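(* Let $\{\mathbf X_\Delta,\mathbf A,p\}$ be a Markov decision process with cemetery $\Delta$ and let $x_0\in\mathbf X$ be a fixed initial state. An occupation measure $\mathsf M\in\mathcal D^f$ is an extreme point of the convex set $\mathcal D^f$ of finite occupation measures if and only if $\mathsf M=\mathsf M^{\varphi}_{x_0}$ for some deterministic stationary strategy $\varphi$.
   Context: Model. $\mathbf X$ and $\mathbf A$ are nonempty topological Borel spaces (homeomorphic to Borel subsets of Polish spaces) with Borel $\sigma$-algebras $\mathcal B(\mathbf X),\mathcal B(\mathbf A)$. The state space is $\mathbf X_\Delta=\mathbf X\cup\{\Delta\}$, where $\Delta\notin\mathbf X$ is an isolated point (cemetery); the action space is $\mathbf A$; $p(dy|x,a)$ is a (Borel measurable) stochastic kernel from $\mathbf X_\Delta\times\mathbf A$ to $\mathcal B(\mathbf X_\Delta)$ with $p(\{\Delta\}|\Delta,a)=1$ for all $a\in\mathbf A$. Strategies. A strategy $\sigma=\{\sigma_n\}_{n\ge1}$ is a sequence of stochastic kernels $\sigma_n(da|x_0,a_1,\dots,x_{n-1})$ from $(\mathbf X_\Delta\times\mathbf A)^{n-1}\times\mathbf X_\Delta$ to $\mathcal B(\mathbf A)$. It is always assumed that $\sigma_n(\{\hat a\}|x_0,a_1,\dots,x_{n-1})=1$ whenever $x_{n-1}=\Delta$, where $\hat a\in\mathbf A$ is an arbitrarily fixed action. A strategy is stationary if there is one stochastic kernel $\sigma^s(da|x)$ from $\mathbf X_\Delta$ to $\mathcal B(\mathbf A)$ with $\sigma_n(da|x_0,a_1,\dots,x_{n-1})=\sigma^s(da|x_{n-1})$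 for all $n$ and all histories. It is deterministic stationary if moreover $\sigma^s(\cdot|x)$ is the Dirac measure at $\varphi(x)$ for a measurable mapping $\varphi$ into $\mathbf A$; the strategy is then denoted by $\varphi$. Strategic measures. For a strategy $\sigma$ and $x_0\in\mathbf X$, $\mathsf P^\sigma_{x_0}$ is the unique probability measure on $\Omega=(\mathbf X_\Delta\times\mathbf A)^\infty$, with coordinates $X_0,A_1,X_1,A_2,\dots$, such that $X_0=x_0$ almost surely, the conditional law of $A_n$ given $(X_0,A_1,\dots,X_{n-1})$ is $\sigma_n(\cdot|X_0,A_1,\dots,X_{n-1})$, and the conditional law of $X_n$ given $(X_0,A_1,\dots,X_{n-1},A_n)$ is $p(\cdot|X_{n-1},A_n)$. Occupation measures. The occupation measure of $\sigma$ is the $[0,\infty]$-valued measure on $\mathcal B(\mathbf X\times\mathbf A)$ (not including $\Delta$) determined by $$\mathsf M^\sigma_{x_0}(\Gamma_X\times\Gamma_A)=\sum_{n=1}^\infty \mathsf P^\sigma_{x_0}(X_{n-1}\in\Gamma_X,\,A_n\in\Gamma_A),\quad \Gamma_X\in\mathcal B(\mathbf X),\ \Gamma_A\in\mathcal B(\mathbf A).$$ $\mathcal D^f=\{\mathsf M^\sigma_{x_0}:\ \sigma\text{ a strategy},\ \mathsf M^\sigma_{x_0}(\mathbf X\times\mathbf A)<\infty\}$; it is a convex subset of the linear space of finite signed measures on $\mathcal B(\mathbf X\times\mathbf A)$. No compactness or continuity is assumed on the model; some strategies may have infinite occupation measures. *)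

theory Defs
  imports "HOL-Probability.Probability" "HOL-Library.Function_Algebras"
begin

subsection \<open>Set functions as a real vector space\<close>

(* Finite signed measures are treated as real-valued set functions with pointwise operations;
   Function_Algebras supplies the additive structure, scalar multiplication is added here.
   A finite measure M enters through "measure M", which determines M once its
   sigma-algebra is fixed. *)

instantiation "fun" :: (type, real_vector) real_vector
begin

definition scaleR_fun :: "real \<Rightarrow> ('a \<Rightarrow> 'b) \<Rightarrow> 'a \<Rightarrow> 'b"
  where "scaleR_fun c f = (\<lambda>x. c *\<^sub>R f x)"

instance
  by standard (simp_all add: scaleR_fun_def fun_eq_iff scaleR_add_right scaleR_add_left)

end


subsection \<open>Topological Borel spaces\<close>

definition borel_of :: "'x topology \<Rightarrow> 'x measure"
  where "borel_of X = sigma (topspace X) {U. openin X U}"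

(* The Polish space lives on its own type 'p. *)
definition topological_borel_space :: "'p::polish_space itself \<Rightarrow> 'x topology \<Rightarrow> bool"
  where "topological_borel_space _ X \<longleftrightarrow>
    (\<exists>B \<in> sets (borel :: 'p measure). X homeomorphic_space top_of_set B)"

lemma space_borel_of [simp]: "space (borel_of X) = topspace X"
  by (simp add: borel_of_def space_measure_of_conv)

lemma sets_borel_of: "sets (borel_of X) = sigma_sets (topspace X) {U. openin X U}"
  unfolding borel_of_def by (rule sets_measure_of) (auto dest: openin_subset)

(* The cemetery is the point None, every x in X being identified with Some x. *)
definition adjoin_isolated :: "'x topology \<Rightarrow> 'x option topology"
  where "adjoin_isolated X = topology (\<lambda>U. openin X {x. Some x \<in> U})"

lemma openin_adjoin_isolated: "openin (adjoin_isolated X) U \<longleftrightarrow> openin X {x. Some x \<in> U}"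
proof -
  have "istopology (\<lambda>U. openin X {x. Some x \<in> U})"
    unfolding istopology_def
  proof (intro conjI allI impI)
    fix S T assume "openin X {x. Some x \<in> S}" "openin X {x. Some x \<in> T}"
    then have "openin X ({x. Some x \<in> S} \<inter> {x. Some x \<in> T})" by (rule openin_Int)
    then show "openin X {x. Some x \<in> S \<inter> T}" by (simp add: Collect_conj_eq)
  next
    fix K assume K: "\<forall>S\<in>K. openin X {x. Some x \<in> S}"
    have "{x. Some x \<in> \<Union> K} = (\<Union>S\<in>K. {x. Some x \<in> S})" by auto
    then show "openin X {x. Some x \<in> \<Union> K}" using K by auto
  qed
  then show ?thesis by (simp add: adjoin_isolated_def topology_inverse')
qed

lemma topspace_adjoin_isolated [simp]:
  "topspace (adjoin_isolated X) = insert None (Some ` topspace X)"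
proof
  show "topspace (adjoin_isolated X) \<subseteq> insert None (Some ` topspace X)"
  proof
    fix y assume "y \<in> topspace (adjoin_isolated X)"
    then obtain U where "openin (adjoin_isolated X) U" "y \<in> U"
      unfolding topspace_def by auto
    then show "y \<in> insert None (Some ` topspace X)"
      by (cases y) (auto simp: openin_adjoin_isolated dest!: openin_subset)
  qed
next
  have "{x. Some x \<in> insert None (Some ` topspace X)} = topspace X" by auto
  then have "openin (adjoin_isolated X) (insert None (Some ` topspace X))"
    by (simp add: openin_adjoin_isolated)
  then show "insert None (Some ` topspace X) \<subseteq> topspace (adjoin_isolated X)"
    by (rule openin_subset)
qed


subsection \<open>Stochastic kernels and conditional laws\<close>

abbreviation stochastic_kernel :: "'a measure \<Rightarrow> 'b measure \<Rightarrow> ('a \<Rightarrow> 'b measure) \<Rightarrow> bool"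
  where "stochastic_kernel M N k \<equiv> k \<in> measurable M (prob_algebra N)"

(* Under P, the conditional law of the N-valued Z given the M-valued Y is k(Y). *)
definition has_conditional_law ::
  "'w measure \<Rightarrow> 'a measure \<Rightarrow> ('w \<Rightarrow> 'a) \<Rightarrow> 'b measure \<Rightarrow> ('w \<Rightarrow> 'b) \<Rightarrow> ('a \<Rightarrow> 'b measure) \<Rightarrow> bool"
  where "has_conditional_law P M Y N Z k \<longleftrightarrow>
    (\<forall>B \<in> sets M. \<forall>C \<in> sets N.
      emeasure P {\<omega> \<in> space P. Y \<omega> \<in> B \<and> Z \<omega> \<in> C}
        = (\<integral>\<^sup>+ \<omega>. emeasure (k (Y \<omega>)) C * indicator B (Y \<omega>) \<partial>P))"


subsection \<open>Markov decision processes with a cemetery\<close>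

locale cemetery_mdp =
  fixes X :: "'x topology"
    and A :: "'a topology"
    and p :: "'x option \<times> 'a \<Rightarrow> 'x option measure"
    and ahat :: 'a
  assumes kernel_p: "stochastic_kernel
      (borel_of (adjoin_isolated X) \<Otimes>\<^sub>M borel_of A) (borel_of (adjoin_isolated X)) p"
    and cemetery_absorbing: "\<And>a. a \<in> topspace A \<Longrightarrow> emeasure (p (None, a)) {None} = 1"
    and ahat_in: "ahat \<in> topspace A"
begin

abbreviation state_borel :: "'x option measure"
  where "state_borel \<equiv> borel_of (adjoin_isolated X)"

abbreviation action_borel :: "'a measure"
  where "action_borel \<equiv> borel_of A"

(* Indices are shifted to start at 0: omega i is the pair (x_i, a_(i+1)). *)
abbreviation trajectory_space :: "(nat \<Rightarrow> 'x option \<times> 'a) measure"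
  where "trajectory_space \<equiv> (\<Pi>\<^sub>M i\<in>UNIV. state_borel \<Otimes>\<^sub>M action_borel)"

(* history_space n carries the histories (x_0, a_1, ..., a_n, x_n): the first n state-action
   pairs, followed by the current state. *)
abbreviation history_space :: "nat \<Rightarrow> ((nat \<Rightarrow> 'x option \<times> 'a) \<times> 'x option) measure"
  where "history_space n \<equiv>
    (\<Pi>\<^sub>M i\<in>{..<n}. state_borel \<Otimes>\<^sub>M action_borel) \<Otimes>\<^sub>M state_borel"

(* sigma n selects the action a_(n+1). *)
definition strategy ::
  "(nat \<Rightarrow> (nat \<Rightarrow> 'x option \<times> 'a) \<times> 'x option \<Rightarrow> 'a measure) \<Rightarrow> bool"
  where "strategy \<sigma> \<longleftrightarrow>
    (\<forall>n. stochastic_kernel (history_space n) action_borel (\<sigma> n)) \<and>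
    (\<forall>n. \<forall>h \<in> space (history_space n). snd h = None \<longrightarrow> emeasure (\<sigma> n h) {ahat} = 1)"

definition deterministic_stationary_strategy ::
  "(nat \<Rightarrow> (nat \<Rightarrow> 'x option \<times> 'a) \<times> 'x option \<Rightarrow> 'a measure) \<Rightarrow> bool"
  where "deterministic_stationary_strategy \<sigma> \<longleftrightarrow>
    strategy \<sigma> \<and>
    (\<exists>\<phi> \<in> measurable state_borel action_borel.
      \<forall>n. \<forall>h \<in> space (history_space n). \<sigma> n h = return action_borel (\<phi> (snd h)))"

definition is_strategic_measure ::
  "'x \<Rightarrow> (nat \<Rightarrow> (nat \<Rightarrow> 'x option \<times> 'a) \<times> 'x option \<Rightarrow> 'a measure)
    \<Rightarrow> (nat \<Rightarrow> 'x option \<times> 'a) measure \<Rightarrow> bool"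
  where "is_strategic_measure x0 \<sigma> P \<longleftrightarrow>
    prob_space P \<and> sets P = sets trajectory_space \<and>
    (AE \<omega> in P. fst (\<omega> 0) = Some x0) \<and>
    (\<forall>n. has_conditional_law P
      (history_space n) (\<lambda>\<omega>. (restrict \<omega> {..<n}, fst (\<omega> n)))
      action_borel (\<lambda>\<omega>. snd (\<omega> n))
      (\<sigma> n)) \<and>
    (\<forall>n. has_conditional_law P
      (\<Pi>\<^sub>M i\<in>{..n}. state_borel \<Otimes>\<^sub>M action_borel) (\<lambda>\<omega>. restrict \<omega> {..n})
      state_borel (\<lambda>\<omega>. fst (\<omega> (Suc n)))
      (\<lambda>h. p (h n)))"

definition strategic_measure ::
  "'x \<Rightarrow> (nat \<Rightarrow> (nat \<Rightarrow> 'x option \<times> 'a) \<times> 'x option \<Rightarrow> 'a measure)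
    \<Rightarrow> (nat \<Rightarrow> 'x option \<times> 'a) measure"
  where "strategic_measure x0 \<sigma> = (THE P. is_strategic_measure x0 \<sigma> P)"

(* The product sigma-algebra is the Borel sigma-algebra of the product, since X and A are
   second countable.  The cemetery is not counted: only the events omega n = (Some x, a)
   with (x, a) in E contribute. *)
definition occupation_measure ::
  "'x \<Rightarrow> (nat \<Rightarrow> (nat \<Rightarrow> 'x option \<times> 'a) \<times> 'x option \<Rightarrow> 'a measure) \<Rightarrow> ('x \<times> 'a) measure"
  where "occupation_measure x0 \<sigma> =
    measure_of (topspace X \<times> topspace A) (sets (borel_of X \<Otimes>\<^sub>M borel_of A))
      (\<lambda>E. \<Sum>n. emeasure (strategic_measure x0 \<sigma>)
        {\<omega> \<in> space (strategic_measure x0 \<sigma>). \<omega> n \<in> map_prod Some id ` E})"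

definition finite_occupation_measures :: "'x \<Rightarrow> ('x \<times> 'a) measure set"
  where "finite_occupation_measures x0 =
    {occupation_measure x0 \<sigma> | \<sigma>. strategy \<sigma> \<and>
      emeasure (occupation_measure x0 \<sigma>) (topspace X \<times> topspace A) < \<infinity>}"

end

end

theory Submission
  imports Defs
begin

text \<open>
  For a fixed stochastic kernel \<open>\<pi>\<close>, a finite occupation measure \<open>M\<close> that disintegrates along \<open>\<pi>\<close>
  is the occupation measure of the stationary strategy \<open>\<pi>\<close>.  If \<open>M\<close> comes from a deterministic
  stationary \<open>\<phi>\<close>, the components of a convex decomposition of \<open>M\<close> are carried by the graph of \<open>\<phi>\<close>
  and hence coincide with \<open>M\<close>.  Conversely, disintegrate an extreme \<open>M\<close> along some \<open>\<pi>\<close>; for a set \<open>B\<close>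
  of actions, tilting \<open>\<pi>\<close> at one single time towards \<open>B\<close>, respectively towards its complement, gives
  two strategies whose occupation measures average to \<open>M\<close>.  By extremality the tilt has no effect,
  so \<open>\<pi>(B|x)\<close> is almost surely 0 or 1, and \<open>\<pi>\<close> is a Dirac kernel.
\<close>

section \<open>Products of measures with kernels\<close>

text \<open>The delicate point is that \<open>M\<close> is reproduced by a stationary strategy.
  Unrolling the balance equation \<open>n\<close> times writes \<open>M\<close> as the occupation of
  the first \<open>n\<close> steps plus a remainder. For an arbitrary finite solution of the balance
  equation this remainder may persist as an invariant part; it is excluded because \<open>M\<close>
  comes from an actual strategy. The tilt is confined to one time because occupation measures are
  affine in the kernel used at one given time, but not in a kernel used at all times. The two tilted
  occupation measures add up to \<open>2 M\<close>, so both are finite and compete in the convex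
  set. Since the exceptional null set of states depends on \<open>B\<close>, a real code of the
  action space with a measurable left inverse reduces matters to countably many \<open>B\<close>;
  the same code yields the disintegration. Integrals are computed on
  \<open>X_Delta \<times> A\<close>, where the kernels act, with the cemetery removed by a
  density.\<close>

definition kernel_prod ::
  "'a measure \<Rightarrow> 'b measure \<Rightarrow> 'a measure \<Rightarrow> ('a \<Rightarrow> 'b measure) \<Rightarrow> ('a \<times> 'b) measure"
  where "kernel_prod M N q k = q \<bind> (\<lambda>x. distr (k x) (M \<Otimes>\<^sub>M N) (Pair x))"

lemma kernel_prod_kernel_measurable:
  assumes "k \<in> measurable M (prob_algebra N)"
  shows "(\<lambda>x. distr (k x) (M \<Otimes>\<^sub>M N) (Pair x)) \<in> measurable M (prob_algebra (M \<Otimes>\<^sub>M N))"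
  using assms by (intro measurable_distr_prob_space2) auto

lemma sets_kernel_prod:
  assumes "k \<in> measurable M (prob_algebra N)" "sets q = sets M" "space M \<noteq> {}"
  shows "sets (kernel_prod M N q k) = sets (M \<Otimes>\<^sub>M N)"
  unfolding kernel_prod_def
  using assms by (intro sets_bind) (auto dest: sets_eq_imp_space_eq)

lemma nn_integral_kernel_prod:
  assumes k: "k \<in> measurable M (prob_algebra N)" and q: "sets q = sets M"
    and h: "h \<in> borel_measurable (M \<Otimes>\<^sub>M N)"
  shows "(\<integral>\<^sup>+z. h z \<partial>kernel_prod M N q k) = (\<integral>\<^sup>+x. \<integral>\<^sup>+a. h (x, a) \<partial>k x \<partial>q)"
proof -
  have "(\<lambda>x. distr (k x) (M \<Otimes>\<^sub>M N) (Pair x)) \<in> measurable q (subprob_algebra (M \<Otimes>\<^sub>M N))"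
    using kernel_prod_kernel_measurable[OF k] q
    by (auto simp: measurable_cong_sets[OF q refl] intro: measurable_prob_algebraD)
  then have "(\<integral>\<^sup>+z. h z \<partial>kernel_prod M N q k)
      = (\<integral>\<^sup>+x. \<integral>\<^sup>+z. h z \<partial>distr (k x) (M \<Otimes>\<^sub>M N) (Pair x) \<partial>q)"
    unfolding kernel_prod_def by (rule nn_integral_bind[OF h])
  also have "\<dots> = (\<integral>\<^sup>+x. \<integral>\<^sup>+a. h (x, a) \<partial>k x \<partial>q)"
  proof (rule nn_integral_cong)
    fix x assume "x \<in> space q"
    then have x: "x \<in> space M" using q by (auto dest: sets_eq_imp_space_eq)
    then have "sets (k x) = sets N"
      using measurable_space[OF k x] by (simp add: space_prob_algebra)
    then have "Pair x \<in> measurable (k x) (M \<Otimes>\<^sub>M N)"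
      using x by (auto simp: measurable_cong_sets[of "k x" N])
    then show "(\<integral>\<^sup>+z. h z \<partial>distr (k x) (M \<Otimes>\<^sub>M N) (Pair x)) = (\<integral>\<^sup>+a. h (x, a) \<partial>k x)"
      using h by (intro nn_integral_distr) auto
  qed
  finally show ?thesis .
qed

lemma emeasure_kernel_prod:
  assumes k: "k \<in> measurable M (prob_algebra N)" and q: "sets q = sets M" "space M \<noteq> {}"
    and B: "B \<in> sets M" and C: "C \<in> sets N"
  shows "emeasure (kernel_prod M N q k) (B \<times> C) = (\<integral>\<^sup>+x. emeasure (k x) C * indicator B x \<partial>q)"
proof -
  have BC: "B \<times> C \<in> sets (M \<Otimes>\<^sub>M N)" using B C by auto
  have "emeasure (kernel_prod M N q k) (B \<times> C)
      = (\<integral>\<^sup>+z. indicator (B \<times> C) z \<partial>kernel_prod M N q k)"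
    using BC by (simp add: sets_kernel_prod[OF k q])
  also have "\<dots> = (\<integral>\<^sup>+x. \<integral>\<^sup>+a. indicator (B \<times> C) (x, a) \<partial>k x \<partial>q)"
    using BC by (intro nn_integral_kernel_prod[OF k q(1)]) auto
  also have "\<dots> = (\<integral>\<^sup>+x. emeasure (k x) C * indicator B x \<partial>q)"
  proof (rule nn_integral_cong)
    fix x assume "x \<in> space q"
    then have "x \<in> space M" using q by (auto dest: sets_eq_imp_space_eq)
    then have "C \<in> sets (k x)"
      using measurable_space[OF k] C by (auto simp: space_prob_algebra)
    then show "(\<integral>\<^sup>+a. indicator (B \<times> C) (x, a) \<partial>k x) = emeasure (k x) C * indicator B x"
      by (cases "x \<in> B") (auto simp: indicator_times)
  qed
  finally show ?thesis .
qed

text \<open>Rectangles are an intersection-stable generator; the constant sequence at the full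
  rectangle exhausts the space, and \<open>\<mu>\<close> is finite on it.\<close>

lemma measure_eqI_rectangles:
  assumes "finite_measure \<mu>" "sets \<mu> = sets (M \<Otimes>\<^sub>M N)" "sets \<nu> = sets (M \<Otimes>\<^sub>M N)"
    and eq: "\<And>B C. B \<in> sets M \<Longrightarrow> C \<in> sets N \<Longrightarrow> emeasure \<mu> (B \<times> C) = emeasure \<nu> (B \<times> C)"
  shows "\<mu> = \<nu>"
proof (rule measure_eqI_generator_eq[OF Int_stable_pair_measure_generator, of M N "space M \<times> space N" _ _ "\<lambda>_. space M \<times> space N"])
  interpret finite_measure \<mu> by fact
  show "emeasure \<mu> (space M \<times> space N) \<noteq> \<infinity>" by simp
qed (use assms in \<open>auto simp: sets_pair_measure space_pair_measure dest: sets.sets_into_space\<close>)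

text \<open>Turns the rectangle identities of \<open>has_conditional_law\<close> into one equation
  of measures, which can be integrated against any measurable function and pushed forward.
  Uniqueness of strategic measures and the step laws are derived from it.\<close>

lemma has_conditional_law_iff_kernel_prod:
  assumes P: "prob_space P" and Y: "Y \<in> measurable P M" and Z: "Z \<in> measurable P N"
    and k: "k \<in> measurable M (prob_algebra N)"
  shows "has_conditional_law P M Y N Z k \<longleftrightarrow>
    distr P (M \<Otimes>\<^sub>M N) (\<lambda>\<omega>. (Y \<omega>, Z \<omega>)) = kernel_prod M N (distr P M Y) k"
proof -
  interpret P: prob_space P by fact
  have ne: "space M \<noteq> {}" using P.not_empty measurable_space[OF Y] by auto
  have YZ: "(\<lambda>\<omega>. (Y \<omega>, Z \<omega>)) \<in> measurable P (M \<Otimes>\<^sub>M N)" using Y Z by measurable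
  let ?\<mu> = "distr P (M \<Otimes>\<^sub>M N) (\<lambda>\<omega>. (Y \<omega>, Z \<omega>))" and ?\<nu> = "kernel_prod M N (distr P M Y) k"
  have fin: "finite_measure ?\<mu>" by (intro P.finite_measure_distr YZ)
  have 1: "emeasure ?\<mu> (B \<times> C) = emeasure P {\<omega> \<in> space P. Y \<omega> \<in> B \<and> Z \<omega> \<in> C}"
    if "B \<in> sets M" "C \<in> sets N" for B C
    using that by (subst emeasure_distr[OF YZ]) (auto intro!: arg_cong[where f="emeasure P"])
  have 2: "emeasure ?\<nu> (B \<times> C) = (\<integral>\<^sup>+ \<omega>. emeasure (k (Y \<omega>)) C * indicator B (Y \<omega>) \<partial>P)"
    if "B \<in> sets M" "C \<in> sets N" for B C
  proof -
    have "(\<lambda>x. emeasure (k x) C * indicator B x) \<in> borel_measurable M"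
      using that measurable_emeasure_kernel[OF measurable_prob_algebraD[OF k]] by auto
    then show ?thesis
      using that by (simp add: emeasure_kernel_prod[OF k _ ne] nn_integral_distr[OF Y])
  qed
  show ?thesis
    unfolding has_conditional_law_def
  proof
    assume *: "\<forall>B\<in>sets M. \<forall>C\<in>sets N. emeasure P {\<omega> \<in> space P. Y \<omega> \<in> B \<and> Z \<omega> \<in> C}
        = (\<integral>\<^sup>+ \<omega>. emeasure (k (Y \<omega>)) C * indicator B (Y \<omega>) \<partial>P)"
    show "?\<mu> = ?\<nu>"
      by (rule measure_eqI_rectangles[OF fin, of M N])
        (use * in \<open>simp_all add: 1 2 sets_kernel_prod[OF k _ ne]\<close>)
  next
    assume "?\<mu> = ?\<nu>"
    then show "\<forall>B\<in>sets M. \<forall>C\<in>sets N. emeasure P {\<omega> \<in> space P. Y \<omega> \<in> B \<and> Z \<omega> \<in> C}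
        = (\<integral>\<^sup>+ \<omega>. emeasure (k (Y \<omega>)) C * indicator B (Y \<omega>) \<partial>P)"
      by (simp add: 1[symmetric] 2[symmetric])
  qed
qed

section \<open>Disintegration\<close>

text \<open>Integrate over the set \<open>B\<close> where the claim fails: there
  \<open>f - g\<close> is positive, yet its integral is 0. Finiteness of the integral of
  \<open>g\<close> makes the subtraction in \<open>ennreal\<close> legitimate.\<close>

lemma AE_le_of_nn_integral_indicator_le:
  assumes f: "f \<in> borel_measurable M" and g: "g \<in> borel_measurable M"
    and fin: "(\<integral>\<^sup>+x. g x \<partial>M) \<noteq> \<infinity>"
    and le: "\<And>B. B \<in> sets M \<Longrightarrow> (\<integral>\<^sup>+x. f x * indicator B x \<partial>M) \<le> (\<integral>\<^sup>+x. g x * indicator B x \<partial>M)"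
  shows "AE x in M. f x \<le> (g x :: ennreal)"
proof -
  define B where "B = {x \<in> space M. g x < f x}"
  have B[measurable]: "B \<in> sets M" unfolding B_def using f g by measurable
  have finB: "(\<integral>\<^sup>+x. g x * indicator B x \<partial>M) \<noteq> \<infinity>"
  proof -
    have "(\<integral>\<^sup>+x. g x * indicator B x \<partial>M) \<le> (\<integral>\<^sup>+x. g x \<partial>M)"
      by (intro nn_integral_mono) (auto split: split_indicator)
    then show ?thesis using fin by (auto simp: top_unique)
  qed
  have "(\<integral>\<^sup>+x. f x * indicator B x - g x * indicator B x \<partial>M)
      = (\<integral>\<^sup>+x. f x * indicator B x \<partial>M) - (\<integral>\<^sup>+x. g x * indicator B x \<partial>M)"
    using f g finB by (intro nn_integral_diff) (auto simp: B_def split: split_indicator)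
  also have "\<dots> = 0" using le[OF B] by (subst diff_eq_0_iff_ennreal) (use finB in \<open>auto simp: diff_eq_0_iff_ennreal top.not_eq_extremum\<close>)
  finally have "AE x in M. f x * indicator B x - g x * indicator B x = 0"
    using f g by (subst (asm) nn_integral_0_iff_AE) auto
  moreover have "AE x in M. g x \<noteq> \<infinity>" using g fin by (intro nn_integral_PInf_AE) auto
  ultimately show ?thesis
    using AE_space
    by eventually_elim
      (auto simp: B_def diff_eq_0_iff_ennreal not_less split: split_indicator_asm)
qed

text \<open>Regular conditional distributions for a real second coordinate. The conditional
  distribution function at \<open>q\<close> is a Radon-Nikodym derivative with respect to the first
  marginal, so it is known only up to a null set depending on \<open>q\<close>; it is rebuilt from
  its rational values so that every single \<open>x\<close> yields a genuine distribution
  function.\<close>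

lemma disintegration_real:
  fixes \<nu> :: "('a \<times> real) measure"
  assumes fin: "finite_measure \<nu>" and sets: "sets \<nu> = sets (S \<Otimes>\<^sub>M borel)"
    and supp: "emeasure \<nu> (space S \<times> - {0..1}) = 0" and ne: "space S \<noteq> {}"
  obtains k where "k \<in> measurable S (prob_algebra borel)"
    "\<nu> = kernel_prod S borel (distr \<nu> S fst) k"
proof -
  interpret \<nu>: finite_measure \<nu> by fact
  define m where "m = distr \<nu> S fst"
  have spnu: "space \<nu> = space S \<times> UNIV"
    using sets_eq_imp_space_eq[OF sets] by (simp add: space_pair_measure)
  have fst: "fst \<in> measurable \<nu> S" by (simp add: measurable_cong_sets[OF sets refl])
  have sm[simp]: "sets m = sets S" "space m = space S" by (auto simp: m_def)
  interpret m: finite_measure m unfolding m_def by (intro \<nu>.finite_measure_distr fst)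
  have em: "emeasure m B = emeasure \<nu> (B \<times> UNIV)" if "B \<in> sets S" for B
    using that sets.sets_into_space[OF that] unfolding m_def
    by (subst emeasure_distr[OF fst]) (auto simp: spnu intro!: arg_cong[where f="emeasure \<nu>"])
  have ssets: "B \<times> {..r} \<in> sets \<nu>" if "B \<in> sets S" for B and r :: real using that by (auto simp: sets)
  \<comment> \<open>The measure on \<open>S\<close> to be differentiated: \<open>\<nu>\<close>
    restricted to second coordinates at most \<open>q\<close>, then projected.\<close>
  define N where "N q = distr (density \<nu> (indicator (space S \<times> {..q::real}))) S fst" for q
  have eN: "emeasure (N q) B = emeasure \<nu> (B \<times> {..q})" if "B \<in> sets S" for B q
  proof -
    have "emeasure (N q) B = emeasure (density \<nu> (indicator (space S \<times> {..q}))) (B \<times> UNIV)"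
      unfolding N_def using that sets.sets_into_space[OF that]
      by (subst emeasure_distr)
        (auto simp: spnu measurable_cong_sets[OF sets refl] intro!: arg_cong[where f="emeasure _"])
    also have "\<dots> = emeasure \<nu> ((space S \<times> {..q}) \<inter> (B \<times> UNIV))"
      using that ssets[of "space S" q]
      by (subst emeasure_density)
        (auto simp: sets indicator_inter_arith[symmetric] measurable_cong_sets[OF sets refl]
          simp del: nn_integral_indicator intro!: nn_integral_indicator)
    also have "(space S \<times> {..q}) \<inter> (B \<times> UNIV) = B \<times> {..q}"
      using sets.sets_into_space[OF that] by auto
    finally show ?thesis .
  qed
  \<comment> \<open>Outside \<open>0 \<le> q < 1\<close> the version is fixed by hand, which
    \<open>supp\<close> permits; elsewhere it is truncated at 1. Bounds and limits then hold for
    every \<open>x\<close>, and no exceptional null set has to be removed later.\<close>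
  have "\<exists>f. f \<in> borel_measurable S \<and> (\<forall>x. f x \<le> 1) \<and> (q < 0 \<longrightarrow> (\<forall>x. f x = 0)) \<and> (1 \<le> q \<longrightarrow> (\<forall>x. f x = 1)) \<and>
      (\<forall>B\<in>sets S. (\<integral>\<^sup>+x. f x * indicator B x \<partial>m) = emeasure \<nu> (B \<times> {..q}))" for q
  proof -
    consider "q < 0" | "1 \<le> q" | "0 \<le> q" "q < 1" by linarith
    then show ?thesis
    proof cases
      case 1
      have "emeasure \<nu> (B \<times> {..q}) = 0" if "B \<in> sets S" for B
      proof -
        have "emeasure \<nu> (B \<times> {..q}) \<le> emeasure \<nu> (space S \<times> - {0..1})"
          using 1 that sets.sets_into_space[OF that] by (intro emeasure_mono) (auto simp: sets)
        then show ?thesis using supp by simp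
      qed
      then show ?thesis using 1 by (intro exI[of _ "\<lambda>_. 0"]) auto
    next
      case 2
      have "emeasure \<nu> (B \<times> {..q}) = emeasure m B" if "B \<in> sets S" for B
      proof -
        have "AE z in \<nu>. snd z \<le> q"
          by (rule AE_I[OF _ supp]) (use 2 in \<open>auto simp: sets spnu\<close>)
        then have "emeasure \<nu> (B \<times> {..q}) = emeasure \<nu> (B \<times> UNIV)"
          using that by (intro emeasure_eq_AE) (auto simp: sets)
        then show ?thesis by (simp add: em that)
      qed
      then show ?thesis using 2 by (intro exI[of _ "\<lambda>_. 1"]) auto
    next
      case 3
      have ac: "absolutely_continuous m (N q)"
        unfolding absolutely_continuous_def
      proof
        fix B assume "B \<in> null_sets m"
        then have B: "B \<in> sets S" "emeasure \<nu> (B \<times> UNIV) = 0" by (auto simp: null_sets_def em)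
        have "emeasure \<nu> (B \<times> {..q}) \<le> emeasure \<nu> (B \<times> UNIV)"
          using B by (intro emeasure_mono) (auto simp: sets)
        then show "B \<in> null_sets (N q)" using B eN by (auto simp: null_sets_def N_def)
      qed
      have "sets (N q) = sets m" by (simp add: N_def)
      then obtain f where f: "f \<in> borel_measurable m" "density m f = N q"
        using m.Radon_Nikodym ac by blast
      have int: "(\<integral>\<^sup>+x. f x * indicator B x \<partial>m) = emeasure \<nu> (B \<times> {..q})" if "B \<in> sets S" for B
        using emeasure_density[OF f(1), of B] f(2) eN[OF that] that by simp
      have "AE x in m. f x \<le> 1"
      proof (rule AE_le_of_nn_integral_indicator_le)
        fix B assume "B \<in> sets m"
        then show "(\<integral>\<^sup>+x. f x * indicator B x \<partial>m) \<le> (\<integral>\<^sup>+x. 1 * indicator B x \<partial>m)"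
          by (simp add: int em) (intro emeasure_mono, auto simp: sets)
      qed (use f in auto)
      then have "AE x in m. min 1 (f x) = f x" by eventually_elim (auto simp: min_def)
      then have "(\<integral>\<^sup>+x. min 1 (f x) * indicator B x \<partial>m) = (\<integral>\<^sup>+x. f x * indicator B x \<partial>m)" for B
        by (intro nn_integral_cong_AE) auto
      then show ?thesis using f(1) 3 int
        by (intro exI[of _ "\<lambda>x. min 1 (f x)"]) (auto simp: measurable_cong_sets[OF sm(1) refl])
    qed
  qed
  then obtain f where fm[measurable]: "\<And>q. f q \<in> borel_measurable S" and f1: "\<And>q x. f q x \<le> 1"
    and f0: "\<And>q x. q < 0 \<Longrightarrow> f q x = 0" and f2: "\<And>q x. 1 \<le> q \<Longrightarrow> f q x = 1"
    and f: "\<And>q B. B \<in> sets S \<Longrightarrow> (\<integral>\<^sup>+x. f q x * indicator B x \<partial>m) = emeasure \<nu> (B \<times> {..q})"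
    by metis
  have ftop: "f q x < \<top>" for q x using f1[of q x] by (rule le_less_trans) simp
  have le: "AE x in m. f q x \<le> f r x" if "q \<le> r" for q r
  proof (rule AE_le_of_nn_integral_indicator_le)
    have "(\<integral>\<^sup>+x. f r x \<partial>m) \<le> (\<integral>\<^sup>+x. 1 \<partial>m)" by (intro nn_integral_mono f1)
    then show "(\<integral>\<^sup>+x. f r x \<partial>m) \<noteq> \<infinity>" using m.emeasure_finite by (auto simp: top_unique)
    fix B assume "B \<in> sets m"
    then show "(\<integral>\<^sup>+x. f q x * indicator B x \<partial>m) \<le> (\<integral>\<^sup>+x. f r x * indicator B x \<partial>m)"
      using that by (simp add: f) (intro emeasure_mono, auto simp: sets)
  qed (auto simp: measurable_cong_sets[OF sm(1) refl])
  \<comment> \<open>The infimum over rationals beyond \<open>r\<close> is monotone and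
    right-continuous in \<open>r\<close> for every \<open>x\<close>, even at those \<open>x\<close>
    where \<open>f\<close> fails to be monotone in \<open>q\<close>.\<close>
  define F where "F x r = (INF q\<in>\<rat> \<inter> {r<..}. enn2real (f q x))" for x and r :: real
  have Q: "\<rat> \<inter> {r<..} \<noteq> {}" for r :: real
    using Rats_dense_in_real[of r "r + 1"] by auto
  have bdd: "bdd_below ((\<lambda>q. enn2real (f q x)) ` I)" for x I by (rule bdd_belowI[of _ 0]) auto
  have F_mono: "F x r \<le> F x s" if "r \<le> s" for x r s
    unfolding F_def using that by (intro cINF_superset_mono Q bdd) auto
  have F_le: "F x r \<le> enn2real (f q x)" if "q \<in> \<rat>" "r < q" for x r q
    unfolding F_def using that by (intro cINF_lower bdd) auto
  have F_ge: "c \<le> F x r" if "\<And>q. q \<in> \<rat> \<Longrightarrow> r < q \<Longrightarrow> c \<le> enn2real (f q x)" for x r c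
    unfolding F_def using that by (intro cINF_greatest Q) auto
  have F_nonneg: "0 \<le> F x r" for x r by (rule F_ge) simp
  have F_cont: "continuous (at_right r) (F x)" for x r
  proof (subst continuous_at_right_real_increasing[OF F_mono], safe)
    fix e :: real assume "e > 0"
    then have "F x r < F x r + e" by simp
    then obtain q where q: "q \<in> \<rat>" "r < q" "enn2real (f q x) < F x r + e"
      unfolding F_def using Q bdd by (subst (asm) cINF_less_iff) auto
    obtain s where s: "r < s" "s < q" using dense q by blast
    then have "F x s \<le> enn2real (f q x)" by (intro F_le q)
    then show "\<exists>d>0. F x (r + d) - F x r < e"
      using q s by (intro exI[of _ "s - r"]) auto
  qed
  have F0: "F x r = 0" if "r < 0" for x r
  proof -
    obtain q where "q \<in> \<rat>" "r < q" "q < 0" using Rats_dense_in_real[OF \<open>r < 0\<close>] by auto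
    then show ?thesis using F_le[of q r x] F_nonneg[of x r] f0 by simp
  qed
  have F1: "F x r = 1" if "1 \<le> r" for x r
    unfolding F_def using that f2 by (subst INF_cong[OF refl, of _ _ "\<lambda>_. 1"]) (auto simp: Q)
  have lim0: "(F x \<longlongrightarrow> 0) at_bot" for x
    by (rule tendsto_eventually) (use F0 in \<open>auto simp: eventually_at_bot_dense\<close>)
  have lim1: "(F x \<longlongrightarrow> 1) at_top" for x
    by (rule tendsto_eventually) (use F1 in \<open>auto simp: eventually_at_top_linorder\<close>)
  define k where "k x = interval_measure (F x)" for x
  have rd: "real_distribution (k x)" for x
    unfolding k_def by (intro real_distribution_interval_measure F_mono F_cont lim0 lim1)
  have kIic: "emeasure (k x) {..r} = ennreal (F x r)" for x r
    unfolding k_def by (intro emeasure_interval_measure_Iic F_mono F_cont lim0)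
  have Fm[measurable]: "(\<lambda>x. F x r) \<in> borel_measurable S" for r
    unfolding F_def by (intro borel_measurable_cINF_real) (auto intro: countable_rat)
  have k: "k \<in> measurable S (prob_algebra borel)"
  proof (rule measurable_prob_algebra_generated[where \<Omega>=UNIV and G="range (\<lambda>r. {..r})"])
    show "sets (borel :: real measure) = sigma_sets UNIV (range (\<lambda>r. {..r}))"
      unfolding borel_eq_atMost by (rule sets_measure_of) auto
    show "Int_stable (range (\<lambda>r::real. {..r}))" by (auto simp: Int_stable_def intro!: image_eqI[where x="min _ _"])
    show "prob_space (k x)" for x using rd[of x] by (simp add: real_distribution_def)
    show "sets (k x) = sets borel" for x by (simp add: k_def)
  qed (auto simp: kIic)
  \<comment> \<open>One inequality: almost surely \<open>f r x \<le> f q x\<close> for all rational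
    \<open>q > r\<close> at once. The other: let rational levels tend to \<open>r\<close> from above
    and use continuity of \<open>\<nu>\<close> from above.\<close>
  have key: "(\<integral>\<^sup>+x. ennreal (F x r) * indicator B x \<partial>m) = emeasure \<nu> (B \<times> {..r})" if B: "B \<in> sets S" for B r
  proof (rule antisym)
    have fF: "AE x in m. f r x \<le> ennreal (F x r)"
    proof -
      have "AE x in m. \<forall>q\<in>\<rat> \<inter> {r<..}. f r x \<le> f q x"
        by (subst AE_ball_countable) (auto intro: countable_rat le)
      then show ?thesis
      proof eventually_elim
        case (elim x)
        have "enn2real (f r x) \<le> F x r"
          using elim ftop by (intro F_ge enn2real_mono) auto
        then have "ennreal (enn2real (f r x)) \<le> ennreal (F x r)" by (rule ennreal_leI)
        then show ?case by (simp add: ennreal_enn2real[OF ftop])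
      qed
    qed
    have "emeasure \<nu> (B \<times> {..r}) = (\<integral>\<^sup>+x. f r x * indicator B x \<partial>m)" by (simp add: f B)
    also have "\<dots> \<le> (\<integral>\<^sup>+x. ennreal (F x r) * indicator B x \<partial>m)"
      using fF by (intro nn_integral_mono_AE) (auto simp: mult_right_mono)
    finally show "emeasure \<nu> (B \<times> {..r}) \<le> (\<integral>\<^sup>+x. ennreal (F x r) * indicator B x \<partial>m)" .
    \<comment> \<open>The levels must be rational to bound \<open>F\<close>; the real levels
      \<open>r + 1 / Suc n\<close> above them supply the decreasing sequence of sets.\<close>
    have "\<exists>y. y \<in> \<rat> \<and> r < y \<and> y < r + 1 / Suc n" for n :: nat
      using Rats_dense_in_real[of r "r + 1 / Suc n"] by auto
    then have "\<exists>q. \<forall>n::nat. q n \<in> \<rat> \<and> r < q n \<and> q n < r + 1 / Suc n" by (intro choice allI)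
    then obtain q where q: "\<And>n::nat. q n \<in> \<rat>" "\<And>n::nat. r < q n" "\<And>n::nat. q n < r + 1 / Suc n" by blast
    have "(\<integral>\<^sup>+x. ennreal (F x r) * indicator B x \<partial>m) \<le> emeasure \<nu> (B \<times> {..r + 1 / Suc n})" for n :: nat
    proof -
      have "(\<integral>\<^sup>+x. ennreal (F x r) * indicator B x \<partial>m) \<le> (\<integral>\<^sup>+x. f (q n) x * indicator B x \<partial>m)"
      proof (intro nn_integral_mono mult_right_mono)
        show "ennreal (F x r) \<le> f (q n) x" for x
          using ennreal_leI[OF F_le[OF q(1)[of n] q(2)[of n], of x]] by (simp add: ennreal_enn2real[OF ftop])
      qed auto
      also have "\<dots> = emeasure \<nu> (B \<times> {..q n})" by (simp add: f B)
      also have "\<dots> \<le> emeasure \<nu> (B \<times> {..r + 1 / Suc n})"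
        using q(3)[of n] B by (intro emeasure_mono) (auto simp: sets)
      finally show ?thesis .
    qed
    then have "(\<integral>\<^sup>+x. ennreal (F x r) * indicator B x \<partial>m) \<le> (INF n. emeasure \<nu> (B \<times> {..r + 1 / Suc n}))"
      by (intro INF_greatest)
    also have "\<dots> = emeasure \<nu> (\<Inter>n. B \<times> {..r + 1 / Suc n})"
      by (intro INF_emeasure_decseq) (auto simp: sets B decseq_def frac_le intro: order_trans)
    also have "(\<Inter>n. B \<times> {..r + 1 / Suc n}) = B \<times> {..r}"
    proof -
      have "(\<forall>n::nat. s \<le> r + 1 / real (Suc n)) \<longleftrightarrow> s \<le> r" for s
      proof
        assume s: "\<forall>n::nat. s \<le> r + 1 / real (Suc n)"
        have "(\<lambda>n. r + 1 / Suc n) \<longlonglongrightarrow> r + 0"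
          by (intro tendsto_add tendsto_const LIMSEQ_Suc[OF lim_1_over_n])
        then have "s \<le> r + 0" by (rule LIMSEQ_le_const) (use s in auto)
        then show "s \<le> r" by simp
      qed (auto intro: add_increasing2)
      then show ?thesis by (auto simp del: of_nat_Suc)
    qed
    finally show "(\<integral>\<^sup>+x. ennreal (F x r) * indicator B x \<partial>m) \<le> emeasure \<nu> (B \<times> {..r})" .
  qed
  have "\<nu> = kernel_prod S borel m k"
  proof (rule measure_eqI_rectangles[OF fin sets])
    fix B and C :: "real set" assume B: "B \<in> sets S" and C: "C \<in> sets borel"
    \<comment> \<open>With \<open>B\<close> fixed a finite Borel measure on the line remains, so
      agreement on half-lines, known from \<open>key\<close>, extends to every Borel
      \<open>C\<close> by uniqueness of distribution functions.\<close>
    define D where "D \<mu> = distr (density \<mu> (indicator (B \<times> UNIV))) borel snd" for \<mu> :: "('a \<times> real) measure"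
    have D: "emeasure (D \<mu>) E = emeasure \<mu> (B \<times> E)" "finite_borel_measure (D \<mu>)"
      if \<mu>: "finite_measure \<mu>" "sets \<mu> = sets (S \<Otimes>\<^sub>M borel)" and E: "E \<in> sets borel" for \<mu> E
    proof -
      interpret \<mu>: finite_measure \<mu> by fact
      have sp: "space \<mu> = space S \<times> UNIV"
        using sets_eq_imp_space_eq[OF \<mu>(2)] by (simp add: space_pair_measure)
      have *: "emeasure (D \<mu>) E = emeasure \<mu> (B \<times> E)" if "E \<in> sets borel" for E
      proof -
        have "snd -` E \<inter> space \<mu> = space S \<times> E" by (auto simp: sp)
        moreover have "(\<integral>\<^sup>+z. indicator (B \<times> UNIV) z * indicator (space S \<times> E) z \<partial>\<mu>) = emeasure \<mu> (B \<times> E)"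
          using B that sets.sets_into_space[OF B]
          by (subst nn_integral_indicator[symmetric])
            (auto simp: \<mu> simp del: nn_integral_indicator intro!: nn_integral_cong split: split_indicator)
        ultimately show ?thesis
          unfolding D_def using B that
          by (simp add: emeasure_distr measurable_cong_sets[OF \<mu>(2) refl] emeasure_density \<mu>)
      qed
      show "emeasure (D \<mu>) E = emeasure \<mu> (B \<times> E)" by (rule *) fact
      have "emeasure (D \<mu>) (space (D \<mu>)) \<noteq> \<infinity>"
        using *[of UNIV] by (simp add: D_def)
      then show "finite_borel_measure (D \<mu>)"
        by (auto simp: finite_borel_measure_def finite_borel_measure_axioms_def D_def intro: finite_measureI)
    qed
    let ?\<nu>' = "kernel_prod S borel m k"
    have sets': "sets ?\<nu>' = sets (S \<Otimes>\<^sub>M borel)" by (simp add: sets_kernel_prod[OF k _ ne])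
    have k': "emeasure ?\<nu>' (B \<times> E) = (\<integral>\<^sup>+x. emeasure (k x) E * indicator B x \<partial>m)"
      if "B \<in> sets S" "E \<in> sets borel" for B E
      using that by (intro emeasure_kernel_prod[OF k _ ne]) auto
    have fin': "finite_measure ?\<nu>'"
    proof (rule finite_measureI)
      have "emeasure ?\<nu>' (space ?\<nu>') = (\<integral>\<^sup>+x. emeasure (k x) UNIV * indicator (space S) x \<partial>m)"
        using sets_eq_imp_space_eq[OF sets'] k'[of "space S" UNIV] by (simp add: space_pair_measure)
      also have "\<dots> \<le> (\<integral>\<^sup>+x. 1 \<partial>m)"
        using rd by (intro nn_integral_mono)
          (auto simp: real_distribution_def real_distribution_axioms_def indicator_def dest: prob_space.emeasure_le_1)
      finally show "emeasure ?\<nu>' (space ?\<nu>') \<noteq> \<infinity>"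
        using m.emeasure_finite by (auto simp: top_unique)
    qed
    have "emeasure (D \<nu>) {..r} = emeasure (D ?\<nu>') {..r}" for r
      by (simp add: D(1)[OF fin sets] D(1)[OF fin' sets'] k' B kIic key)
    then have "cdf (D \<nu>) = cdf (D ?\<nu>')" by (simp add: cdf_def measure_def fun_eq_iff)
    then have "D \<nu> = D ?\<nu>'"
      using D(2)[OF fin sets C] D(2)[OF fin' sets' C] by (intro cdf_unique') auto
    then show "emeasure \<nu> (B \<times> C) = emeasure ?\<nu>' (B \<times> C)"
      using D(1)[OF fin sets C] D(1)[OF fin' sets' C] by simp
  qed (simp_all add: sets_kernel_prod[OF k _ ne])
  then show thesis using that k by (simp add: m_def)
qed

text \<open>Push \<open>\<mu>\<close> to the line by the code \<open>c\<close>, disintegrate there,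
  and push the kernel back by \<open>d\<close>. As \<open>d\<close> is measurable on the whole line,
  the result is a probability kernel for every \<open>x\<close>, whether or not the real kernel
  charges reals that are not codes.\<close>

lemma disintegration:
  fixes \<mu> :: "('a \<times> 'b) measure"
  assumes fin: "finite_measure \<mu>" and sets: "sets \<mu> = sets (S \<Otimes>\<^sub>M T)" and ne: "space S \<noteq> {}"
    and c: "c \<in> borel_measurable T" and c01: "\<And>a. a \<in> space T \<Longrightarrow> c a \<in> {0..1::real}"
    and d: "d \<in> measurable borel T" and dc: "\<And>a. a \<in> space T \<Longrightarrow> d (c a) = a"
  obtains k where "k \<in> measurable S (prob_algebra T)" "\<mu> = kernel_prod S T (distr \<mu> S fst) k"
proof -
  interpret \<mu>: finite_measure \<mu> by fact
  note sp = sets_eq_imp_space_eq[OF sets, unfolded space_pair_measure]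
  have fst: "fst \<in> measurable \<mu> S" by (simp add: measurable_cong_sets[OF sets refl])
  define C where "C = (\<lambda>(x::'a, a). (x, c a))"
  have C: "C \<in> measurable \<mu> (S \<Otimes>\<^sub>M borel)"
    unfolding C_def using c by (simp add: measurable_cong_sets[OF sets refl])
  define \<nu> where "\<nu> = distr \<mu> (S \<Otimes>\<^sub>M borel) C"
  have "emeasure \<nu> (space S \<times> - {0..1}) = 0"
  proof -
    have "C -` (space S \<times> - {0..1}) \<inter> space \<mu> = {}" using c01 by (force simp: C_def sp)
    then show ?thesis unfolding \<nu>_def by (subst emeasure_distr[OF C]) auto
  qed
  moreover have "finite_measure \<nu>" unfolding \<nu>_def by (rule \<mu>.finite_measure_distr[OF C])
  moreover have "sets \<nu> = sets (S \<Otimes>\<^sub>M borel)" by (simp add: \<nu>_def)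
  ultimately obtain k where k: "k \<in> measurable S (prob_algebra borel)"
    and \<nu>: "\<nu> = kernel_prod S borel (distr \<nu> S fst) k"
    using disintegration_real ne by metis
  have m: "distr \<nu> S fst = distr \<mu> S fst"
    unfolding \<nu>_def by (subst distr_distr[OF _ C]) (auto simp: C_def comp_def case_prod_beta)
  define k' where "k' x = distr (k x) T d" for x
  have k': "k' \<in> measurable S (prob_algebra T)"
    unfolding k'_def by (rule measurable_compose[OF k measurable_distr_prob_space[OF d]])
  have "\<mu> = kernel_prod S T (distr \<mu> S fst) k'"
  proof (rule measure_eqI_rectangles[OF fin sets])
    fix B E assume B: "B \<in> sets S" and E: "E \<in> sets T"
    have dE: "d -` E \<in> sets borel" using measurable_sets[OF d E] by simp
    have "emeasure \<nu> (B \<times> d -` E) = emeasure \<mu> (C -` (B \<times> d -` E) \<inter> space \<mu>)"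
      unfolding \<nu>_def using B dE by (intro emeasure_distr[OF C]) auto
    also have "C -` (B \<times> d -` E) \<inter> space \<mu> = B \<times> E"
      using sets.sets_into_space[OF B] sets.sets_into_space[OF E] dc by (auto simp: C_def sp)
    finally have "emeasure \<mu> (B \<times> E) = emeasure (kernel_prod S borel (distr \<nu> S fst) k) (B \<times> d -` E)"
      using \<nu> by simp
    also have "\<dots> = (\<integral>\<^sup>+x. emeasure (k x) (d -` E) * indicator B x \<partial>distr \<mu> S fst)"
      using B dE unfolding m by (intro emeasure_kernel_prod[OF k _ ne]) auto
    also have "\<dots> = (\<integral>\<^sup>+x. emeasure (k' x) E * indicator B x \<partial>distr \<mu> S fst)"
    proof (rule nn_integral_cong)
      fix x assume "x \<in> space (distr \<mu> S fst)"
      then have "sets (k x) = sets borel" using measurable_space[OF k] by (auto simp: space_prob_algebra)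
      then have "emeasure (k' x) E = emeasure (k x) (d -` E)"
        unfolding k'_def using d E sets_eq_imp_space_eq[of "k x" borel]
        by (subst emeasure_distr) (auto simp: measurable_cong_sets[of "k x" borel])
      then show "emeasure (k x) (d -` E) * indicator B x = emeasure (k' x) E * indicator B x" by simp
    qed
    also have "\<dots> = emeasure (kernel_prod S T (distr \<mu> S fst) k') (B \<times> E)"
      using B E by (intro emeasure_kernel_prod[OF k' _ ne, symmetric]) auto
    finally show "emeasure \<mu> (B \<times> E) = emeasure (kernel_prod S T (distr \<mu> S fst) k') (B \<times> E)" .
  qed (simp_all add: sets_kernel_prod[OF k' _ ne])
  with k' show thesis by (rule that)
qed

section \<open>Coding Borel spaces by real numbers\<close>

text \<open>Digits 0 and 1 in base four: the tail after any digit is at most 1/3, so there is no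
  double expansion and the floor cuts exactly after digit \<open>k\<close>. All earlier digits
  contribute multiples of four, so the parity is \<open>b k\<close>.\<close>

lemma base_four_digits:
  fixes b :: "nat \<Rightarrow> bool"
  defines "x \<equiv> (\<Sum>j. of_bool (b j) * (1/4::real) ^ Suc j)"
  shows "0 \<le> x" "x \<le> 1" "b k \<longleftrightarrow> odd \<lfloor>4 ^ Suc k * x\<rfloor>"
proof -
  have geo: "(\<lambda>j. (1/4::real) ^ Suc j) sums (1/3)"
    using sums_mult[OF geometric_sums[of "1/4::real"], of "1/4"] by simp
  have summ: "summable (\<lambda>j. of_bool (b (j + n)) * (1/4::real) ^ Suc j)" for n
    by (rule summable_comparison_test[OF _ sums_summable[OF geo]]) (auto intro!: exI[of _ 0])
  have bds: "0 \<le> (\<Sum>j. of_bool (b (j + n)) * (1/4::real) ^ Suc j)"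
    "(\<Sum>j. of_bool (b (j + n)) * (1/4::real) ^ Suc j) \<le> 1/3" for n
  proof -
    show "0 \<le> (\<Sum>j. of_bool (b (j + n)) * (1/4::real) ^ Suc j)"
      by (intro suminf_nonneg summ) auto
    have "(\<Sum>j. of_bool (b (j + n)) * (1/4::real) ^ Suc j) \<le> (\<Sum>j. (1/4) ^ Suc j)"
      by (intro suminf_le summ sums_summable[OF geo]) auto
    then show "(\<Sum>j. of_bool (b (j + n)) * (1/4::real) ^ Suc j) \<le> 1/3"
      using sums_unique[OF geo] by simp
  qed
  show "0 \<le> x" "x \<le> 1" using bds[of 0] by (auto simp: x_def)
  \<comment> \<open>The integer part of \<open>4 ^ Suc k * x\<close>, with digit \<open>k\<close> in
    the units place; the fractional part is \<open>t\<close>.\<close>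
  define N :: int where "N = (\<Sum>j<Suc k. of_bool (b j) * 4 ^ (k - j))"
  define t where "t = (\<Sum>j. of_bool (b (j + Suc k)) * (1/4::real) ^ Suc j)"
  have "x = (\<Sum>j. of_bool (b (j + Suc k)) * (1/4::real) ^ Suc (j + Suc k))
      + (\<Sum>j<Suc k. of_bool (b j) * (1/4::real) ^ Suc j)"
    unfolding x_def using summ[of 0] by (intro suminf_split_initial_segment) simp
  also have "(\<Sum>j. of_bool (b (j + Suc k)) * (1/4::real) ^ Suc (j + Suc k)) = (1/4) ^ Suc k * t"
    unfolding t_def suminf_mult[OF summ, symmetric] by (simp add: power_add mult_ac)
  finally have "4 ^ Suc k * x = t + (\<Sum>j<Suc k. 4 ^ Suc k * (of_bool (b j) * (1/4::real) ^ Suc j))"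
    by (simp only: distrib_left sum_distrib_left) (simp add: power_one_over)
  also have "(\<Sum>j<Suc k. 4 ^ Suc k * (of_bool (b j) * (1/4::real) ^ Suc j)) = of_int N"
    unfolding N_def of_int_sum
    by (intro sum.cong) (auto simp: power_one_over field_simps simp flip: power_add)
  finally have "\<lfloor>4 ^ Suc k * x\<rfloor> = N"
    using bds[of "Suc k"] by (intro floor_unique) (auto simp: t_def)
  moreover have "even (\<Sum>j<k. of_bool (b j) * 4 ^ (k - j) :: int)" by (intro dvd_sum) auto
  ultimately show "b k \<longleftrightarrow> odd \<lfloor>4 ^ Suc k * x\<rfloor>" by (simp add: N_def)
qed

text \<open>A point is coded by the answers to countably many questions: does it lie within
  \<open>1 / Suc n\<close> of the \<open>i\<close>-th point of a dense sequence? The decoder takes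
  for each \<open>n\<close> the first \<open>i\<close> answered positively and passes to the limit.
  The measurable left inverse is what later carries kernels back from the line.\<close>

lemma polish_space_real_code:
  obtains c :: "'q::polish_space \<Rightarrow> real" and d :: "real \<Rightarrow> 'q"
  where "c \<in> borel_measurable borel" "\<And>y. c y \<in> {0..1}" "d \<in> borel_measurable borel" "\<And>y. d (c y) = y"
proof -
  obtain D :: "'q set" where D: "countable D" "\<And>X. open X \<Longrightarrow> X \<noteq> {} \<Longrightarrow> \<exists>e\<in>D. e \<in> X"
    using countable_dense_exists by metis
  define s where "s = from_nat_into D"
  have "D \<noteq> {}" using D(2)[of UNIV] by auto
  have s: "\<exists>i. s i \<in> X" if "open X" "X \<noteq> {}" for X
    using D(2)[OF that] from_nat_into_surj[OF D(1)] unfolding s_def by metis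
  \<comment> \<open>Bit \<open>k\<close> stands for the pair of an accuracy index and an index into
    the dense sequence, via \<open>prod_decode\<close>.\<close>
  define b where "b k y \<longleftrightarrow> dist y (s (snd (prod_decode k))) < 1 / Suc (fst (prod_decode k))" for k and y :: 'q
  define c where "c y = (\<Sum>j. of_bool (b j y) * (1/4::real) ^ Suc j)" for y
  define b' where "b' k x \<longleftrightarrow> odd \<lfloor>4 ^ Suc k * x\<rfloor>" for k and x :: real
  have b': "b' k (c y) = b k y" for k y
    unfolding b'_def c_def by (rule base_four_digits(3)[symmetric])
  have bm: "Measurable.pred borel (b k)" for k unfolding b_def by measurable
  have bm': "Measurable.pred borel (b' k)" for k unfolding b'_def by measurable
  \<comment> \<open>At a code, density provides a set bit for every accuracy, so
    \<open>LEAST\<close> finds one; at other reals its value does not matter.\<close>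
  define i where "i n x = (LEAST i. b' (prod_encode (n, i)) x)" for n x
  have im: "i n \<in> measurable borel (count_space UNIV)" for n
    unfolding i_def using bm' by measurable
  have dist: "dist y (s (i n (c y))) < 1 / Suc n" for n y
  proof -
    obtain j where "s j \<in> ball y (1 / Suc n)" using s[of "ball y (1 / Suc n)"] by auto
    then have "b' (prod_encode (n, j)) (c y)" by (simp add: b' b_def)
    then have "b' (prod_encode (n, i n (c y))) (c y)" unfolding i_def by (rule LeastI)
    then show ?thesis by (simp add: b' b_def)
  qed
  have lim: "(\<lambda>n. s (i n (c y))) \<longlonglongrightarrow> y" for y
  proof (rule tendstoI)
    fix e :: real assume "0 < e"
    then obtain N where N: "1 / Suc N < e" using nat_approx_posE by blast
    have "dist (s (i n (c y))) y < e" if "N \<le> n" for n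
    proof -
      have "1 / Suc n \<le> 1 / Suc N" using that by (intro divide_left_mono) auto
      then show ?thesis using dist[of y n] N by (simp add: dist_commute)
    qed
    then show "\<forall>\<^sub>F n in sequentially. dist (s (i n (c y))) y < e"
      by (auto simp: eventually_sequentially)
  qed
  have sm: "(\<lambda>x. s (i n x)) \<in> borel_measurable borel" for n
    by (rule measurable_compose[OF im]) simp
  \<comment> \<open>Reals that are not codes may decode to a divergent sequence. By completeness
    convergence is the Cauchy condition, hence a Borel condition; \<open>y0\<close> is the value
    elsewhere.\<close>
  define G where "G = {x. Cauchy (\<lambda>n. s (i n x))}"
  have G: "G \<in> sets borel"
    using sets_Collect_Cauchy[of "\<lambda>n x. s (i n x)" borel] sm unfolding G_def by simp
  obtain y0 :: 'q where True by simp
  define d where "d x = (if x \<in> G then lim (\<lambda>n. s (i n x)) else y0)" for x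
  have "d \<in> borel_measurable borel"
  proof (rule borel_measurable_LIMSEQ_metric)
    show "(\<lambda>x. if x \<in> G then s (i n x) else y0) \<in> borel_measurable borel" for n
      using G sm by (intro measurable_If_set) auto
    show "(\<lambda>n. if x \<in> G then s (i n x) else y0) \<longlonglongrightarrow> d x" for x
      unfolding d_def G_def using convergent_LIMSEQ_iff Cauchy_convergent_iff by auto
  qed
  moreover have "c y \<in> {0..1}" for y using base_four_digits(1,2)[of "\<lambda>j. b j y"] by (simp add: c_def)
  moreover have "c \<in> borel_measurable borel" unfolding c_def using bm by measurable
  moreover have "d (c y) = y" for y
    using limI[OF lim[of y]] LIMSEQ_imp_Cauchy[OF lim[of y]] by (simp add: d_def G_def)
  ultimately show thesis using that by blast
qed

lemma openin_borel_of: "openin X U \<Longrightarrow> U \<in> sets (borel_of X)"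
  by (auto simp: sets_borel_of)

lemma measurable_borel_ofI:
  assumes "\<And>x. x \<in> space M \<Longrightarrow> f x \<in> topspace X"
    and "\<And>U. openin X U \<Longrightarrow> f -` U \<inter> space M \<in> sets M"
  shows "f \<in> measurable M (borel_of X)"
  unfolding borel_of_def using assms by (intro measurable_measure_of) (auto dest: openin_subset)

lemma topological_borel_space_real_code:
  assumes "topological_borel_space TYPE('q::polish_space) A" and a0: "a0 \<in> topspace A"
  obtains c :: "'a \<Rightarrow> real" and d :: "real \<Rightarrow> 'a"
  where "c \<in> borel_measurable (borel_of A)" "\<And>a. c a \<in> {0..1}"
    "d \<in> measurable borel (borel_of A)" "\<And>a. a \<in> topspace A \<Longrightarrow> d (c a) = a"
proof -
  obtain B :: "'q set" and f g where B: "B \<in> sets borel" and fg: "homeomorphic_maps A (top_of_set B) f g"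
    using assms by (auto simp: topological_borel_space_def homeomorphic_space_def)
  obtain c :: "'q \<Rightarrow> real" and d where c: "c \<in> borel_measurable borel" "\<And>y. c y \<in> {0..1}"
    and d: "d \<in> borel_measurable borel" "\<And>y. d (c y) = y"
    using polish_space_real_code by metis
  have fB: "f a \<in> B" if "a \<in> topspace A" for a
    using fg that by (auto simp: homeomorphic_maps_def continuous_map_def)
  have gA: "g y \<in> topspace A" if "y \<in> B" for y
    using fg that by (auto simp: homeomorphic_maps_def continuous_map_def)
  have f: "f \<in> measurable (borel_of A) borel"
  proof (rule borel_measurableI)
    fix U :: "'q set" assume "open U"
    then have "openin (top_of_set B) (B \<inter> U)" by (rule openin_open_Int)
    then have "openin A {x \<in> topspace A. f x \<in> B \<inter> U}"
      using fg by (auto simp: homeomorphic_maps_def continuous_map_def)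
    also have "{x \<in> topspace A. f x \<in> B \<inter> U} = f -` U \<inter> space (borel_of A)" using fB by auto
    finally show "f -` U \<inter> space (borel_of A) \<in> sets (borel_of A)" by (rule openin_borel_of)
  qed
  \<comment> \<open>Decode into the Polish space and return to \<open>A\<close> if the result lies
    in \<open>B\<close>. This case distinction is measurable because \<open>B\<close> is a Borel
    set.\<close>
  define h where "h r = (if d r \<in> B then g (d r) else a0)" for r
  have h: "h \<in> measurable borel (borel_of A)"
  proof (rule measurable_borel_ofI)
    fix U assume "openin A U"
    then have "openin (top_of_set B) {y \<in> B. g y \<in> U}"
      using fg by (auto simp: homeomorphic_maps_def continuous_map_def)
    then obtain V where V: "open V" "{y \<in> B. g y \<in> U} = B \<inter> V" unfolding openin_open by auto
    have "h -` U = (if a0 \<in> U then d -` (B \<inter> V) \<union> d -` (- B) else d -` (B \<inter> V))"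
      using V(2) by (auto simp: h_def split: if_splits)
    moreover have "d -` E \<in> sets borel" if "E \<in> sets borel" for E
      using measurable_sets[OF d(1) that] by simp
    ultimately show "h -` U \<inter> space borel \<in> sets borel" using B V(1) by auto
  qed (auto simp: h_def gA a0)
  show thesis
  proof (rule that)
    show "(\<lambda>a. c (f a)) \<in> borel_measurable (borel_of A)" using f c(1) by measurable
    show "h (c (f a)) = a" if "a \<in> topspace A" for a
      using that fB fg d(2) by (auto simp: h_def homeomorphic_maps_def)
  qed (use c h in auto)
qed

section \<open>Processes with given conditional laws\<close>

text \<open>Repackages the Ionescu-Tulcea theorem as one integral identity: given the first
  \<open>n\<close> coordinates, the next one is drawn from \<open>K n\<close>. The case
  \<open>n = 0\<close> supplies the initial law.\<close>

lemma ionescu_tulcea_process: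
  fixes Z :: "'z measure" and K :: "nat \<Rightarrow> (nat \<Rightarrow> 'z) \<Rightarrow> 'z measure"
  assumes K: "\<And>n. K n \<in> measurable (\<Pi>\<^sub>M i\<in>{..<n}. Z) (prob_algebra Z)"
  obtains P where "prob_space P" "sets P = sets (\<Pi>\<^sub>M i\<in>UNIV. Z)"
    "\<And>n F. F \<in> borel_measurable ((\<Pi>\<^sub>M i\<in>{..<n}. Z) \<Otimes>\<^sub>M Z) \<Longrightarrow>
      (\<integral>\<^sup>+\<omega>. F (restrict \<omega> {..<n}, \<omega> n) \<partial>P)
        = (\<integral>\<^sup>+\<omega>. \<integral>\<^sup>+z. F (restrict \<omega> {..<n}, z) \<partial>K n (restrict \<omega> {..<n}) \<partial>P)"
proof -
  interpret IT: Ionescu_Tulcea K "\<lambda>_. Z"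
  proof (rule Ionescu_Tulcea.intro)
    show "K i \<in> measurable (\<Pi>\<^sub>M i\<in>{0..<i}. Z) (subprob_algebra Z)" for i
      by (rule measurable_prob_algebraD[OF K[of i, unfolded lessThan_atLeast0]])
    fix i :: nat and x assume "x \<in> space (\<Pi>\<^sub>M i\<in>{0..<i}. Z)"
    then have "K i x \<in> space (prob_algebra Z)"
      by (rule measurable_space[OF K[of i, unfolded lessThan_atLeast0]])
    then show "prob_space (K i x)" by (simp add: space_prob_algebra)
  qed
  let ?H = "\<lambda>n. \<Pi>\<^sub>M i\<in>{..<n}. Z"
  \<comment> \<open>The only point of the product over the empty index set: the empty history from
    which the construction starts.\<close>
  define u :: "nat \<Rightarrow> 'z" where "u = (\<lambda>_. undefined)"
  have u: "u \<in> space (PiM {0..<0} (\<lambda>_. Z))" by (simp add: u_def space_PiM)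
  have setsC: "sets (IT.C 0 n u) = sets (?H n)" for n
    using IT.sets_C[OF u, of n] by (simp add: lessThan_atLeast0)
  define P where "P = IT.PF.lim"
  have sets: "sets P = sets (\<Pi>\<^sub>M i\<in>UNIV. Z)" by (simp add: P_def)
  have rm: "(\<lambda>\<omega>. restrict \<omega> {..<n}) \<in> measurable P (?H n)" for n
    by (subst measurable_cong_sets[OF sets refl]) (rule measurable_restrict_subset, simp)
  have law: "distr P (?H n) (\<lambda>\<omega>. restrict \<omega> {..<n}) = IT.C 0 n u" for n
  proof (rule measure_eqI)
    fix E assume "E \<in> sets (distr P (?H n) (\<lambda>\<omega>. restrict \<omega> {..<n}))"
    then have E: "E \<in> sets (PiM {0..<n} (\<lambda>_. Z))" by (simp add: lessThan_atLeast0)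
    have "distr P (?H n) (\<lambda>\<omega>. restrict \<omega> {..<n}) = IT.CI {0..<n}"
      using IT.distr_lim[of "{0..<n}"] by (simp add: P_def lessThan_atLeast0)
    also have "emeasure \<dots> E = emeasure (IT.C 0 n u) (prod_emb {0..<n} (\<lambda>_. Z) {0..<n} E)"
      unfolding u_def by (rule IT.emeasure_CI) (use E in auto)
    also have "prod_emb {0..<n} (\<lambda>_. Z) {0..<n} E = E"
      using sets.sets_into_space[OF E] by (intro prod_emb_id) (simp add: space_PiM)
    finally show "emeasure (distr P (?H n) (\<lambda>\<omega>. restrict \<omega> {..<n})) E = emeasure (IT.C 0 n u) E" .
  qed (simp add: setsC)
  have "prob_space (IT.C 0 0 u)" by (rule IT.prob_space_C[OF u])
  then have prob: "prob_space P"
    using law[of 0] rm[of 0] by (intro prob_space_distrD[of "\<lambda>\<omega>. restrict \<omega> {..<0}" P "?H 0"]) auto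
  have "(\<integral>\<^sup>+\<omega>. F (restrict \<omega> {..<n}, \<omega> n) \<partial>P)
        = (\<integral>\<^sup>+\<omega>. \<integral>\<^sup>+z. F (restrict \<omega> {..<n}, z) \<partial>K n (restrict \<omega> {..<n}) \<partial>P)"
    if F: "F \<in> borel_measurable (?H n \<Otimes>\<^sub>M Z)" for n F
  proof -
    define f where "f h = F (restrict h {..<n}, h n)" for h
    have f: "f \<in> borel_measurable (?H (Suc n))"
      unfolding f_def
      by (intro measurable_compose[OF _ F] measurable_Pair measurable_restrict_subset
          measurable_component_singleton) auto
    have "(\<integral>\<^sup>+\<omega>. F (restrict \<omega> {..<n}, \<omega> n) \<partial>P) = (\<integral>\<^sup>+\<omega>. f (restrict \<omega> {..<Suc n}) \<partial>P)"
      by (simp add: f_def Int_absorb1 Int_absorb2)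
    also have "\<dots> = (\<integral>\<^sup>+h. f h \<partial>IT.C 0 (Suc n) u)"
      unfolding law[symmetric] by (rule nn_integral_distr[OF rm, symmetric]) (simp add: f)
    also have "\<dots> = (\<integral>\<^sup>+h. \<integral>\<^sup>+h'. f h' \<partial>IT.eP n h \<partial>IT.C 0 n u)"
      unfolding IT.C.simps add_0
    proof (rule nn_integral_bind)
      show "f \<in> borel_measurable (PiM {0..<Suc n} (\<lambda>_. Z))" using f by (simp add: lessThan_atLeast0)
      show "IT.eP n \<in> measurable (IT.C 0 n u) (subprob_algebra (PiM {0..<Suc n} (\<lambda>_. Z)))"
        unfolding measurable_cong_sets[OF IT.sets_C[OF u, of n, unfolded add_0] refl]
        by (rule IT.measurable_eP)
    qed
    also have "\<dots> = (\<integral>\<^sup>+h. \<integral>\<^sup>+z. F (h, z) \<partial>K n h \<partial>IT.C 0 n u)"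
    proof (rule nn_integral_cong)
      fix h assume "h \<in> space (IT.C 0 n u)"
      then have h: "h \<in> space (PiM {0..<n} (\<lambda>_. Z))" using IT.space_C[OF u, of n] by simp
      have r': "restrict (h(n := z)) {..<n} = h" for z
        using h by (auto simp: space_PiM PiE_iff extensional_def fun_eq_iff restrict_def)
      have "(\<integral>\<^sup>+h'. f h' \<partial>IT.eP n h) = (\<integral>\<^sup>+z. f (h(n := z)) \<partial>K n h)"
        using f by (intro IT.nn_integral_eP[OF h]) (simp add: lessThan_atLeast0)
      then show "(\<integral>\<^sup>+h'. f h' \<partial>IT.eP n h) = (\<integral>\<^sup>+z. F (h, z) \<partial>K n h)" by (simp add: f_def r')
    qed
    also have "\<dots> = (\<integral>\<^sup>+\<omega>. \<integral>\<^sup>+z. F (restrict \<omega> {..<n}, z) \<partial>K n (restrict \<omega> {..<n}) \<partial>P)"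
      unfolding law[symmetric]
    proof (rule nn_integral_distr[OF rm])
      have "(\<lambda>h. \<integral>\<^sup>+z. F (h, z) \<partial>K n h) \<in> borel_measurable (?H n)"
        using F by (intro nn_integral_measurable_subprob_algebra2[OF _ measurable_prob_algebraD[OF K]]) simp
      then show "(\<lambda>h. \<integral>\<^sup>+z. F (h, z) \<partial>K n h) \<in> borel_measurable (distr P (?H n) (\<lambda>\<omega>. restrict \<omega> {..<n}))"
        by simp
    qed
    finally show ?thesis .
  qed
  with prob sets show thesis by (rule that)
qed

text \<open>A cylinder over a finite \<open>J\<close> depends only on the first \<open>n\<close>
  coordinates as soon as \<open>J \<subseteq> {..<n}\<close>, and cylinders determine a finite
  measure on the product.\<close>

lemma measure_eqI_initial_segments:
  fixes Z :: "'z measure" and P Q :: "(nat \<Rightarrow> 'z) measure"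
  assumes P: "prob_space P" "sets P = sets (\<Pi>\<^sub>M i\<in>UNIV. Z)" and Q: "sets Q = sets (\<Pi>\<^sub>M i\<in>UNIV. Z)"
    and eq: "\<And>n. distr P (\<Pi>\<^sub>M i\<in>{..<n}. Z) (\<lambda>\<omega>. restrict \<omega> {..<n})
      = distr Q (\<Pi>\<^sub>M i\<in>{..<n}. Z) (\<lambda>\<omega>. restrict \<omega> {..<n})"
  shows "P = Q"
proof (rule measure_eqI_PiM_infinite[OF P(2) Q])
  show "finite_measure P" using P(1) by (rule prob_space.finite_measure)
  fix E and J :: "nat set" assume J: "finite J" and E: "\<And>i. i \<in> J \<Longrightarrow> E i \<in> sets Z"
  then obtain n where n: "J \<subseteq> {..<n}" using finite_nat_iff_bounded by auto
  define R where "R = prod_emb {..<n} (\<lambda>_. Z) J (Pi\<^sub>E J E)"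
  have R: "R \<in> sets (\<Pi>\<^sub>M i\<in>{..<n}. Z)"
    unfolding R_def using n J E by (intro sets_PiM_I) auto
  have rm: "(\<lambda>\<omega>. restrict \<omega> {..<n}) \<in> measurable M (\<Pi>\<^sub>M i\<in>{..<n}. Z)"
    if "sets M = sets (\<Pi>\<^sub>M i\<in>(UNIV :: nat set). Z)" for M
    by (subst measurable_cong_sets[OF that refl]) (rule measurable_restrict_subset, simp)
  have "emeasure M (prod_emb UNIV (\<lambda>_. Z) J (Pi\<^sub>E J E))
      = emeasure (distr M (\<Pi>\<^sub>M i\<in>{..<n}. Z) (\<lambda>\<omega>. restrict \<omega> {..<n})) R"
    if M: "sets M = sets (\<Pi>\<^sub>M i\<in>(UNIV :: nat set). Z)" for M
  proof -
    have "space M = space (\<Pi>\<^sub>M i\<in>(UNIV :: nat set). Z)" by (rule sets_eq_imp_space_eq[OF M])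
    then have "(\<lambda>\<omega>. restrict \<omega> {..<n}) -` R \<inter> space M = prod_emb UNIV (\<lambda>_. Z) J (Pi\<^sub>E J E)"
      using n by (auto simp: R_def prod_emb_def space_PiM PiE_iff extensional_def Int_absorb1 Int_absorb2)
    then show ?thesis by (simp add: emeasure_distr[OF rm[OF M] R])
  qed
  then show "emeasure P (prod_emb UNIV (\<lambda>_. Z) J (Pi\<^sub>E J E)) = emeasure Q (prod_emb UNIV (\<lambda>_. Z) J (Pi\<^sub>E J E))"
    using P(2) Q eq[of n] by simp
qed

section \<open>Strategic measures\<close>

context cemetery_mdp
begin

abbreviation pair_borel :: "('x option \<times> 'a) measure"
  where "pair_borel \<equiv> state_borel \<Otimes>\<^sub>M action_borel"

lemma space_state_borel_nonempty: "space state_borel \<noteq> {}" by simp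

lemma strategyD:
  assumes "strategy \<sigma>"
  shows "\<sigma> n \<in> measurable (history_space n) (prob_algebra action_borel)"
  using assms by (simp add: strategy_def)

lemma measurable_history:
  assumes "sets P = sets trajectory_space"
  shows "(\<lambda>\<omega>. restrict \<omega> {..<n}) \<in> measurable P (\<Pi>\<^sub>M i\<in>{..<n}. pair_borel)"
    and "(\<lambda>\<omega>. \<omega> n) \<in> measurable P pair_borel"
    and "(\<lambda>\<omega>. fst (\<omega> n)) \<in> measurable P state_borel"
    and "(\<lambda>\<omega>. snd (\<omega> n)) \<in> measurable P action_borel"
    and "(\<lambda>\<omega>. (restrict \<omega> {..<n}, fst (\<omega> n))) \<in> measurable P (history_space n)"
proof -
  show 1: "(\<lambda>\<omega>. restrict \<omega> {..<n}) \<in> measurable P (\<Pi>\<^sub>M i\<in>{..<n}. pair_borel)"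
    by (subst measurable_cong_sets[OF assms refl]) (rule measurable_restrict_subset, simp)
  show 2: "(\<lambda>\<omega>. \<omega> n) \<in> measurable P pair_borel"
    by (subst measurable_cong_sets[OF assms refl]) (rule measurable_component_singleton, simp)
  show 3: "(\<lambda>\<omega>. fst (\<omega> n)) \<in> measurable P state_borel" by (rule measurable_compose[OF 2]) simp
  show 4: "(\<lambda>\<omega>. snd (\<omega> n)) \<in> measurable P action_borel" by (rule measurable_compose[OF 2]) simp
  show "(\<lambda>\<omega>. (restrict \<omega> {..<n}, fst (\<omega> n))) \<in> measurable P (history_space n)"
    by (rule measurable_Pair[OF 1 3])
qed

text \<open>A coordinate of the process is a whole pair of state and action, so one Ionescu-Tulcea
  step draws the state from \<open>s n\<close> and then the action from \<open>\<sigma> n\<close>.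
  Measurability of \<open>{Some x0}\<close> turns the initial condition into an event.\<close>

lemma strategic_measure_exists:
  assumes \<sigma>: "strategy \<sigma>" and x0: "x0 \<in> topspace X" "{Some x0} \<in> sets state_borel"
  shows "\<exists>P. is_strategic_measure x0 \<sigma> P"
proof -
  let ?H = "\<lambda>n. \<Pi>\<^sub>M i\<in>{..<n}. pair_borel"
  \<comment> \<open>The law of the state given the past: Dirac at time 0, later the transition out
    of the last recorded pair, whose index is \<open>n - 1\<close>.\<close>
  define s where "s n h = (case n of 0 \<Rightarrow> return state_borel (Some x0) | Suc m \<Rightarrow> p (h m))"
    for n and h :: "nat \<Rightarrow> 'x option \<times> 'a"
  have s: "s n \<in> measurable (?H n) (prob_algebra state_borel)" for n
  proof (cases n)
    case 0
    then show ?thesis using x0 unfolding s_def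
      by (auto intro!: measurable_const simp: space_prob_algebra prob_space_return)
  next
    case (Suc m)
    have "(\<lambda>h. h m) \<in> measurable (?H n) pair_borel"
      using Suc by (intro measurable_component_singleton) auto
    then show ?thesis unfolding s_def Suc
      by (simp add: measurable_compose[OF _ kernel_p])
  qed
  define K where "K n h = kernel_prod state_borel action_borel (s n h) (\<lambda>x. \<sigma> n (h, x))" for n h
  have K: "K n \<in> measurable (?H n) (prob_algebra pair_borel)" for n
    unfolding K_def kernel_prod_def
  proof (rule measurable_bind_prob_space2[OF s])
    have "(\<lambda>z. distr (\<sigma> n z) pair_borel (Pair (snd z))) \<in> measurable (history_space n) (prob_algebra pair_borel)"
      by (rule measurable_distr_prob_space2[OF strategyD[OF \<sigma>]]) simp
    then show "(\<lambda>(h, x). distr (\<sigma> n (h, x)) pair_borel (Pair x))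
        \<in> measurable (?H n \<Otimes>\<^sub>M state_borel) (prob_algebra pair_borel)"
      by (simp add: case_prod_beta')
  qed
  obtain P where P: "prob_space P" "sets P = sets trajectory_space"
    and law: "\<And>n F. F \<in> borel_measurable (?H n \<Otimes>\<^sub>M pair_borel) \<Longrightarrow>
      (\<integral>\<^sup>+\<omega>. F (restrict \<omega> {..<n}, \<omega> n) \<partial>P)
        = (\<integral>\<^sup>+\<omega>. \<integral>\<^sup>+z. F (restrict \<omega> {..<n}, z) \<partial>K n (restrict \<omega> {..<n}) \<partial>P)"
    using ionescu_tulcea_process[OF K] by blast
  note mh = measurable_history[OF P(2)]
  have law': "(\<integral>\<^sup>+\<omega>. F (restrict \<omega> {..<n}, \<omega> n) \<partial>P)
      = (\<integral>\<^sup>+\<omega>. \<integral>\<^sup>+x. \<integral>\<^sup>+a. F (restrict \<omega> {..<n}, (x, a))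
          \<partial>\<sigma> n (restrict \<omega> {..<n}, x) \<partial>s n (restrict \<omega> {..<n}) \<partial>P)"
    if F: "F \<in> borel_measurable (?H n \<Otimes>\<^sub>M pair_borel)" for F n
    unfolding law[OF F]
  proof (rule nn_integral_cong)
    fix \<omega> assume "\<omega> \<in> space P"
    then have h: "restrict \<omega> {..<n} \<in> space (?H n)" using measurable_space[OF mh(1)] by blast
    have "(\<lambda>x. \<sigma> n (restrict \<omega> {..<n}, x)) \<in> measurable state_borel (prob_algebra action_borel)"
      by (rule measurable_compose[OF measurable_Pair1'[OF h] strategyD[OF \<sigma>]])
    moreover have "(\<lambda>z. F (restrict \<omega> {..<n}, z)) \<in> borel_measurable pair_borel"
      by (rule measurable_compose[OF measurable_Pair1'[OF h] F])
    moreover have "sets (s n (restrict \<omega> {..<n})) = sets state_borel"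
      using measurable_space[OF s h] by (simp add: space_prob_algebra)
    ultimately show "(\<integral>\<^sup>+z. F (restrict \<omega> {..<n}, z) \<partial>K n (restrict \<omega> {..<n}))
      = (\<integral>\<^sup>+x. \<integral>\<^sup>+a. F (restrict \<omega> {..<n}, (x, a)) \<partial>\<sigma> n (restrict \<omega> {..<n}, x) \<partial>s n (restrict \<omega> {..<n}))"
      unfolding K_def by (simp add: nn_integral_kernel_prod)
  qed
  have \<sigma>1: "emeasure (\<sigma> n (h, x)) (topspace A) = 1"
    if "h \<in> space (?H n)" "x \<in> space state_borel" for n h x
  proof -
    have "\<sigma> n (h, x) \<in> space (prob_algebra action_borel)"
      using that by (intro measurable_space[OF strategyD[OF \<sigma>]]) (auto simp: space_pair_measure)
    from in_space_prob_algebra[OF this] show ?thesis by simp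
  qed
  \<comment> \<open>Integrates out the action: \<open>\<sigma> n\<close> has total mass 1 at every
    history.\<close>
  have state_law: "(\<integral>\<^sup>+\<omega>. G (restrict \<omega> {..<n}, fst (\<omega> n)) \<partial>P)
      = (\<integral>\<^sup>+\<omega>. \<integral>\<^sup>+x. G (restrict \<omega> {..<n}, x) \<partial>s n (restrict \<omega> {..<n}) \<partial>P)"
    if G: "G \<in> borel_measurable (history_space n)" for G n
  proof -
    have Gm: "(\<lambda>z. G (fst z, fst (snd z))) \<in> borel_measurable (?H n \<Otimes>\<^sub>M pair_borel)"
      by (rule measurable_compose[OF _ G]) simp
    have "(\<integral>\<^sup>+\<omega>. G (restrict \<omega> {..<n}, fst (\<omega> n)) \<partial>P)
      = (\<integral>\<^sup>+\<omega>. \<integral>\<^sup>+x. \<integral>\<^sup>+a. G (restrict \<omega> {..<n}, x) \<partial>\<sigma> n (restrict \<omega> {..<n}, x) \<partial>s n (restrict \<omega> {..<n}) \<partial>P)"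
      using law'[OF Gm] by (simp only: fst_conv snd_conv)
    also have "\<dots> = (\<integral>\<^sup>+\<omega>. \<integral>\<^sup>+x. G (restrict \<omega> {..<n}, x) \<partial>s n (restrict \<omega> {..<n}) \<partial>P)"
    proof (intro nn_integral_cong)
      fix \<omega> x assume "\<omega> \<in> space P" and x: "x \<in> space (s n (restrict \<omega> {..<n}))"
      then have h: "restrict \<omega> {..<n} \<in> space (?H n)" using measurable_space[OF mh(1)] by blast
      have x': "x \<in> space state_borel"
        using measurable_space[OF s h] x by (auto simp: space_prob_algebra dest: sets_eq_imp_space_eq)
      have "sets (\<sigma> n (restrict \<omega> {..<n}, x)) = sets action_borel"
        using measurable_space[OF strategyD[OF \<sigma>], of "(restrict \<omega> {..<n}, x)" n] h x'
        by (auto simp: space_prob_algebra space_pair_measure)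
      from sets_eq_imp_space_eq[OF this]
      show "(\<integral>\<^sup>+a. G (restrict \<omega> {..<n}, x) \<partial>\<sigma> n (restrict \<omega> {..<n}, x)) = G (restrict \<omega> {..<n}, x)"
        using \<sigma>1[OF h x'] by simp
    qed
    finally show ?thesis .
  qed
  have em\<sigma>: "(\<lambda>z. emeasure (\<sigma> n z) C) \<in> borel_measurable (history_space n)" if "C \<in> sets action_borel" for C n
    by (rule measurable_emeasure_kernel[OF measurable_prob_algebraD[OF strategyD[OF \<sigma>]] that])
  have "is_strategic_measure x0 \<sigma> P"
    unfolding is_strategic_measure_def
  proof (intro conjI allI)
    show "prob_space P" "sets P = sets trajectory_space" by fact+
    show "AE \<omega> in P. fst (\<omega> 0) = Some x0"
    proof (rule AE_I)
      define U where "U = space state_borel - {Some x0}"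
      have U: "U \<in> sets state_borel" unfolding U_def by (rule sets.compl_sets[OF x0(2)])
      have U_iff: "x \<in> U \<longleftrightarrow> x \<noteq> Some x0" if "x \<in> space state_borel" for x
        using that by (simp add: U_def)
      let ?N = "{\<omega> \<in> space P. fst (\<omega> 0) \<noteq> Some x0}"
      show N: "?N \<in> sets P"
      proof -
        have "(\<lambda>\<omega>. fst (\<omega> 0)) -` U \<inter> space P \<in> sets P"
          by (rule measurable_sets[OF mh(3) U])
        also have "(\<lambda>\<omega>. fst (\<omega> 0)) -` U \<inter> space P = ?N"
          using measurable_space[OF mh(3)] U_iff by blast
        finally show ?thesis .
      qed
      have ind: "indicator U \<in> borel_measurable state_borel"
        using U by simp
      have "emeasure P ?N = (\<integral>\<^sup>+\<omega>. indicator ?N \<omega> \<partial>P)" using N by simp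
      also have "\<dots> = (\<integral>\<^sup>+\<omega>. indicator U (fst (\<omega> 0)) \<partial>P)"
        using U_iff[OF measurable_space[OF mh(3)]] by (intro nn_integral_cong) (auto simp: indicator_def)
      also have "\<dots> = (\<integral>\<^sup>+\<omega>. \<integral>\<^sup>+x. indicator U x \<partial>s 0 (restrict \<omega> {..<0}) \<partial>P)"
        using state_law[OF measurable_compose[OF measurable_snd ind], of 0] by (simp only: snd_conv)
      also have "\<dots> = 0" using U by (simp add: s_def U_def)
      finally show "emeasure P ?N = 0" .
    qed auto
    show "has_conditional_law P (history_space n) (\<lambda>\<omega>. (restrict \<omega> {..<n}, fst (\<omega> n)))
        action_borel (\<lambda>\<omega>. snd (\<omega> n)) (\<sigma> n)" for n
      unfolding has_conditional_law_def
    proof safe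
      fix B C assume B: "B \<in> sets (history_space n)" and C: "C \<in> sets action_borel"
      let ?E = "{\<omega> \<in> space P. (restrict \<omega> {..<n}, fst (\<omega> n)) \<in> B \<and> snd (\<omega> n) \<in> C}"
      have "?E = ((\<lambda>\<omega>. (restrict \<omega> {..<n}, fst (\<omega> n))) -` B \<inter> space P) \<inter> ((\<lambda>\<omega>. snd (\<omega> n)) -` C \<inter> space P)"
        by auto
      then have E: "?E \<in> sets P"
        using measurable_sets[OF mh(5) B] measurable_sets[OF mh(4) C] by auto
      define F where "F z = (indicator B (fst z, fst (snd z)) * indicator C (snd (snd z)) :: ennreal)"
        for z :: "(nat \<Rightarrow> 'x option \<times> 'a) \<times> 'x option \<times> 'a"
      have F: "F \<in> borel_measurable (?H n \<Otimes>\<^sub>M pair_borel)"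
        unfolding F_def using B C
        by (intro borel_measurable_times_ennreal measurable_compose[OF _ borel_measurable_indicator[of B "history_space n"]]
            measurable_compose[OF _ borel_measurable_indicator[of C action_borel]]) auto
      have "emeasure P ?E = (\<integral>\<^sup>+\<omega>. indicator ?E \<omega> \<partial>P)" using E by simp
      also have "\<dots> = (\<integral>\<^sup>+\<omega>. F (restrict \<omega> {..<n}, \<omega> n) \<partial>P)"
        by (intro nn_integral_cong) (auto simp: F_def split: split_indicator)
      also have "\<dots> = (\<integral>\<^sup>+\<omega>. \<integral>\<^sup>+x. \<integral>\<^sup>+a. F (restrict \<omega> {..<n}, (x, a))
          \<partial>\<sigma> n (restrict \<omega> {..<n}, x) \<partial>s n (restrict \<omega> {..<n}) \<partial>P)"
        by (rule law'[OF F])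
      also have "\<dots> = (\<integral>\<^sup>+\<omega>. \<integral>\<^sup>+x. emeasure (\<sigma> n (restrict \<omega> {..<n}, x)) C * indicator B (restrict \<omega> {..<n}, x)
          \<partial>s n (restrict \<omega> {..<n}) \<partial>P)"
      proof (intro nn_integral_cong)
        fix \<omega> x assume "\<omega> \<in> space P" and x: "x \<in> space (s n (restrict \<omega> {..<n}))"
        then have h: "restrict \<omega> {..<n} \<in> space (?H n)" using measurable_space[OF mh(1)] by blast
        have x': "x \<in> space state_borel"
          using measurable_space[OF s h] x by (auto simp: space_prob_algebra dest: sets_eq_imp_space_eq)
        have "sets (\<sigma> n (restrict \<omega> {..<n}, x)) = sets action_borel"
          using measurable_space[OF strategyD[OF \<sigma>], of "(restrict \<omega> {..<n}, x)" n] h x'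
          by (auto simp: space_prob_algebra space_pair_measure)
        then have "C \<in> sets (\<sigma> n (restrict \<omega> {..<n}, x))" using C by simp
        then show "(\<integral>\<^sup>+a. F (restrict \<omega> {..<n}, (x, a)) \<partial>\<sigma> n (restrict \<omega> {..<n}, x))
            = emeasure (\<sigma> n (restrict \<omega> {..<n}, x)) C * indicator B (restrict \<omega> {..<n}, x)"
          by (cases "(restrict \<omega> {..<n}, x) \<in> B") (simp_all add: F_def)
      qed
      also have "\<dots> = (\<integral>\<^sup>+\<omega>. emeasure (\<sigma> n (restrict \<omega> {..<n}, fst (\<omega> n))) C * indicator B (restrict \<omega> {..<n}, fst (\<omega> n)) \<partial>P)"
        using B em\<sigma>[OF C]
        by (intro state_law[of "\<lambda>z. emeasure (\<sigma> n z) C * indicator B z" n, symmetric]) auto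
      finally show "emeasure P ?E = \<dots>" .
    qed
    show "has_conditional_law P (\<Pi>\<^sub>M i\<in>{..n}. pair_borel) (\<lambda>\<omega>. restrict \<omega> {..n})
        state_borel (\<lambda>\<omega>. fst (\<omega> (Suc n))) (\<lambda>h. p (h n))" for n
      unfolding has_conditional_law_def lessThan_Suc_atMost[symmetric]
    proof safe
      fix B C assume B: "B \<in> sets (?H (Suc n))" and C: "C \<in> sets state_borel"
      let ?E = "{\<omega> \<in> space P. restrict \<omega> {..<Suc n} \<in> B \<and> fst (\<omega> (Suc n)) \<in> C}"
      have "?E = ((\<lambda>\<omega>. restrict \<omega> {..<Suc n}) -` B \<inter> space P) \<inter> ((\<lambda>\<omega>. fst (\<omega> (Suc n))) -` C \<inter> space P)"
        by auto
      then have E: "?E \<in> sets P"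
        using measurable_sets[OF mh(1) B] measurable_sets[OF mh(3) C] by auto
      define G where "G z = (indicator B (fst z) * indicator C (snd z) :: ennreal)"
        for z :: "(nat \<Rightarrow> 'x option \<times> 'a) \<times> 'x option"
      have G: "G \<in> borel_measurable (history_space (Suc n))"
        unfolding G_def using B C by measurable
      have "emeasure P ?E = (\<integral>\<^sup>+\<omega>. indicator ?E \<omega> \<partial>P)" using E by simp
      also have "\<dots> = (\<integral>\<^sup>+\<omega>. G (restrict \<omega> {..<Suc n}, fst (\<omega> (Suc n))) \<partial>P)"
        by (intro nn_integral_cong) (auto simp: G_def simp del: restrict_apply split: split_indicator)
      also have "\<dots> = (\<integral>\<^sup>+\<omega>. \<integral>\<^sup>+x. G (restrict \<omega> {..<Suc n}, x) \<partial>s (Suc n) (restrict \<omega> {..<Suc n}) \<partial>P)"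
        by (rule state_law[OF G])
      also have "\<dots> = (\<integral>\<^sup>+\<omega>. emeasure (p (restrict \<omega> {..<Suc n} n)) C * indicator B (restrict \<omega> {..<Suc n}) \<partial>P)"
      proof (intro nn_integral_cong)
        fix \<omega> assume "\<omega> \<in> space P"
        then have "p (\<omega> n) \<in> space (prob_algebra state_borel)"
          using measurable_space[OF kernel_p] measurable_space[OF mh(2)] by blast
        then have "C \<in> sets (p (\<omega> n))" using C by (simp add: space_prob_algebra)
        then show "(\<integral>\<^sup>+x. G (restrict \<omega> {..<Suc n}, x) \<partial>s (Suc n) (restrict \<omega> {..<Suc n}))
            = emeasure (p (restrict \<omega> {..<Suc n} n)) C * indicator B (restrict \<omega> {..<Suc n})"
          by (cases "restrict \<omega> {..<Suc n} \<in> B") (simp_all add: G_def s_def)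
      qed
      finally show "emeasure P ?E = \<dots>" .
    qed
  qed
  then show ?thesis ..
qed

text \<open>The law of the history with its current state (\<open>?H\<close>) and the law of
  completed pairs (\<open>?D\<close>) determine each other in turn: \<open>\<sigma> n\<close> leads
  from \<open>?H P n\<close> to \<open>?D P (Suc n)\<close>, and \<open>p\<close> from there to
  \<open>?H P (Suc n)\<close>, starting from a Dirac measure.\<close>

lemma strategic_measure_unique:
  assumes \<sigma>: "strategy \<sigma>" and x0: "x0 \<in> topspace X"
    and P: "is_strategic_measure x0 \<sigma> P" and Q: "is_strategic_measure x0 \<sigma> Q"
  shows "P = Q"
proof -
  let ?D = "\<lambda>P n. distr P (\<Pi>\<^sub>M i\<in>{..<n}. pair_borel) (\<lambda>\<omega>. restrict \<omega> {..<n})"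
  let ?H = "\<lambda>P n. distr P (history_space n) (\<lambda>\<omega>. (restrict \<omega> {..<n}, fst (\<omega> n)))"
  \<comment> \<open>Files the current state and the new action as coordinate \<open>n\<close> of the
    lengthened history.\<close>
  have upd: "(\<lambda>z. (fst (fst z))(n := (snd (fst z), snd z)))
      \<in> measurable (history_space n \<Otimes>\<^sub>M action_borel) (\<Pi>\<^sub>M i\<in>{..<Suc n}. pair_borel)" for n
    by (rule measurable_fun_upd[where J="{..<n}"]) auto
  have pn: "(\<lambda>h. p (h n)) \<in> measurable (\<Pi>\<^sub>M i\<in>{..<Suc n}. pair_borel) (prob_algebra state_borel)" for n
    by (rule measurable_compose[OF _ kernel_p]) (rule measurable_component_singleton, simp)
  have D: "?D P (Suc n) = distr (kernel_prod (history_space n) action_borel (?H P n) (\<sigma> n))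
      (\<Pi>\<^sub>M i\<in>{..<Suc n}. pair_borel) (\<lambda>z. (fst (fst z))(n := (snd (fst z), snd z)))" (is ?thesisD)
    and H: "?H P (Suc n) = kernel_prod (\<Pi>\<^sub>M i\<in>{..<Suc n}. pair_borel) state_borel (?D P (Suc n)) (\<lambda>h. p (h n))" (is ?thesisH)
    and H0: "?H P 0 = return (history_space 0) (\<lambda>_. undefined, Some x0)" (is ?thesisI)
    if "is_strategic_measure x0 \<sigma> P" for P n
  proof -
    note P = that[unfolded is_strategic_measure_def]
    interpret P: prob_space P using P by blast
    have sets: "sets P = sets trajectory_space" using P by blast
    note mh = measurable_history[OF sets]
    have kp: "distr P (history_space n \<Otimes>\<^sub>M action_borel) (\<lambda>\<omega>. ((restrict \<omega> {..<n}, fst (\<omega> n)), snd (\<omega> n)))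
        = kernel_prod (history_space n) action_borel (?H P n) (\<sigma> n)"
      using has_conditional_law_iff_kernel_prod[OF P.prob_space_axioms mh(5) mh(4) strategyD[OF \<sigma>]] P by blast
    have "distr (kernel_prod (history_space n) action_borel (?H P n) (\<sigma> n))
        (\<Pi>\<^sub>M i\<in>{..<Suc n}. pair_borel) (\<lambda>z. (fst (fst z))(n := (snd (fst z), snd z)))
      = distr P (\<Pi>\<^sub>M i\<in>{..<Suc n}. pair_borel)
        ((\<lambda>z. (fst (fst z))(n := (snd (fst z), snd z))) \<circ> (\<lambda>\<omega>. ((restrict \<omega> {..<n}, fst (\<omega> n)), snd (\<omega> n))))"
      unfolding kp[symmetric] by (rule distr_distr[OF upd measurable_Pair[OF mh(5) mh(4)]])
    also have "\<dots> = ?D P (Suc n)"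
      by (rule arg_cong[where f="distr P _"]) (auto simp: fun_eq_iff)
    finally show ?thesisD by simp
    have "has_conditional_law P (\<Pi>\<^sub>M i\<in>{..<Suc n}. pair_borel) (\<lambda>\<omega>. restrict \<omega> {..<Suc n})
        state_borel (\<lambda>\<omega>. fst (\<omega> (Suc n))) (\<lambda>h. p (h n))"
      using P by (simp only: lessThan_Suc_atMost)
    then show ?thesisH
      using has_conditional_law_iff_kernel_prod[OF P.prob_space_axioms mh(1) mh(3) pn] by blast
    \<comment> \<open>The empty history, paired with the initial state.\<close>
    have c: "(\<lambda>_. undefined, Some x0) \<in> space (history_space 0)"
      using x0 by (simp add: space_pair_measure space_PiM)
    have "?H P 0 = distr P (history_space 0) (\<lambda>\<omega>. (\<lambda>_. undefined, Some x0))"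
    proof (rule distr_cong_AE[OF refl refl _ mh(5)])
      have "AE \<omega> in P. fst (\<omega> 0) = Some x0" using P by blast
      then show "AE \<omega> in P. (restrict \<omega> {..<0}, fst (\<omega> 0)) = (\<lambda>_. undefined, Some x0)"
        by eventually_elim (simp add: restrict_def)
    qed (use c in simp)
    then show ?thesisI using P.distr_const[OF c] by simp
  qed
  have HH: "?H P n = ?H Q n" for n
  proof (induction n)
    case (Suc n)
    then show ?case by (simp only: H[OF P] H[OF Q] D[OF P] D[OF Q])
  qed (simp only: H0[OF P] H0[OF Q])
  have DH: "?D P n = distr (?H P n) (\<Pi>\<^sub>M i\<in>{..<n}. pair_borel) fst"
    if "is_strategic_measure x0 \<sigma> P" for P n
    using that measurable_history(5)[of P n]
    by (subst distr_distr) (auto simp: is_strategic_measure_def comp_def)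
  show ?thesis
  proof (rule measure_eqI_initial_segments)
    show "?D P n = ?D Q n" for n by (simp only: DH[OF P] DH[OF Q] HH)
  qed (use P Q in \<open>auto simp: is_strategic_measure_def\<close>)
qed

lemma is_strategic_measure_strategic_measure:
  assumes "strategy \<sigma>" "x0 \<in> topspace X" "{Some x0} \<in> sets state_borel"
  shows "is_strategic_measure x0 \<sigma> (strategic_measure x0 \<sigma>)"
  unfolding strategic_measure_def
  using strategic_measure_exists[OF assms] strategic_measure_unique[OF assms(1,2)]
  by (metis (no_types, lifting) theI)

text \<open>Occupation measures see the strategic measure only through these one-time laws of the
  pairs \<open>(x_n, a_(n+1))\<close>; the recursion proved below replaces path space in the
  analysis of strategies.\<close>

definition step_law :: "'x \<Rightarrow> (nat \<Rightarrow> (nat \<Rightarrow> 'x option \<times> 'a) \<times> 'x option \<Rightarrow> 'a measure)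
    \<Rightarrow> nat \<Rightarrow> ('x option \<times> 'a) measure"
  where "step_law x0 \<sigma> n = distr (strategic_measure x0 \<sigma>) pair_borel (\<lambda>\<omega>. \<omega> n)"

lemma sets_step_law [simp, measurable_cong]: "sets (step_law x0 \<sigma> n) = sets pair_borel"
  by (simp add: step_law_def)

context
  fixes x0 \<sigma>
  assumes \<sigma>: "strategy \<sigma>" and x0: "x0 \<in> topspace X" "{Some x0} \<in> sets state_borel"
begin

lemma prob_space_step_law: "prob_space (step_law x0 \<sigma> n)"
  using is_strategic_measure_strategic_measure[OF \<sigma> x0]
  by (auto simp: is_strategic_measure_def step_law_def intro: prob_space.prob_space_distr measurable_history)

lemma step_law_0:
  assumes g: "g \<in> borel_measurable state_borel"
  shows "(\<integral>\<^sup>+z. g (fst z) \<partial>step_law x0 \<sigma> 0) = g (Some x0)"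
proof -
  note P = is_strategic_measure_strategic_measure[OF \<sigma> x0, unfolded is_strategic_measure_def]
  interpret P: prob_space "strategic_measure x0 \<sigma>" using P by blast
  have sets: "sets (strategic_measure x0 \<sigma>) = sets trajectory_space" using P by blast
  have "(\<integral>\<^sup>+z. g (fst z) \<partial>step_law x0 \<sigma> 0) = (\<integral>\<^sup>+\<omega>. g (fst (\<omega> 0)) \<partial>strategic_measure x0 \<sigma>)"
    unfolding step_law_def using g
    by (intro nn_integral_distr measurable_history[OF sets]) simp
  also have "\<dots> = (\<integral>\<^sup>+\<omega>. g (Some x0) \<partial>strategic_measure x0 \<sigma>)"
    using P by (intro nn_integral_cong_AE) auto
  finally show ?thesis by (simp add: P.emeasure_space_1)
qed

text \<open>True for every strategy, however it depends on the past: the next state feels the past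
  only through the current pair, so one-time laws propagate without histories.\<close>

lemma step_law_Suc:
  assumes g: "g \<in> borel_measurable state_borel"
  shows "(\<integral>\<^sup>+z. g (fst z) \<partial>step_law x0 \<sigma> (Suc n)) = (\<integral>\<^sup>+z. \<integral>\<^sup>+y. g y \<partial>p z \<partial>step_law x0 \<sigma> n)"
proof -
  let ?P = "strategic_measure x0 \<sigma>" and ?D = "\<Pi>\<^sub>M i\<in>{..<Suc n}. pair_borel"
  note P = is_strategic_measure_strategic_measure[OF \<sigma> x0, unfolded is_strategic_measure_def]
  interpret P: prob_space ?P using P by blast
  have sets: "sets ?P = sets trajectory_space" using P by blast
  note mh = measurable_history[OF sets]
  have pn: "(\<lambda>h. p (h n)) \<in> measurable ?D (prob_algebra state_borel)"
    by (rule measurable_compose[OF _ kernel_p]) (rule measurable_component_singleton, simp)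
  have "has_conditional_law ?P ?D (\<lambda>\<omega>. restrict \<omega> {..<Suc n})
      state_borel (\<lambda>\<omega>. fst (\<omega> (Suc n))) (\<lambda>h. p (h n))"
    using P by (simp only: lessThan_Suc_atMost)
  then have eq: "distr ?P (?D \<Otimes>\<^sub>M state_borel) (\<lambda>\<omega>. (restrict \<omega> {..<Suc n}, fst (\<omega> (Suc n))))
      = kernel_prod ?D state_borel (distr ?P ?D (\<lambda>\<omega>. restrict \<omega> {..<Suc n})) (\<lambda>h. p (h n))"
    using has_conditional_law_iff_kernel_prod[OF P.prob_space_axioms mh(1) mh(3) pn] by blast
  have gs: "(\<lambda>z. g (snd z)) \<in> borel_measurable (?D \<Otimes>\<^sub>M state_borel)"
    by (rule measurable_compose[OF measurable_snd g])
  have pg: "(\<lambda>z. \<integral>\<^sup>+y. g y \<partial>p z) \<in> borel_measurable pair_borel"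
    by (rule measurable_compose[OF measurable_prob_algebraD[OF kernel_p] nn_integral_measurable_subprob_algebra[OF g]])
  have "(\<integral>\<^sup>+z. g (fst z) \<partial>step_law x0 \<sigma> (Suc n)) = (\<integral>\<^sup>+\<omega>. g (fst (\<omega> (Suc n))) \<partial>?P)"
    unfolding step_law_def using g by (intro nn_integral_distr mh) simp
  also have "\<dots> = (\<integral>\<^sup>+z. g (snd z) \<partial>distr ?P (?D \<Otimes>\<^sub>M state_borel) (\<lambda>\<omega>. (restrict \<omega> {..<Suc n}, fst (\<omega> (Suc n)))))"
    using gs by (subst nn_integral_distr[OF measurable_Pair[OF mh(1) mh(3)]]) (auto simp del: restrict_apply)
  also have "\<dots> = (\<integral>\<^sup>+h. \<integral>\<^sup>+y. g y \<partial>p (h n) \<partial>distr ?P ?D (\<lambda>\<omega>. restrict \<omega> {..<Suc n}))"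
    unfolding eq by (subst nn_integral_kernel_prod[OF pn _ gs]) simp_all
  also have "\<dots> = (\<integral>\<^sup>+\<omega>. \<integral>\<^sup>+y. g y \<partial>p (restrict \<omega> {..<Suc n} n) \<partial>?P)"
  proof (rule nn_integral_distr[OF mh(1)])
    have "(\<lambda>h. \<integral>\<^sup>+y. g y \<partial>p (h n)) \<in> borel_measurable ?D"
      by (rule measurable_compose[OF _ pg]) (rule measurable_component_singleton, simp)
    then show "(\<lambda>h. \<integral>\<^sup>+y. g y \<partial>p (h n)) \<in> borel_measurable (distr ?P ?D (\<lambda>\<omega>. restrict \<omega> {..<Suc n}))"
      by simp
  qed
  also have "\<dots> = (\<integral>\<^sup>+z. \<integral>\<^sup>+y. g y \<partial>p z \<partial>step_law x0 \<sigma> n)"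
    unfolding step_law_def using pg by (subst nn_integral_distr[OF mh(2)]) simp_all
  finally show ?thesis .
qed

text \<open>The Markov property is asked of \<open>\<sigma>\<close> at time \<open>n\<close> only,
  so a strategy may use a different kernel at each time, as the perturbed ones do.\<close>

lemma step_law_markov:
  assumes \<kappa>: "\<kappa> \<in> measurable state_borel (prob_algebra action_borel)"
    and eq: "\<And>h. h \<in> space (history_space n) \<Longrightarrow> \<sigma> n h = \<kappa> (snd h)"
    and h: "h \<in> borel_measurable pair_borel"
  shows "(\<integral>\<^sup>+z. h z \<partial>step_law x0 \<sigma> n) = (\<integral>\<^sup>+z. \<integral>\<^sup>+a. h (fst z, a) \<partial>\<kappa> (fst z) \<partial>step_law x0 \<sigma> n)"
proof -
  let ?P = "strategic_measure x0 \<sigma>" and ?Y = "\<lambda>\<omega>. (restrict \<omega> {..<n}, fst (\<omega> n))"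
  note P = is_strategic_measure_strategic_measure[OF \<sigma> x0, unfolded is_strategic_measure_def]
  interpret P: prob_space ?P using P by blast
  have sets: "sets ?P = sets trajectory_space" using P by blast
  note mh = measurable_history[OF sets]
  have eqd: "distr ?P (history_space n \<Otimes>\<^sub>M action_borel) (\<lambda>\<omega>. (?Y \<omega>, snd (\<omega> n)))
      = kernel_prod (history_space n) action_borel (distr ?P (history_space n) ?Y) (\<sigma> n)"
    using has_conditional_law_iff_kernel_prod[OF P.prob_space_axioms mh(5) mh(4) strategyD[OF \<sigma>]] P by blast
  have F: "(\<lambda>z. h (snd (fst z), snd z)) \<in> borel_measurable (history_space n \<Otimes>\<^sub>M action_borel)"
    by (rule measurable_compose[OF _ h]) simp
  have \<kappa>h: "(\<lambda>x. \<integral>\<^sup>+a. h (x, a) \<partial>\<kappa> x) \<in> borel_measurable state_borel"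
    using h by (intro nn_integral_measurable_subprob_algebra2[OF _ measurable_prob_algebraD[OF \<kappa>]]) simp
  have "(\<integral>\<^sup>+z. h z \<partial>step_law x0 \<sigma> n) = (\<integral>\<^sup>+\<omega>. h (\<omega> n) \<partial>?P)"
    unfolding step_law_def using h by (subst nn_integral_distr[OF mh(2)]) simp_all
  also have "\<dots> = (\<integral>\<^sup>+z. h (snd (fst z), snd z) \<partial>distr ?P (history_space n \<Otimes>\<^sub>M action_borel) (\<lambda>\<omega>. (?Y \<omega>, snd (\<omega> n))))"
    using F by (subst nn_integral_distr[OF measurable_Pair[OF mh(5) mh(4)]]) simp_all
  also have "\<dots> = (\<integral>\<^sup>+y. \<integral>\<^sup>+a. h (snd y, a) \<partial>\<sigma> n y \<partial>distr ?P (history_space n) ?Y)"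
    unfolding eqd by (subst nn_integral_kernel_prod[OF strategyD[OF \<sigma>] _ F]) simp_all
  also have "\<dots> = (\<integral>\<^sup>+y. \<integral>\<^sup>+a. h (snd y, a) \<partial>\<kappa> (snd y) \<partial>distr ?P (history_space n) ?Y)"
    by (intro nn_integral_cong) (simp add: eq)
  also have "\<dots> = (\<integral>\<^sup>+\<omega>. \<integral>\<^sup>+a. h (fst (\<omega> n), a) \<partial>\<kappa> (fst (\<omega> n)) \<partial>?P)"
    using measurable_compose[OF measurable_snd \<kappa>h] by (subst nn_integral_distr[OF mh(5)]) simp_all
  also have "\<dots> = (\<integral>\<^sup>+z. \<integral>\<^sup>+a. h (fst z, a) \<partial>\<kappa> (fst z) \<partial>step_law x0 \<sigma> n)"
    unfolding step_law_def using measurable_compose[OF measurable_fst \<kappa>h]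
    by (subst nn_integral_distr[OF mh(2)]) simp_all
  finally show ?thesis .
qed

end

section \<open>Stationary strategies\<close>

lemma None_sets [measurable]: "{None} \<in> sets state_borel"
  by (auto simp: sets_borel_of openin_adjoin_isolated intro!: sigma_sets.Basic)

definition alive :: "'x option \<Rightarrow> ennreal"
  where "alive x = (if x = None then 0 else 1)"

lemma alive_simps [simp]: "alive None = 0" "alive (Some y) = 1" "alive x \<le> 1"
  "alive x * alive x = alive x"
  by (auto simp: alive_def)

lemma alive_measurable [measurable]: "alive \<in> borel_measurable state_borel"
proof -
  have "(\<lambda>x. if x \<in> {None} then 0 else 1 :: ennreal) \<in> borel_measurable state_borel"
    by (rule measurable_If_set) auto
  then show ?thesis by (simp add: alive_def[abs_def])
qed

lemma nn_integral_p_measurable [measurable]: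
  assumes "g \<in> borel_measurable state_borel"
  shows "(\<lambda>z. \<integral>\<^sup>+y. g y \<partial>p z) \<in> borel_measurable pair_borel"
  by (rule measurable_compose[OF measurable_prob_algebraD[OF kernel_p] nn_integral_measurable_subprob_algebra[OF assms]])

lemma p_prob: "z \<in> space pair_borel \<Longrightarrow> prob_space (p z) \<and> sets (p z) = sets state_borel"
  using measurable_space[OF kernel_p] by (auto simp: space_prob_algebra)

lemma nn_integral_p_None:
  assumes a: "a \<in> topspace A" and g: "g None = 0"
  shows "(\<integral>\<^sup>+y. g y \<partial>p (None, a)) = 0"
proof -
  have p: "prob_space (p (None, a))" "sets (p (None, a)) = sets state_borel"
    using p_prob[of "(None, a)"] a by (auto simp: space_pair_measure)
  interpret prob_space "p (None, a)" by (fact p)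
  have "prob {None} = 1" using cemetery_absorbing[OF a] by (simp add: measure_def)
  then have "AE y in p (None, a). y \<in> {None}"
    using None_sets p(2) by (subst AE_in_set_eq_1) auto
  then have "(\<integral>\<^sup>+y. g y \<partial>p (None, a)) = (\<integral>\<^sup>+y. 0 \<partial>p (None, a))"
    by (intro nn_integral_cong_AE) (auto simp: g)
  then show ?thesis by simp
qed

text \<open>The occupation measure transported to \<open>X_Delta \<times> A\<close>, where the
  kernels act. Binding against the counting measure sums the step laws over all times; the density
  discards the time spent in the cemetery.\<close>

definition live_occupation :: "'x \<Rightarrow> (nat \<Rightarrow> (nat \<Rightarrow> 'x option \<times> 'a) \<times> 'x option \<Rightarrow> 'a measure)
    \<Rightarrow> ('x option \<times> 'a) measure"
  where "live_occupation x0 \<sigma> = density (count_space UNIV \<bind> step_law x0 \<sigma>) (\<lambda>z. alive (fst z))"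

context
  fixes x0 \<sigma>
  assumes \<sigma>: "strategy \<sigma>" and x0: "x0 \<in> topspace X" "{Some x0} \<in> sets state_borel"
begin

lemma step_law_subprob: "step_law x0 \<sigma> \<in> measurable (count_space UNIV) (subprob_algebra pair_borel)"
  using prob_space_step_law[OF \<sigma> x0] by (auto simp: space_subprob_algebra intro: prob_space_imp_subprob_space)

lemma sets_live_occupation: "sets (live_occupation x0 \<sigma>) = sets pair_borel"
  unfolding live_occupation_def by (simp add: sets_bind[where N=pair_borel])

lemma nn_integral_live_occupation:
  assumes h: "h \<in> borel_measurable pair_borel"
  shows "(\<integral>\<^sup>+z. h z \<partial>live_occupation x0 \<sigma>) = (\<Sum>n. \<integral>\<^sup>+z. alive (fst z) * h z \<partial>step_law x0 \<sigma> n)"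
proof -
  have s: "sets (count_space UNIV \<bind> step_law x0 \<sigma>) = sets pair_borel"
    by (simp add: sets_bind[where N=pair_borel])
  have "(\<integral>\<^sup>+z. h z \<partial>live_occupation x0 \<sigma>)
      = (\<integral>\<^sup>+z. alive (fst z) * h z \<partial>(count_space UNIV \<bind> step_law x0 \<sigma>))"
    unfolding live_occupation_def using h
    by (subst nn_integral_density) (auto simp: measurable_cong_sets[OF s refl])
  also have "\<dots> = (\<integral>\<^sup>+n. \<integral>\<^sup>+z. alive (fst z) * h z \<partial>step_law x0 \<sigma> n \<partial>count_space UNIV)"
    using h by (intro nn_integral_bind[OF _ step_law_subprob]) simp
  finally show ?thesis by (simp add: nn_integral_count_space_nat)
qed

lemma nn_integral_live_occupation_fst:
  assumes g: "g \<in> borel_measurable state_borel" "g None = 0"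
  shows "(\<integral>\<^sup>+z. g (fst z) \<partial>live_occupation x0 \<sigma>) = (\<Sum>n. \<integral>\<^sup>+z. g (fst z) \<partial>step_law x0 \<sigma> n)"
proof -
  have "alive x * g x = g x" for x using g(2) by (cases x) auto
  then show ?thesis
    using measurable_compose[OF measurable_fst g(1)] by (subst nn_integral_live_occupation) auto
qed

text \<open>The flow equation: a visit is either the start or the result of a transition. It is an
  index shift in the series of step laws, and it holds in \<open>[0, \<infinity>]\<close>.\<close>

lemma live_occupation_balance:
  assumes g: "g \<in> borel_measurable state_borel" "g None = 0"
  shows "(\<integral>\<^sup>+z. g (fst z) \<partial>live_occupation x0 \<sigma>)
    = g (Some x0) + (\<integral>\<^sup>+z. \<integral>\<^sup>+y. g y \<partial>p z \<partial>live_occupation x0 \<sigma>)"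
proof -
  \<comment> \<open>Nothing flows from the cemetery to where \<open>g\<close> is positive, so the
    factor \<open>alive\<close> may be dropped.\<close>
  have 1: "alive (fst z) * (\<integral>\<^sup>+y. g y \<partial>p z) = (\<integral>\<^sup>+y. g y \<partial>p z)" if "z \<in> space pair_borel" for z
    using that nn_integral_p_None[of "snd z" g] g(2)
    by (cases z; cases "fst z") (auto simp: space_pair_measure)
  have "(\<integral>\<^sup>+z. \<integral>\<^sup>+y. g y \<partial>p z \<partial>live_occupation x0 \<sigma>)
      = (\<Sum>n. \<integral>\<^sup>+z. alive (fst z) * (\<integral>\<^sup>+y. g y \<partial>p z) \<partial>step_law x0 \<sigma> n)"
    using g by (intro nn_integral_live_occupation) simp
  also have "\<dots> = (\<Sum>n. \<integral>\<^sup>+z. (\<integral>\<^sup>+y. g y \<partial>p z) \<partial>step_law x0 \<sigma> n)"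
    using 1 sets_eq_imp_space_eq[OF sets_step_law[of x0 \<sigma>]]
    by (intro suminf_cong nn_integral_cong) auto
  also have "\<dots> = (\<Sum>n. \<integral>\<^sup>+z. g (fst z) \<partial>step_law x0 \<sigma> (Suc n))"
    by (simp only: step_law_Suc[OF \<sigma> x0 g(1)])
  finally have 2: "(\<integral>\<^sup>+z. \<integral>\<^sup>+y. g y \<partial>p z \<partial>live_occupation x0 \<sigma>)
      = (\<Sum>n. \<integral>\<^sup>+z. g (fst z) \<partial>step_law x0 \<sigma> (Suc n))" .
  have "(\<lambda>n. \<integral>\<^sup>+z. g (fst z) \<partial>step_law x0 \<sigma> n) sums
      ((\<integral>\<^sup>+z. \<integral>\<^sup>+y. g y \<partial>p z \<partial>live_occupation x0 \<sigma>) + (\<integral>\<^sup>+z. g (fst z) \<partial>step_law x0 \<sigma> 0))"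
    unfolding 2 by (intro sums_Suc summable_sums) simp
  then show ?thesis
    using nn_integral_live_occupation_fst[OF g] step_law_0[OF \<sigma> x0 g(1)]
    by (simp add: sums_iff add.commute)
qed

end

text \<open>The only danger is mass circulating in a part of the state space where the lifetime under
  \<open>\<pi>\<close> has infinite expectation; \<open>\<pi>\<close> started at \<open>x0\<close> cannot enter that part, and since \<open>\<sigma>\<close> uses
  only actions charged by \<open>\<pi>\<close>, neither can \<open>\<sigma>\<close>.\<close>

lemma stationary_reproduces_occupation:
  assumes \<sigma>: "strategy \<sigma>" and \<tau>: "strategy \<tau>"
    and x0: "x0 \<in> topspace X" "{Some x0} \<in> sets state_borel"
    and \<pi>: "\<pi> \<in> measurable state_borel (prob_algebra action_borel)"
    and \<tau>\<pi>: "\<And>n h. h \<in> space (history_space n) \<Longrightarrow> \<tau> n h = \<pi> (snd h)"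
    and fin: "finite_measure (live_occupation x0 \<sigma>)"
    and dis: "live_occupation x0 \<sigma> = kernel_prod state_borel action_borel (distr (live_occupation x0 \<sigma>) state_borel fst) \<pi>"
  shows "live_occupation x0 \<tau> = live_occupation x0 \<sigma>"
proof -
  define M where "M = live_occupation x0 \<sigma>"
  interpret M: finite_measure M using fin by (simp add: M_def)
  have Mfin: "emeasure M (space M) < \<top>"
    using M.emeasure_finite[of "space M"] unfolding less_top infinity_ennreal_def .
  have sM: "sets M = sets pair_borel" unfolding M_def by (rule sets_live_occupation[OF \<sigma> x0])
  have mfst: "fst \<in> measurable M state_borel" by (simp add: measurable_cong_sets[OF sM refl])
  note \<pi>s = measurable_prob_algebraD[OF \<pi>]
  have \<pi>int: "(\<lambda>x. \<integral>\<^sup>+a. h (x, a) \<partial>\<pi> x) \<in> borel_measurable state_borel"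
    if "h \<in> borel_measurable pair_borel" for h
    using that by (intro nn_integral_measurable_subprob_algebra2[OF _ \<pi>s]) simp
  have dis': "(\<integral>\<^sup>+z. h z \<partial>M) = (\<integral>\<^sup>+z. \<integral>\<^sup>+a. h (fst z, a) \<partial>\<pi> (fst z) \<partial>M)"
    if h: "h \<in> borel_measurable pair_borel" for h
  proof -
    have "(\<integral>\<^sup>+z. h z \<partial>M) = (\<integral>\<^sup>+z. h z \<partial>kernel_prod state_borel action_borel (distr M state_borel fst) \<pi>)"
      using dis by (simp add: M_def)
    also have "\<dots> = (\<integral>\<^sup>+x. \<integral>\<^sup>+a. h (x, a) \<partial>\<pi> x \<partial>distr M state_borel fst)"
      by (rule nn_integral_kernel_prod[OF \<pi> _ h]) simp
    also have "\<dots> = (\<integral>\<^sup>+z. \<integral>\<^sup>+a. h (fst z, a) \<partial>\<pi> (fst z) \<partial>M)"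
      by (rule nn_integral_distr[OF mfst]) (simp add: \<pi>int[OF h])
    finally show ?thesis .
  qed
  have \<pi>sp: "prob_space (\<pi> x)" "space (\<pi> x) = topspace A" if "x \<in> space state_borel" for x
    using measurable_space[OF \<pi> that] sets_eq_imp_space_eq[of "\<pi> x" action_borel]
    by (auto simp: space_prob_algebra)

  \<comment> \<open>The one-step operator of the chain controlled by \<open>\<pi>\<close>; by
    \<open>\<tau>law\<close> its powers give expectations under \<open>\<tau>\<close>.\<close>
  define K where "K g x = (\<integral>\<^sup>+a. \<integral>\<^sup>+y. g y \<partial>p (x, a) \<partial>\<pi> x)" for g x
  have Km: "K g \<in> borel_measurable state_borel" if "g \<in> borel_measurable state_borel" for g
    unfolding K_def[abs_def] by (rule \<pi>int) (rule nn_integral_p_measurable[OF that])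
  have K0: "K g None = 0" if "g None = 0" for g
    unfolding K_def using that nn_integral_p_None[of _ g] \<pi>sp(2)[of None]
    by (subst nn_integral_cong[where v="\<lambda>_. 0"]) auto
  have Kmono: "K g x \<le> K g' x" if "\<And>y. g y \<le> g' y" for g g' x
    unfolding K_def by (intro nn_integral_mono that)
  have pm: "(\<lambda>a. \<integral>\<^sup>+y. g y \<partial>p (x, a)) \<in> borel_measurable (\<pi> x)"
    if "g \<in> borel_measurable state_borel" "x \<in> space state_borel" for g x
  proof -
    have "sets (\<pi> x) = sets action_borel"
      using measurable_space[OF \<pi> that(2)] by (simp add: space_prob_algebra)
    then show ?thesis
      using measurable_compose[OF measurable_Pair1'[OF that(2)] nn_integral_p_measurable[OF that(1)]]
      by (simp add: measurable_cong_sets[of "\<pi> x"])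
  qed
  have pgm: "g \<in> borel_measurable (p (x, a))"
    if "g \<in> borel_measurable state_borel" "x \<in> space state_borel" "a \<in> space (\<pi> x)" for g :: "'x option \<Rightarrow> ennreal" and x a
    using that p_prob[of "(x, a)"] \<pi>sp(2)[of x]
    by (auto simp: space_pair_measure measurable_cong_sets[of "p (x, a)" state_borel])
  have Ksuminf: "K (\<lambda>y. \<Sum>n. g n y) x = (\<Sum>n. K (g n) x)"
    if g: "\<And>n. g n \<in> borel_measurable state_borel" and x: "x \<in> space state_borel" for g :: "nat \<Rightarrow> 'x option \<Rightarrow> ennreal" and x
  proof -
    have "K (\<lambda>y. \<Sum>n. g n y) x = (\<integral>\<^sup>+a. (\<Sum>n. \<integral>\<^sup>+y. g n y \<partial>p (x, a)) \<partial>\<pi> x)"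
      unfolding K_def by (intro nn_integral_cong nn_integral_suminf pgm g x)
    also have "\<dots> = (\<Sum>n. K (g n) x)" unfolding K_def by (intro nn_integral_suminf pm g x)
    finally show ?thesis .
  qed
  have Kcmult: "K (\<lambda>y. c * g y) x = c * K g x"
    if g: "g \<in> borel_measurable state_borel" and x: "x \<in> space state_borel" for c g x
  proof -
    have "K (\<lambda>y. c * g y) x = (\<integral>\<^sup>+a. c * (\<integral>\<^sup>+y. g y \<partial>p (x, a)) \<partial>\<pi> x)"
      unfolding K_def by (intro nn_integral_cong nn_integral_cmult pgm g x)
    also have "\<dots> = c * K g x" unfolding K_def by (intro nn_integral_cmult pm g x)
    finally show ?thesis .
  qed
  have pow_m: "(K ^^ n) g \<in> borel_measurable state_borel" if "g \<in> borel_measurable state_borel" for g n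
    using that by (induction n) (auto intro: Km)
  have pow_0: "(K ^^ n) g None = 0" if "g None = 0" for g n
    using that by (induction n) (auto intro: K0)
  have pow_mono: "(K ^^ n) g y \<le> (K ^^ n) g' y" if "\<And>y. g y \<le> g' y" for g g' n y
    using that by (induction n arbitrary: y) (auto intro: Kmono)

  have balance: "(\<integral>\<^sup>+z. g (fst z) \<partial>M) = g (Some x0) + (\<integral>\<^sup>+z. K g (fst z) \<partial>M)"
    if g: "g \<in> borel_measurable state_borel" "g None = 0" for g
    using live_occupation_balance[OF \<sigma> x0 g] dis'[OF nn_integral_p_measurable[OF g(1)]]
    by (simp add: M_def K_def)
  \<comment> \<open>The balance unrolled \<open>n\<close> times. By \<open>\<tau>law\<close> the
    partial sum is what \<open>\<tau>\<close> accumulates in its first \<open>n\<close> steps; the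
    task is to make the last integral tend to 0.\<close>
  have iterate: "(\<integral>\<^sup>+z. g (fst z) \<partial>M)
      = (\<Sum>k<n. (K ^^ k) g (Some x0)) + (\<integral>\<^sup>+z. (K ^^ n) g (fst z) \<partial>M)"
    if g: "g \<in> borel_measurable state_borel" "g None = 0" for g n
    by (induction n) (use balance[OF pow_m pow_0] g in \<open>simp_all add: add.assoc\<close>)
  have \<tau>law: "(\<integral>\<^sup>+z. g (fst z) \<partial>step_law x0 \<tau> n) = (K ^^ n) g (Some x0)"
    if "g \<in> borel_measurable state_borel" for g n
    using that
  proof (induction n arbitrary: g)
    case 0
    then show ?case by (simp add: step_law_0[OF \<tau> x0])
  next
    case (Suc n)
    have "(\<integral>\<^sup>+z. g (fst z) \<partial>step_law x0 \<tau> (Suc n)) = (\<integral>\<^sup>+z. K g (fst z) \<partial>step_law x0 \<tau> n)"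
      unfolding step_law_Suc[OF \<tau> x0 Suc.prems] K_def
      by (rule step_law_markov[OF \<tau> x0 \<pi> \<tau>\<pi> nn_integral_p_measurable[OF Suc.prems]])
    also have "\<dots> = (K ^^ Suc n) g (Some x0)"
      using Suc.IH[OF Km[OF Suc.prems]] by (simp add: funpow_swap1)
    finally show ?case .
  qed

  \<comment> \<open>The expected lifetime under \<open>\<pi>\<close> from \<open>x\<close>. Dropping
    the remainder in \<open>iterate\<close> bounds it at \<open>x0\<close> by the mass of
    \<open>M\<close>.\<close>
  define f where "f x = (\<Sum>n. (K ^^ n) alive x)" for x
  have fm: "f \<in> borel_measurable state_borel"
    unfolding f_def using pow_m[OF alive_measurable] by measurable
  have f0: "f None = 0" unfolding f_def using pow_0[of alive] by simp
  have Kf: "K f x \<le> f x" if "x \<in> space state_borel" for x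
  proof -
    have "K f x = (\<Sum>n. (K ^^ Suc n) alive x)"
      unfolding f_def using Ksuminf[OF pow_m[OF alive_measurable] that] by simp
    moreover have "(\<lambda>n. (K ^^ n) alive x) sums ((\<Sum>n. (K ^^ Suc n) alive x) + (K ^^ 0) alive x)"
      by (intro sums_Suc summable_sums) simp
    ultimately show ?thesis unfolding f_def by (simp add: sums_iff del: funpow.simps)
  qed
  have Malive: "(\<integral>\<^sup>+z. alive (fst z) \<partial>M) < \<infinity>"
  proof -
    have "(\<integral>\<^sup>+z. alive (fst z) \<partial>M) \<le> (\<integral>\<^sup>+z. 1 \<partial>M)" by (intro nn_integral_mono) simp
    also have "\<dots> < \<infinity>" using Mfin by simp
    finally show ?thesis .
  qed
  have "f (Some x0) \<le> (\<integral>\<^sup>+z. alive (fst z) \<partial>M)"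
    unfolding f_def suminf_eq_SUP
  proof (rule SUP_least)
    show "(\<Sum>k<n. (K ^^ k) alive (Some x0)) \<le> (\<integral>\<^sup>+z. alive (fst z) \<partial>M)" for n
      unfolding iterate[OF alive_measurable alive_simps(1), of n] by simp
  qed
  then have fx0: "f (Some x0) < \<infinity>" using Malive by (rule le_less_trans)
  define F where "F = {x \<in> space state_borel. f x = \<infinity>}"
  have F: "F \<in> sets state_borel" unfolding F_def using fm by measurable
  have Fm: "indicator F \<in> borel_measurable state_borel" using F by simp
  \<comment> \<open>Entering \<open>F\<close> with positive probability would make
    \<open>K f x\<close> infinite, whereas \<open>K f x \<le> f x\<close> and \<open>f x\<close> is
    finite off \<open>F\<close>.\<close>
  have KF: "K (indicator F) x = 0" if "x \<in> space state_borel" "x \<notin> F" for x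
  proof (rule ccontr)
    assume "K (indicator F) x \<noteq> 0"
    then have "\<infinity> = \<infinity> * K (indicator F) x" by (simp add: ennreal_top_mult)
    also have "\<dots> = K (\<lambda>y. \<infinity> * indicator F y) x" by (rule Kcmult[OF Fm that(1), symmetric])
    also have "\<dots> \<le> K f x" by (rule Kmono) (auto simp: F_def split: split_indicator)
    also have "\<dots> \<le> f x" by (rule Kf[OF that(1)])
    finally show False using that by (simp add: F_def top_unique)
  qed
  \<comment> \<open>The probability of jumping into \<open>F\<close> from outside, as a function of
    state and action. Averaged over \<open>\<pi>\<close> it vanishes by \<open>KF\<close>; as
    \<open>M\<close> disintegrates along \<open>\<pi>\<close>, its integral over \<open>M\<close>
    vanishes too, and therefore its live part vanishes under each step law of
    \<open>\<sigma>\<close>.\<close>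
  define e where "e z = (indicator (- F) (fst z) * (\<integral>\<^sup>+y. indicator F y \<partial>p z) :: ennreal)" for z
  have mF: "(\<lambda>z. indicator (- F) (fst z) :: ennreal) \<in> borel_measurable pair_borel"
  proof -
    have "(\<lambda>z. 1 - indicator F (fst z) :: ennreal) \<in> borel_measurable pair_borel"
      using measurable_compose[OF measurable_fst Fm] by measurable
    moreover have "1 - indicator F x = (indicator (- F) x :: ennreal)" for x
      by (auto split: split_indicator)
    ultimately show ?thesis by simp
  qed
  have em: "e \<in> borel_measurable pair_borel"
    unfolding e_def using mF nn_integral_p_measurable[OF Fm] by (rule borel_measurable_times_ennreal)
  have "(\<integral>\<^sup>+z. e z \<partial>M) = (\<integral>\<^sup>+z. indicator (- F) (fst z) * K (indicator F) (fst z) \<partial>M)"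
    unfolding dis'[OF em]
  proof (rule nn_integral_cong)
    fix z assume "z \<in> space M"
    then have "fst z \<in> space state_borel" by (rule measurable_space[OF mfst])
    then show "(\<integral>\<^sup>+a. e (fst z, a) \<partial>\<pi> (fst z)) = indicator (- F) (fst z) * K (indicator F) (fst z)"
      unfolding e_def K_def using pm[OF Fm] by (simp add: nn_integral_cmult)
  qed
  also have "\<dots> = (\<integral>\<^sup>+z. 0 \<partial>M)"
  proof (rule nn_integral_cong)
    fix z assume "z \<in> space M"
    then have "fst z \<in> space state_borel" by (rule measurable_space[OF mfst])
    then show "indicator (- F) (fst z) * K (indicator F) (fst z) = (0::ennreal)"
      using KF by (cases "fst z \<in> F") auto
  qed
  finally have "(\<Sum>n. \<integral>\<^sup>+z. alive (fst z) * e z \<partial>step_law x0 \<sigma> n) = 0"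
    using nn_integral_live_occupation[OF \<sigma> x0 em] by (simp add: M_def)
  then have e0: "(\<integral>\<^sup>+z. alive (fst z) * e z \<partial>step_law x0 \<sigma> n) = 0" for n
    by (subst (asm) suminf_eq_zero_iff) auto
  have NF: "None \<notin> F" using f0 by (simp add: F_def)
  \<comment> \<open>A visit to \<open>F\<close> comes from \<open>F\<close> itself (null by
    induction), from a live state outside \<open>F\<close> (null by \<open>e0\<close>) or from the
    cemetery (impossible).\<close>
  have \<sigma>F: "(\<integral>\<^sup>+z. indicator F (fst z) \<partial>step_law x0 \<sigma> n) = 0" for n
  proof (induction n)
    case 0
    have "Some x0 \<notin> F" using fx0 by (auto simp: F_def)
    then show ?case by (simp add: step_law_0[OF \<sigma> x0 Fm])
  next
    case (Suc n)
    have "(\<integral>\<^sup>+z. indicator F (fst z) \<partial>step_law x0 \<sigma> (Suc n))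
        = (\<integral>\<^sup>+z. \<integral>\<^sup>+y. indicator F y \<partial>p z \<partial>step_law x0 \<sigma> n)"
      by (rule step_law_Suc[OF \<sigma> x0 Fm])
    also have "\<dots> \<le> (\<integral>\<^sup>+z. indicator F (fst z) + alive (fst z) * e z \<partial>step_law x0 \<sigma> n)"
    proof (rule nn_integral_mono)
      fix z assume "z \<in> space (step_law x0 \<sigma> n)"
      then have z: "z \<in> space pair_borel" using sets_eq_imp_space_eq[OF sets_step_law] by blast
      interpret pz: prob_space "p z" using p_prob[OF z] by simp
      have le1: "(\<integral>\<^sup>+y. indicator F y \<partial>p z) \<le> 1"
        using p_prob[OF z] F pz.emeasure_le_1 by simp
      show "(\<integral>\<^sup>+y. indicator F y \<partial>p z) \<le> indicator F (fst z) + alive (fst z) * e z"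
      proof (cases "fst z = None")
        case True
        then have "(\<integral>\<^sup>+y. indicator F y \<partial>p z) = 0"
          using nn_integral_p_None[of "snd z" "indicator F"] NF z by (cases z) (auto simp: space_pair_measure)
        then show ?thesis by simp
      next
        case False
        then show ?thesis using le1 by (auto simp: e_def split: split_indicator)
      qed
    qed
    also have "\<dots> = (\<integral>\<^sup>+z. indicator F (fst z) \<partial>step_law x0 \<sigma> n) + (\<integral>\<^sup>+z. alive (fst z) * e z \<partial>step_law x0 \<sigma> n)"
    proof (rule nn_integral_add)
      show "(\<lambda>z. indicator F (fst z) :: ennreal) \<in> borel_measurable (step_law x0 \<sigma> n)"
        by (subst measurable_cong_sets[OF sets_step_law refl]) (rule measurable_compose[OF measurable_fst Fm])
      show "(\<lambda>z. alive (fst z) * e z) \<in> borel_measurable (step_law x0 \<sigma> n)"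
        using em by measurable
    qed
    also have "\<dots> = 0" using Suc.IH e0 by simp
    finally show ?case by simp
  qed
  have "(\<integral>\<^sup>+z. indicator F (fst z) \<partial>M) = 0"
    unfolding M_def using \<sigma>F NF by (subst nn_integral_live_occupation_fst[OF \<sigma> x0 Fm]) auto
  then have AEF: "AE z in M. fst z \<notin> F"
    using measurable_compose[OF mfst Fm] by (subst (asm) nn_integral_0_iff_AE) (auto split: split_indicator_asm)

  have u1: "(K ^^ n) alive x \<le> 1" if "x \<in> space state_borel" for n x
    using that
  proof (induction n arbitrary: x)
    case (Suc n)
    have "(K ^^ Suc n) alive x = (\<integral>\<^sup>+a. \<integral>\<^sup>+y. (K ^^ n) alive y \<partial>p (x, a) \<partial>\<pi> x)" by (simp add: K_def)
    also have "\<dots> \<le> (\<integral>\<^sup>+a. 1 \<partial>\<pi> x)"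
    proof (rule nn_integral_mono)
      fix a assume "a \<in> space (\<pi> x)"
      then have z: "(x, a) \<in> space pair_borel" using Suc.prems \<pi>sp(2)[of x] by (simp add: space_pair_measure)
      interpret pz: prob_space "p (x, a)" using p_prob[OF z] by simp
      have "(\<integral>\<^sup>+y. (K ^^ n) alive y \<partial>p (x, a)) \<le> (\<integral>\<^sup>+y. 1 \<partial>p (x, a))"
        using p_prob[OF z] by (intro nn_integral_mono Suc.IH) (auto dest: sets_eq_imp_space_eq)
      then show "(\<integral>\<^sup>+y. (K ^^ n) alive y \<partial>p (x, a)) \<le> 1" by (simp add: pz.emeasure_space_1)
    qed
    also have "\<dots> = 1" using prob_space.emeasure_space_1[OF \<pi>sp(1)[OF Suc.prems]] by simp
    finally show ?case .
  qed simp
  have ulim: "(\<lambda>n. (K ^^ n) alive x) \<longlonglongrightarrow> 0" if "x \<in> space state_borel" "x \<notin> F" for x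
  proof -
    define r where "r n = enn2real ((K ^^ n) alive x)" for n
    have r: "ennreal (r n) = (K ^^ n) alive x" for n
      unfolding r_def using u1[OF that(1), of n] by (intro ennreal_enn2real) (simp add: le_less_trans)
    have "(\<Sum>n. ennreal (r n)) \<noteq> \<top>" using that by (simp add: r F_def f_def)
    then have "summable r" by (intro summable_suminf_not_top) (auto simp: r_def)
    then have "r \<longlonglongrightarrow> 0" by (rule summable_LIMSEQ_zero)
    then have "(\<lambda>n. ennreal (r n)) \<longlonglongrightarrow> ennreal 0" by (rule tendsto_ennrealI)
    then show ?thesis by (simp add: r)
  qed
  \<comment> \<open>Off \<open>F\<close> the terms of the convergent series \<open>f\<close> tend to
    0. They are bounded by 1, which is integrable for the finite measure \<open>M\<close>, so the
    remainder for \<open>alive\<close> vanishes.\<close>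
  have "(\<lambda>n. \<integral>\<^sup>+z. (K ^^ n) alive (fst z) \<partial>M) \<longlonglongrightarrow> (\<integral>\<^sup>+z. 0 \<partial>M)"
  proof (rule nn_integral_dominated_convergence[where w="\<lambda>_. 1"])
    show "(\<lambda>z. (K ^^ n) alive (fst z)) \<in> borel_measurable M" for n
      by (rule measurable_compose[OF mfst pow_m[OF alive_measurable]])
    show "AE z in M. (K ^^ n) alive (fst z) \<le> 1" for n
      using u1 measurable_space[OF mfst] by auto
    show "(\<integral>\<^sup>+z. 1 \<partial>M) < \<infinity>" using Mfin by simp
    show "AE z in M. (\<lambda>n. (K ^^ n) alive (fst z)) \<longlonglongrightarrow> 0"
      using AEF AE_space by eventually_elim (use ulim measurable_space[OF mfst] in auto)
  qed auto
  then have tail: "(\<lambda>n. \<integral>\<^sup>+z. (K ^^ n) alive (fst z) \<partial>M) \<longlonglongrightarrow> 0" by simp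
  \<comment> \<open>For \<open>g \<le> alive\<close> the remainder is squeezed between 0 and the
    remainder for \<open>alive\<close>.\<close>
  have series: "(\<integral>\<^sup>+z. g (fst z) \<partial>M) = (\<Sum>n. (K ^^ n) g (Some x0))"
    if g: "g \<in> borel_measurable state_borel" "\<And>x. g x \<le> alive x" for g
  proof -
    have g0: "g None = 0" using g(2)[of None] by simp
    have "(\<lambda>n. \<integral>\<^sup>+z. (K ^^ n) g (fst z) \<partial>M) \<longlonglongrightarrow> 0"
      by (rule tendsto_sandwich[OF _ _ tendsto_const tail])
        (auto intro!: always_eventually nn_integral_mono pow_mono g(2))
    then have "(\<lambda>n. (\<Sum>k<n. (K ^^ k) g (Some x0)) + (\<integral>\<^sup>+z. (K ^^ n) g (fst z) \<partial>M))
        \<longlonglongrightarrow> (\<Sum>n. (K ^^ n) g (Some x0)) + 0"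
      by (intro tendsto_add summable_LIMSEQ) auto
    then have "(\<lambda>n::nat. \<integral>\<^sup>+z. g (fst z) \<partial>M) \<longlonglongrightarrow> (\<Sum>n. (K ^^ n) g (Some x0))"
      using iterate[OF g(1) g0] by simp
    then show ?thesis by (rule LIMSEQ_unique[OF tendsto_const])
  qed

  have "live_occupation x0 \<tau> = M"
  proof (rule measure_eqI)
    show "sets (live_occupation x0 \<tau>) = sets M"
      unfolding sM by (rule sets_live_occupation[OF \<tau> x0])
    fix E assume "E \<in> sets (live_occupation x0 \<tau>)"
    then have E: "E \<in> sets pair_borel" by (simp add: sets_live_occupation[OF \<tau> x0])
    define h where "h z = (alive (fst z) * indicator E z :: ennreal)" for z
    have h: "h \<in> borel_measurable pair_borel" unfolding h_def using E by measurable
    have ah: "alive (fst z) * indicator E z = h z" "alive (fst z) * h z = h z" for z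
      by (auto simp: h_def alive_def)
    \<comment> \<open>The factor on the right enforces \<open>g \<le> alive\<close> at every
      argument, also outside the state space, where nothing is known about
      \<open>\<pi>\<close>.\<close>
    define g where "g x = (\<integral>\<^sup>+a. h (x, a) \<partial>\<pi> x) * indicator (space state_borel) x" for x
    have gm: "g \<in> borel_measurable state_borel" unfolding g_def using \<pi>int[OF h] by measurable
    have gle: "g x \<le> alive x" for x
    proof (cases "x \<in> space state_borel")
      case True
      have "(\<integral>\<^sup>+a. h (x, a) \<partial>\<pi> x) \<le> (\<integral>\<^sup>+a. alive x \<partial>\<pi> x)"
        by (intro nn_integral_mono) (auto simp: h_def split: split_indicator)
      also have "\<dots> = alive x" using prob_space.emeasure_space_1[OF \<pi>sp(1)[OF True]] by simp
      finally show ?thesis using True by (simp add: g_def)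
    qed (simp add: g_def)
    have g0: "g None = 0" using gle[of None] by simp
    have gh: "(\<integral>\<^sup>+a. h (fst z, a) \<partial>\<pi> (fst z)) = g (fst z)" if "z \<in> space pair_borel" for z
      using that by (auto simp: g_def space_pair_measure)
    have ME: "emeasure N E = (\<integral>\<^sup>+z. h z \<partial>N)" if N: "N = live_occupation x0 \<rho>" and \<rho>: "strategy \<rho>" for N \<rho>
    proof -
      have "emeasure N E = (\<integral>\<^sup>+z. indicator E z \<partial>N)"
        using E sets_live_occupation[OF \<rho> x0] by (simp add: N)
      then show ?thesis
        using E h unfolding N by (simp add: nn_integral_live_occupation[OF \<rho> x0] ah del: nn_integral_indicator)
    qed
    have "emeasure (live_occupation x0 \<tau>) E = (\<Sum>n. \<integral>\<^sup>+z. h z \<partial>step_law x0 \<tau> n)"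
      using h by (simp add: ME[OF refl \<tau>] nn_integral_live_occupation[OF \<tau> x0] ah)
    also have "\<dots> = (\<Sum>n. \<integral>\<^sup>+z. g (fst z) \<partial>step_law x0 \<tau> n)"
      using gh sets_eq_imp_space_eq[OF sets_step_law]
      by (subst step_law_markov[OF \<tau> x0 \<pi> \<tau>\<pi> h]) (auto intro!: suminf_cong nn_integral_cong)
    also have "\<dots> = (\<integral>\<^sup>+z. g (fst z) \<partial>M)"
      by (simp add: \<tau>law[OF gm] series[OF gm gle])
    also have "\<dots> = (\<integral>\<^sup>+z. h z \<partial>M)"
      unfolding dis'[OF h] using gh sets_eq_imp_space_eq[OF sM]
      by (intro nn_integral_cong) auto
    also have "\<dots> = emeasure M E" by (simp add: ME[OF M_def \<sigma>])
    finally show "emeasure (live_occupation x0 \<tau>) E = emeasure M E" .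
  qed
  then show ?thesis by (simp add: M_def)
qed

section \<open>Occupation measures on the space without cemetery\<close>

abbreviation embed :: "'x \<times> 'a \<Rightarrow> 'x option \<times> 'a"
  where "embed \<equiv> map_prod Some id"

lemma measurable_Some: "Some \<in> measurable (borel_of X) state_borel"
proof (rule measurable_borel_ofI)
  fix U assume "openin (adjoin_isolated X) U"
  then have U: "openin X {x. Some x \<in> U}" by (simp add: openin_adjoin_isolated)
  then have "Some -` U \<inter> space (borel_of X) = {x. Some x \<in> U}" by (auto dest: openin_subset)
  then show "Some -` U \<inter> space (borel_of X) \<in> sets (borel_of X)" using U by (simp add: openin_borel_of)
qed simp

lemma measurable_embed: "embed \<in> measurable (borel_of X \<Otimes>\<^sub>M action_borel) pair_borel"
  using measurable_compose[OF measurable_fst measurable_Some]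
  by (auto simp: map_prod_def case_prod_beta' intro!: measurable_Pair)

lemma sets_Some_image:
  assumes "E \<in> sets (borel_of X)"
  shows "Some ` E \<in> sets state_borel"
  using assms unfolding sets_borel_of[of X]
proof induction
  case (Basic U)
  then show ?case
    by (intro openin_borel_of) (auto simp: openin_adjoin_isolated inj_image_mem_iff)
next
  case (Compl U)
  have "Some ` (topspace X - U) = space state_borel - {None} - Some ` U" by auto
  then show ?case using Compl.IH by (auto simp del: space_borel_of)
qed (auto simp: image_Union)

text \<open>The map \<open>r\<close> is a measurable left inverse of \<open>Some\<close>, with
  \<open>x0\<close> as its value at the cemetery; the image of \<open>E\<close> is then a preimage
  with the cemetery slice removed.\<close>

lemma sets_embed_image:
  assumes "x0 \<in> topspace X" and E: "E \<in> sets (borel_of X \<Otimes>\<^sub>M action_borel)"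
  shows "embed ` E \<in> sets pair_borel"
proof -
  define r where "r y = (case y of None \<Rightarrow> x0 | Some x \<Rightarrow> x)" for y
  have r: "r \<in> measurable state_borel (borel_of X)"
  proof (rule measurable_borel_ofI)
    fix U assume "openin X U"
    then have "Some ` U \<in> sets state_borel" "U \<subseteq> topspace X"
      by (auto intro: sets_Some_image openin_borel_of dest: openin_subset)
    moreover have "(if x0 \<in> U then {None} else {}) \<in> sets state_borel" by simp
    moreover have "r -` U \<inter> space state_borel = Some ` U \<union> (if x0 \<in> U then {None} else {})"
      using \<open>U \<subseteq> topspace X\<close> by (auto simp: r_def split: option.splits)
    ultimately show "r -` U \<inter> space state_borel \<in> sets state_borel" by (simp only: sets.Un)
  qed (use assms in \<open>auto simp: r_def\<close>)
  have m: "(\<lambda>z. (r (fst z), snd z)) \<in> measurable pair_borel (borel_of X \<Otimes>\<^sub>M action_borel)"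
    by (rule measurable_Pair[OF measurable_compose[OF measurable_fst r] measurable_snd])
  have "embed ` E = ((\<lambda>z. (r (fst z), snd z)) -` E \<inter> space pair_borel) - {None} \<times> topspace A"
    using sets.sets_into_space[OF E]
    by (force simp: r_def space_pair_measure image_iff split: option.splits)
  moreover have "{None} \<times> topspace A \<in> sets pair_borel"
    using pair_measureI[OF None_sets sets.top[of action_borel]] by simp
  ultimately show ?thesis using measurable_sets[OF m E] by auto
qed

lemma sets_occupation_measure: "sets (occupation_measure x0 \<sigma>) = sets (borel_of X \<Otimes>\<^sub>M action_borel)"
  using sets.space_closed[of "borel_of X \<Otimes>\<^sub>M action_borel"] sets.sigma_sets_eq[of "borel_of X \<Otimes>\<^sub>M action_borel"]
  by (simp add: occupation_measure_def space_pair_measure)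

lemma space_occupation_measure: "space (occupation_measure x0 \<sigma>) = topspace X \<times> topspace A"
  using sets_eq_imp_space_eq[OF sets_occupation_measure] by (simp add: space_pair_measure)

context
  fixes x0
  assumes x0: "x0 \<in> topspace X" "{Some x0} \<in> sets state_borel"
begin

text \<open>\<open>measure_of\<close> returns the intended values only for a countably additive set
  function. This is checked by recognising the series as \<open>live_occupation\<close> on image
  sets, \<open>embed\<close> being injective.\<close>

lemma emeasure_occupation_measure:
  assumes \<sigma>: "strategy \<sigma>" and E: "E \<in> sets (borel_of X \<Otimes>\<^sub>M action_borel)"
  shows "emeasure (occupation_measure x0 \<sigma>) E = emeasure (live_occupation x0 \<sigma>) (embed ` E)"
proof -
  let ?S = "sets (borel_of X \<Otimes>\<^sub>M action_borel)" and ?P = "strategic_measure x0 \<sigma>"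
  let ?\<mu> = "\<lambda>E. \<Sum>n. emeasure ?P {\<omega> \<in> space ?P. \<omega> n \<in> embed ` E}"
  have sets: "sets ?P = sets trajectory_space"
    using is_strategic_measure_strategic_measure[OF \<sigma> x0] by (simp add: is_strategic_measure_def)
  have eq: "?\<mu> E = emeasure (live_occupation x0 \<sigma>) (embed ` E)" if E: "E \<in> ?S" for E
  proof -
    have iE: "embed ` E \<in> sets pair_borel" by (rule sets_embed_image[OF x0(1) E])
    have "emeasure (live_occupation x0 \<sigma>) (embed ` E) = (\<integral>\<^sup>+z. indicator (embed ` E) z \<partial>live_occupation x0 \<sigma>)"
      using iE by (simp add: sets_live_occupation[OF \<sigma> x0])
    also have "\<dots> = (\<Sum>n. \<integral>\<^sup>+z. alive (fst z) * indicator (embed ` E) z \<partial>step_law x0 \<sigma> n)"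
      using iE by (intro nn_integral_live_occupation[OF \<sigma> x0]) simp
    also have "\<dots> = (\<Sum>n. \<integral>\<^sup>+z. indicator (embed ` E) z \<partial>step_law x0 \<sigma> n)"
      by (intro suminf_cong nn_integral_cong) (auto split: split_indicator)
    also have "\<dots> = ?\<mu> E"
    proof (rule suminf_cong)
      fix n
      have "(\<lambda>\<omega>. \<omega> n) -` (embed ` E) \<inter> space ?P = {\<omega> \<in> space ?P. \<omega> n \<in> embed ` E}" by blast
      then show "(\<integral>\<^sup>+z. indicator (embed ` E) z \<partial>step_law x0 \<sigma> n) = emeasure ?P {\<omega> \<in> space ?P. \<omega> n \<in> embed ` E}"
        using iE emeasure_distr[OF measurable_history(2)[OF sets] iE, of n] by (simp add: step_law_def)
    qed
    finally show ?thesis by simp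
  qed
  have inj: "inj embed" by (simp add: prod.inj_map)
  show ?thesis
    unfolding occupation_measure_def eq[OF E, symmetric]
  proof (rule emeasure_measure_of_sigma)
    show "sigma_algebra (topspace X \<times> topspace A) ?S"
      using sets.sigma_algebra_axioms[of "borel_of X \<Otimes>\<^sub>M action_borel"] by (simp add: space_pair_measure)
    show "positive ?S ?\<mu>" by (simp add: positive_def)
    show "countably_additive ?S ?\<mu>"
    proof (rule countably_additiveI)
      fix D :: "nat \<Rightarrow> ('x \<times> 'a) set" assume D: "range D \<subseteq> ?S" "disjoint_family D" "(\<Union>i. D i) \<in> ?S"
      have "(\<Sum>i. emeasure (live_occupation x0 \<sigma>) (embed ` D i)) = emeasure (live_occupation x0 \<sigma>) (\<Union>i. embed ` D i)"
      proof (rule suminf_emeasure)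
        show "range (\<lambda>i. embed ` D i) \<subseteq> sets (live_occupation x0 \<sigma>)"
          using D(1) sets_embed_image[OF x0(1)] by (auto simp: sets_live_occupation[OF \<sigma> x0])
        show "disjoint_family (\<lambda>i. embed ` D i)"
          using D(2) inj by (auto simp: disjoint_family_on_def image_Int[symmetric])
      qed
      moreover have "(\<Union>i. embed ` D i) = embed ` (\<Union>i. D i)" by auto
      moreover have "D i \<in> ?S" for i using D(1) by auto
      ultimately show "(\<Sum>i. ?\<mu> (D i)) = ?\<mu> (\<Union>i. D i)" by (simp only: eq D(3))
    qed
  qed fact
qed

lemma live_occupation_eq_distr:
  assumes \<sigma>: "strategy \<sigma>"
  shows "live_occupation x0 \<sigma> = distr (occupation_measure x0 \<sigma>) pair_borel embed"
proof (rule measure_eqI)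
  fix E assume "E \<in> sets (live_occupation x0 \<sigma>)"
  then have E: "E \<in> sets pair_borel" by (simp add: sets_live_occupation[OF \<sigma> x0])
  have me: "embed \<in> measurable (occupation_measure x0 \<sigma>) pair_borel"
    by (subst measurable_cong_sets[OF sets_occupation_measure refl]) (rule measurable_embed)
  have E': "embed -` E \<inter> space (occupation_measure x0 \<sigma>) \<in> sets (borel_of X \<Otimes>\<^sub>M action_borel)"
    using measurable_sets[OF me E] by (simp add: sets_occupation_measure)
  let ?E = "embed ` (embed -` E \<inter> space (occupation_measure x0 \<sigma>))"
  have iE: "?E \<in> sets pair_borel" by (rule sets_embed_image[OF x0(1) E'])
  \<comment> \<open>\<open>E\<close> and \<open>?E\<close> differ only in pairs whose state is the
    cemetery, and these \<open>alive\<close> removes.\<close>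
  have *: "alive (fst z) * indicator E z = alive (fst z) * indicator ?E z" if "z \<in> space pair_borel" for z
    using that sets.sets_into_space[OF E]
    by (cases z; cases "fst z") (auto simp: space_occupation_measure space_pair_measure image_iff split: split_indicator
          intro!: bexI[of _ "(the (fst z), snd z)"])
  have "emeasure (live_occupation x0 \<sigma>) E = (\<Sum>n. \<integral>\<^sup>+z. alive (fst z) * indicator E z \<partial>step_law x0 \<sigma> n)"
    using E nn_integral_live_occupation[OF \<sigma> x0, of "indicator E"] by (simp add: sets_live_occupation[OF \<sigma> x0])
  also have "\<dots> = (\<Sum>n. \<integral>\<^sup>+z. alive (fst z) * indicator ?E z \<partial>step_law x0 \<sigma> n)"
    using * sets_eq_imp_space_eq[OF sets_step_law] by (intro suminf_cong nn_integral_cong) auto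
  also have "\<dots> = emeasure (live_occupation x0 \<sigma>) ?E"
    using iE nn_integral_live_occupation[OF \<sigma> x0, of "indicator ?E"] by (simp add: sets_live_occupation[OF \<sigma> x0])
  also have "\<dots> = emeasure (distr (occupation_measure x0 \<sigma>) pair_borel embed) E"
    by (simp add: emeasure_distr[OF me E] emeasure_occupation_measure[OF \<sigma> E'])
  finally show "emeasure (live_occupation x0 \<sigma>) E = emeasure (distr (occupation_measure x0 \<sigma>) pair_borel embed) E" .
qed (simp add: sets_live_occupation[OF \<sigma> x0])

lemma occupation_measure_eqI:
  assumes "strategy \<sigma>" "strategy \<tau>" "live_occupation x0 \<sigma> = live_occupation x0 \<tau>"
  shows "occupation_measure x0 \<sigma> = occupation_measure x0 \<tau>"
  using assms by (intro measure_eqI) (auto simp: sets_occupation_measure emeasure_occupation_measure)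

lemma finite_live_occupation_iff:
  assumes \<sigma>: "strategy \<sigma>"
  shows "finite_measure (live_occupation x0 \<sigma>)
    \<longleftrightarrow> emeasure (occupation_measure x0 \<sigma>) (topspace X \<times> topspace A) < \<infinity>"
proof -
  have me: "embed \<in> measurable (occupation_measure x0 \<sigma>) pair_borel"
    by (subst measurable_cong_sets[OF sets_occupation_measure refl]) (rule measurable_embed)
  have "embed -` space pair_borel \<inter> space (occupation_measure x0 \<sigma>) = topspace X \<times> topspace A"
    by (auto simp: space_occupation_measure space_pair_measure)
  then have eq: "emeasure (live_occupation x0 \<sigma>) (space (live_occupation x0 \<sigma>))
      = emeasure (occupation_measure x0 \<sigma>) (topspace X \<times> topspace A)"
    unfolding live_occupation_eq_distr[OF \<sigma>] by (simp add: emeasure_distr[OF me])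
  show ?thesis
  proof
    assume "finite_measure (live_occupation x0 \<sigma>)"
    then show "emeasure (occupation_measure x0 \<sigma>) (topspace X \<times> topspace A) < \<infinity>"
      using finite_measure.finite_emeasure_space[of "live_occupation x0 \<sigma>"] eq
      by (simp add: less_top[symmetric])
  qed (use eq in \<open>auto intro!: finite_measureI\<close>)
qed

end

text \<open>On the graph the point \<open>(fst z, \<phi> (fst z))\<close> is \<open>z\<close>
  itself, so integrating the Dirac kernel over the marginal gives back \<open>M\<close>.\<close>

lemma kernel_prod_return_graph:
  assumes M: "sets M = sets pair_borel" and \<phi>: "\<phi> \<in> measurable state_borel action_borel"
    and AE: "AE z in M. snd z = \<phi> (fst z)"
  shows "M = kernel_prod state_borel action_borel (distr M state_borel fst) (\<lambda>x. return action_borel (\<phi> x))"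
proof (rule measure_eqI)
  have k: "(\<lambda>x. return action_borel (\<phi> x)) \<in> measurable state_borel (prob_algebra action_borel)"
    by (rule measurable_compose[OF \<phi> measurable_return_prob_space])
  show s: "sets M = sets (kernel_prod state_borel action_borel (distr M state_borel fst) (\<lambda>x. return action_borel (\<phi> x)))"
    by (subst sets_kernel_prod[OF k]) (simp_all add: M)
  have mf: "fst \<in> measurable M state_borel" by (simp add: measurable_cong_sets[OF M refl])
  fix E assume "E \<in> sets M"
  then have E: "E \<in> sets pair_borel" by (simp add: M)
  have graph: "(\<lambda>x. (x, \<phi> x)) \<in> measurable state_borel pair_borel" using \<phi> by simp
  have "emeasure (kernel_prod state_borel action_borel (distr M state_borel fst) (\<lambda>x. return action_borel (\<phi> x))) E
    = (\<integral>\<^sup>+z. indicator E z \<partial>kernel_prod state_borel action_borel (distr M state_borel fst) (\<lambda>x. return action_borel (\<phi> x)))"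
    using E s by (simp add: M)
  also have "\<dots> = (\<integral>\<^sup>+x. \<integral>\<^sup>+a. indicator E (x, a) \<partial>return action_borel (\<phi> x) \<partial>distr M state_borel fst)"
    using E by (intro nn_integral_kernel_prod[OF k]) auto
  also have "\<dots> = (\<integral>\<^sup>+x. indicator E (x, \<phi> x) \<partial>distr M state_borel fst)"
  proof (rule nn_integral_cong)
    fix x assume "x \<in> space (distr M state_borel fst)"
    then have x: "x \<in> space state_borel" by simp
    have "(\<lambda>a. indicator E (x, a) :: ennreal) \<in> borel_measurable action_borel"
      using measurable_compose[OF measurable_Pair1'[OF x] borel_measurable_indicator[OF E]] by simp
    then show "(\<integral>\<^sup>+a. indicator E (x, a) \<partial>return action_borel (\<phi> x)) = indicator E (x, \<phi> x)"
      by (rule nn_integral_return[OF measurable_space[OF \<phi> x]])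
  qed
  also have "\<dots> = (\<integral>\<^sup>+z. indicator E (fst z, \<phi> (fst z)) \<partial>M)"
    using measurable_compose[OF graph borel_measurable_indicator[OF E]]
    by (intro nn_integral_distr[OF mf]) simp
  also have "\<dots> = (\<integral>\<^sup>+z. indicator E z \<partial>M)"
    by (rule nn_integral_cong_AE) (use AE in \<open>eventually_elim, metis prod.collapse\<close>)
  also have "\<dots> = emeasure M E" using E by (simp add: M)
  finally show "emeasure M E = emeasure (kernel_prod state_borel action_borel (distr M state_borel fst) (\<lambda>x. return action_borel (\<phi> x))) E"
    by simp
qed

section \<open>Perturbation at a single time\<close>

lemma strategy_markov:
  assumes "\<And>n. \<kappa> n \<in> measurable state_borel (prob_algebra action_borel)"
    and "\<And>n. emeasure (\<kappa> n None) {ahat} = 1"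
  shows "strategy (\<lambda>n h. \<kappa> n (snd h))"
  unfolding strategy_def
  by (intro conjI allI ballI impI measurable_compose[OF measurable_snd assms(1)]) (simp add: assms(2))

text \<open>The mass of \<open>\<pi> x\<close> off \<open>B\<close> is redistributed over all
  actions in proportion to \<open>\<pi> x\<close>. The total stays 1 without a division by
  \<open>\<pi>(B|x)\<close>, which may be zero. \<open>B\<close> gains exactly
  \<open>\<pi>(B|x) \<pi>(A - B|x)\<close>, and the densities for \<open>B\<close> and for its
  complement add up to 2.\<close>

definition tilt :: "('x option \<Rightarrow> 'a measure) \<Rightarrow> 'a set \<Rightarrow> 'x option \<Rightarrow> 'a measure"
  where "tilt \<pi> B x = density (\<pi> x) (\<lambda>a. indicator B a + emeasure (\<pi> x) (topspace A - B))"

context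
  fixes \<pi> assumes \<pi>: "\<pi> \<in> measurable state_borel (prob_algebra action_borel)"
begin

lemma sets_kernel_action: "x \<in> space state_borel \<Longrightarrow> sets (\<pi> x) = sets action_borel"
  using measurable_space[OF \<pi>] by (simp add: space_prob_algebra)

lemma space_kernel_action: "x \<in> space state_borel \<Longrightarrow> space (\<pi> x) = topspace A"
  using sets_eq_imp_space_eq[OF sets_kernel_action] by simp

lemma prob_space_kernel_action: "x \<in> space state_borel \<Longrightarrow> prob_space (\<pi> x)"
  using measurable_space[OF \<pi>] by (simp add: space_prob_algebra)

lemma measurable_section:
  assumes "h \<in> borel_measurable pair_borel" "x \<in> space state_borel"
  shows "(\<lambda>a. h (x, a)) \<in> borel_measurable (\<pi> x)"
  by (subst measurable_cong_sets[OF sets_kernel_action[OF assms(2)] refl])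
    (rule measurable_compose[OF measurable_Pair1'[OF assms(2)] assms(1)])

lemma measurable_kernel_integral:
  assumes "h \<in> borel_measurable pair_borel"
  shows "(\<lambda>x. \<integral>\<^sup>+a. h (x, a) \<partial>\<pi> x) \<in> borel_measurable state_borel"
  using assms by (intro nn_integral_measurable_subprob_algebra2[OF _ measurable_prob_algebraD[OF \<pi>]]) simp

lemma measurable_kernel_emeasure:
  "B \<in> sets action_borel \<Longrightarrow> (\<lambda>x. emeasure (\<pi> x) B) \<in> borel_measurable state_borel"
  by (rule measurable_emeasure_kernel[OF measurable_prob_algebraD[OF \<pi>]])

lemma measurable_tilt_density:
  assumes B: "B \<in> sets action_borel"
  shows "(\<lambda>z. indicator B (snd z) + emeasure (\<pi> (fst z)) (topspace A - B)) \<in> borel_measurable pair_borel"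
proof -
  have "topspace A - B \<in> sets action_borel" using sets.compl_sets[OF B] by simp
  from measurable_compose[OF measurable_fst measurable_kernel_emeasure[OF this]]
    measurable_compose[OF measurable_snd borel_measurable_indicator[OF B]]
  show ?thesis by (intro borel_measurable_add) auto
qed

lemma nn_integral_tilt:
  assumes B: "B \<in> sets action_borel" and x: "x \<in> space state_borel" and h: "h \<in> borel_measurable (\<pi> x)"
  shows "(\<integral>\<^sup>+a. h a \<partial>tilt \<pi> B x)
    = (\<integral>\<^sup>+a. (indicator B a + emeasure (\<pi> x) (topspace A - B)) * h a \<partial>\<pi> x)"
  unfolding tilt_def
  using measurable_section[OF measurable_tilt_density[OF B] x] h by (intro nn_integral_density) simp_all

lemma emeasure_add_compl:
  assumes B: "B \<in> sets action_borel" and x: "x \<in> space state_borel"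
  shows "emeasure (\<pi> x) B + emeasure (\<pi> x) (topspace A - B) = 1"
proof -
  interpret prob_space "\<pi> x" by (rule prob_space_kernel_action[OF x])
  have "topspace A - B \<in> sets action_borel" using sets.compl_sets[OF B] by simp
  then have "emeasure (\<pi> x) B + emeasure (\<pi> x) (topspace A - B) = emeasure (\<pi> x) (B \<union> (topspace A - B))"
    using B by (intro plus_emeasure) (auto simp: sets_kernel_action[OF x])
  also have "B \<union> (topspace A - B) = space (\<pi> x)"
    using sets.sets_into_space[OF B] space_kernel_action[OF x] by auto
  finally show ?thesis by (simp add: emeasure_space_1)
qed

lemma tilt_kernel:
  assumes B: "B \<in> sets action_borel"
  shows "tilt \<pi> B \<in> measurable state_borel (prob_algebra action_borel)"
proof (rule measurable_prob_algebraI)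
  have ps: "prob_space (tilt \<pi> B x)" if x: "x \<in> space state_borel" for x
  proof
    interpret prob_space "\<pi> x" by (rule prob_space_kernel_action[OF x])
    have "emeasure (tilt \<pi> B x) (space (tilt \<pi> B x)) = (\<integral>\<^sup>+a. 1 \<partial>tilt \<pi> B x)" by simp
    also have "\<dots> = (\<integral>\<^sup>+a. indicator B a + emeasure (\<pi> x) (topspace A - B) \<partial>\<pi> x)"
      by (subst nn_integral_tilt[OF B x]) simp_all
    also have "\<dots> = emeasure (\<pi> x) B + emeasure (\<pi> x) (topspace A - B)"
    proof (subst nn_integral_add)
      show "indicator B \<in> borel_measurable (\<pi> x)"
        by (intro borel_measurable_indicator) (simp add: sets_kernel_action[OF x] B)
    qed (use B in \<open>simp_all add: sets_kernel_action[OF x] emeasure_space_1\<close>)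
    also have "\<dots> = 1" by (rule emeasure_add_compl[OF B x])
    finally show "emeasure (tilt \<pi> B x) (space (tilt \<pi> B x)) = 1" .
  qed
  then show "prob_space (tilt \<pi> B x)" if "x \<in> space state_borel" for x using that .
  show "tilt \<pi> B \<in> measurable state_borel (subprob_algebra action_borel)"
  proof (rule measurable_subprob_algebra)
    fix x assume x: "x \<in> space state_borel"
    show "subprob_space (tilt \<pi> B x)" by (rule prob_space_imp_subprob_space[OF ps[OF x]])
    show "sets (tilt \<pi> B x) = sets action_borel" by (simp add: tilt_def sets_kernel_action[OF x])
  next
    fix C assume C: "C \<in> sets action_borel"
    have "(\<lambda>x. \<integral>\<^sup>+a. (indicator B (snd (x, a)) + emeasure (\<pi> (fst (x, a))) (topspace A - B)) * indicator C (snd (x, a)) \<partial>\<pi> x)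
        \<in> borel_measurable state_borel"
      using measurable_tilt_density[OF B] measurable_compose[OF measurable_snd borel_measurable_indicator[OF C]]
      by (intro measurable_kernel_integral borel_measurable_times_ennreal) auto
    then have "(\<lambda>x. \<integral>\<^sup>+a. (indicator B a + emeasure (\<pi> x) (topspace A - B)) * indicator C a \<partial>\<pi> x)
        \<in> borel_measurable state_borel" by simp
    moreover have "emeasure (tilt \<pi> B x) C
        = (\<integral>\<^sup>+a. (indicator B a + emeasure (\<pi> x) (topspace A - B)) * indicator C a \<partial>\<pi> x)"
      if x: "x \<in> space state_borel" for x
      unfolding tilt_def using C measurable_section[OF measurable_tilt_density[OF B] x]
      by (intro emeasure_density) (simp_all add: sets_kernel_action[OF x])
    ultimately show "(\<lambda>x. emeasure (tilt \<pi> B x) C) \<in> borel_measurable state_borel"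
      by (subst measurable_cong) auto
  qed
qed

section \<open>Strategies that deviate from \<open>\<pi>\<close> at time \<open>n\<close>
  only\<close>

context
  fixes x0 and n :: nat
  assumes x0: "x0 \<in> topspace X" "{Some x0} \<in> sets state_borel"
    and ahat: "{ahat} \<in> sets action_borel" and \<pi>N: "\<pi> None = return action_borel ahat"
begin

text \<open>At the cemetery \<open>\<pi>\<close> is Dirac at \<open>ahat\<close>, and the density is
  1 there whether or not \<open>ahat\<close> lies in \<open>B\<close>; the tilted kernel thus keeps
  the convention imposed on strategies.\<close>

lemma emeasure_tilt_None:
  assumes B: "B \<in> sets action_borel"
  shows "emeasure (tilt \<pi> B None) {ahat} = 1"
proof -
  have C: "topspace A - B \<in> sets action_borel" using sets.compl_sets[OF B] by simp
  have "indicator B ahat + emeasure (\<pi> None) (topspace A - B) = 1"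
    using C ahat_in by (simp add: \<pi>N split: split_indicator)
  moreover have "emeasure (tilt \<pi> B None) {ahat}
      = (\<integral>\<^sup>+a. (indicator B a + emeasure (\<pi> None) (topspace A - B)) * indicator {ahat} a \<partial>\<pi> None)"
    unfolding tilt_def using ahat measurable_section[OF measurable_tilt_density[OF B], of None]
    by (intro emeasure_density) (simp_all add: \<pi>N)
  moreover have "(\<lambda>a. (indicator B a + emeasure (\<pi> None) (topspace A - B)) * indicator {ahat} a) \<in> borel_measurable action_borel"
    using B ahat by simp
  ultimately show ?thesis
    using ahat_in by (simp add: \<pi>N nn_integral_return)
qed

abbreviation stationary :: "nat \<Rightarrow> (nat \<Rightarrow> 'x option \<times> 'a) \<times> 'x option \<Rightarrow> 'a measure"
  where "stationary \<equiv> \<lambda>k h. \<pi> (snd h)"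

abbreviation perturbed :: "'a set \<Rightarrow> nat \<Rightarrow> (nat \<Rightarrow> 'x option \<times> 'a) \<times> 'x option \<Rightarrow> 'a measure"
  where "perturbed B \<equiv> \<lambda>k h. (if k = n then tilt \<pi> B else \<pi>) (snd h)"

lemma strategy_stationary: "strategy stationary"
  using \<pi> \<pi>N ahat by (intro strategy_markov) simp_all

lemma strategy_perturbed: "B \<in> sets action_borel \<Longrightarrow> strategy (perturbed B)"
  using \<pi> \<pi>N ahat tilt_kernel emeasure_tilt_None by (intro strategy_markov) simp_all

lemma step_law_stationary:
  assumes "h \<in> borel_measurable pair_borel"
  shows "(\<integral>\<^sup>+z. h z \<partial>step_law x0 stationary k) = (\<integral>\<^sup>+z. \<integral>\<^sup>+a. h (fst z, a) \<partial>\<pi> (fst z) \<partial>step_law x0 stationary k)"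
  by (rule step_law_markov[OF strategy_stationary x0 \<pi> _ assms]) simp

lemma step_law_perturbed:
  assumes "B \<in> sets action_borel" "h \<in> borel_measurable pair_borel" "k \<noteq> n"
  shows "(\<integral>\<^sup>+z. h z \<partial>step_law x0 (perturbed B) k)
    = (\<integral>\<^sup>+z. \<integral>\<^sup>+a. h (fst z, a) \<partial>\<pi> (fst z) \<partial>step_law x0 (perturbed B) k)"
  by (rule step_law_markov[OF strategy_perturbed[OF assms(1)] x0 \<pi> _ assms(2)]) (simp add: assms(3))

lemma step_law_perturbed_at:
  assumes B: "B \<in> sets action_borel" and h: "h \<in> borel_measurable pair_borel"
  shows "(\<integral>\<^sup>+z. h z \<partial>step_law x0 (perturbed B) n)
    = (\<integral>\<^sup>+z. \<integral>\<^sup>+a. (indicator B a + emeasure (\<pi> (fst z)) (topspace A - B)) * h (fst z, a) \<partial>\<pi> (fst z)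
        \<partial>step_law x0 (perturbed B) n)"
proof -
  have "(\<integral>\<^sup>+z. h z \<partial>step_law x0 (perturbed B) n)
      = (\<integral>\<^sup>+z. \<integral>\<^sup>+a. h (fst z, a) \<partial>tilt \<pi> B (fst z) \<partial>step_law x0 (perturbed B) n)"
    by (rule step_law_markov[OF strategy_perturbed[OF B] x0 tilt_kernel[OF B] _ h]) simp
  also have "\<dots> = (\<integral>\<^sup>+z. \<integral>\<^sup>+a. (indicator B a + emeasure (\<pi> (fst z)) (topspace A - B)) * h (fst z, a) \<partial>\<pi> (fst z)
        \<partial>step_law x0 (perturbed B) n)"
  proof (rule nn_integral_cong)
    fix z assume "z \<in> space (step_law x0 (perturbed B) n)"
    then have z: "fst z \<in> space state_borel"
      using sets_eq_imp_space_eq[OF sets_step_law] by (auto simp: space_pair_measure)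
    show "(\<integral>\<^sup>+a. h (fst z, a) \<partial>tilt \<pi> B (fst z))
      = (\<integral>\<^sup>+a. (indicator B a + emeasure (\<pi> (fst z)) (topspace A - B)) * h (fst z, a) \<partial>\<pi> (fst z))"
      by (rule nn_integral_tilt[OF B z measurable_section[OF h z]])
  qed
  finally show ?thesis .
qed

text \<open>The tilt concerns the action drawn after the state at time \<open>n\<close>, so state
  laws agree up to and including \<open>k = n\<close>.\<close>

lemma step_law_perturbed_fst:
  assumes B: "B \<in> sets action_borel" and g: "g \<in> borel_measurable state_borel" and "k \<le> n"
  shows "(\<integral>\<^sup>+z. g (fst z) \<partial>step_law x0 (perturbed B) k) = (\<integral>\<^sup>+z. g (fst z) \<partial>step_law x0 stationary k)"
  using g \<open>k \<le> n\<close>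
proof (induction k arbitrary: g)
  case 0
  then show ?case by (simp add: step_law_0[OF strategy_perturbed[OF B] x0] step_law_0[OF strategy_stationary x0])
next
  case (Suc k)
  note pg = nn_integral_p_measurable[OF Suc.prems(1)]
  have "(\<integral>\<^sup>+z. g (fst z) \<partial>step_law x0 (perturbed B) (Suc k))
      = (\<integral>\<^sup>+z. \<integral>\<^sup>+a. \<integral>\<^sup>+y. g y \<partial>p (fst z, a) \<partial>\<pi> (fst z) \<partial>step_law x0 (perturbed B) k)"
    unfolding step_law_Suc[OF strategy_perturbed[OF B] x0 Suc.prems(1)]
    using Suc.prems by (intro step_law_perturbed[OF B pg]) simp
  also have "\<dots> = (\<integral>\<^sup>+z. \<integral>\<^sup>+a. \<integral>\<^sup>+y. g y \<partial>p (fst z, a) \<partial>\<pi> (fst z) \<partial>step_law x0 stationary k)"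
    using Suc.prems by (intro Suc.IH[of "\<lambda>x. \<integral>\<^sup>+a. \<integral>\<^sup>+y. g y \<partial>p (x, a) \<partial>\<pi> x"] measurable_kernel_integral[OF pg]) simp
  also have "\<dots> = (\<integral>\<^sup>+z. g (fst z) \<partial>step_law x0 stationary (Suc k))"
    unfolding step_law_Suc[OF strategy_stationary x0 Suc.prems(1)]
    by (rule step_law_stationary[OF pg, symmetric])
  finally show ?case .
qed

text \<open>Induction in time on state laws. Away from \<open>n\<close> both strategies use
  \<open>\<pi>\<close>, so averaged state laws give averaged pair laws; at \<open>n\<close> the
  state laws coincide and the two densities add up to 2.\<close>

lemma step_law_perturbed_average:
  assumes B: "B \<in> sets action_borel" and h: "h \<in> borel_measurable pair_borel"
  shows "(\<integral>\<^sup>+z. h z \<partial>step_law x0 (perturbed B) k) + (\<integral>\<^sup>+z. h z \<partial>step_law x0 (perturbed (topspace A - B)) k)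
    = 2 * (\<integral>\<^sup>+z. h z \<partial>step_law x0 stationary k)"
proof -
  let ?C = "topspace A - B"
  have C: "?C \<in> sets action_borel" using sets.compl_sets[OF B] by simp
  have BC: "topspace A - ?C = B" using sets.sets_into_space[OF B] by auto
  \<comment> \<open>Passes from state laws at time \<open>k\<close> to pair laws at the same time;
    the induction below alternates this with the transition \<open>p\<close>.\<close>
  have step: "(\<integral>\<^sup>+z. h z \<partial>step_law x0 (perturbed B) k) + (\<integral>\<^sup>+z. h z \<partial>step_law x0 (perturbed ?C) k)
      = 2 * (\<integral>\<^sup>+z. h z \<partial>step_law x0 stationary k)"
    if h: "h \<in> borel_measurable pair_borel"
      and fst: "\<And>g. g \<in> borel_measurable state_borel \<Longrightarrow>
        (\<integral>\<^sup>+z. g (fst z) \<partial>step_law x0 (perturbed B) k) + (\<integral>\<^sup>+z. g (fst z) \<partial>step_law x0 (perturbed ?C) k)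
        = 2 * (\<integral>\<^sup>+z. g (fst z) \<partial>step_law x0 stationary k)" for h k
  proof (cases "k = n")
    case False
    show ?thesis
      unfolding step_law_perturbed[OF B h False] step_law_perturbed[OF C h False] step_law_stationary[OF h]
      by (rule fst[OF measurable_kernel_integral[OF h]])
  next
    case True
    define G where "G B x = (\<integral>\<^sup>+a. (indicator B a + emeasure (\<pi> x) (topspace A - B)) * h (x, a) \<partial>\<pi> x)" for B x
    have wm: "(\<lambda>z. (indicator B (snd z) + emeasure (\<pi> (fst z)) (topspace A - B)) * h z) \<in> borel_measurable pair_borel"
      if "B \<in> sets action_borel" for B
      using measurable_tilt_density[OF that] h by (intro borel_measurable_times_ennreal)
    have Gm: "G B \<in> borel_measurable state_borel" if "B \<in> sets action_borel" for B
      unfolding G_def[abs_def] using measurable_kernel_integral[OF wm[OF that]] by simp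
    have GG: "G B x + G ?C x = 2 * (\<integral>\<^sup>+a. h (x, a) \<partial>\<pi> x)" if x: "x \<in> space state_borel" for x
    proof -
      have 2: "indicator B a + emeasure (\<pi> x) ?C + (indicator ?C a + emeasure (\<pi> x) B) = 2"
        if "a \<in> space (\<pi> x)" for a
      proof -
        have "indicator B a + indicator ?C a = (1::ennreal)"
          using that space_kernel_action[OF x] by (auto split: split_indicator)
        then have "(indicator B a + indicator ?C a) + (emeasure (\<pi> x) B + emeasure (\<pi> x) ?C) = 1 + 1"
          using emeasure_add_compl[OF B x] by simp
        then show ?thesis by (simp add: ac_simps)
      qed
      have "G B x + G ?C x = (\<integral>\<^sup>+a. (indicator B a + emeasure (\<pi> x) ?C) * h (x, a)
          + (indicator ?C a + emeasure (\<pi> x) B) * h (x, a) \<partial>\<pi> x)"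
        unfolding G_def BC
        using measurable_section[OF wm[OF B] x] measurable_section[OF wm[OF C] x]
        by (intro nn_integral_add[symmetric]) (simp_all add: BC)
      also have "\<dots> = (\<integral>\<^sup>+a. 2 * h (x, a) \<partial>\<pi> x)"
        using 2 by (intro nn_integral_cong) (simp add: distrib_right[symmetric])
      also have "\<dots> = 2 * (\<integral>\<^sup>+a. h (x, a) \<partial>\<pi> x)"
        by (rule nn_integral_cmult[OF measurable_section[OF h x]])
      finally show ?thesis .
    qed
    have Gf: "(\<lambda>z. G B (fst z)) \<in> borel_measurable (step_law x0 \<tau> n)" if "B \<in> sets action_borel" for B \<tau>
      by (subst measurable_cong_sets[OF sets_step_law refl]) (rule measurable_compose[OF measurable_fst Gm[OF that]])
    have "(\<integral>\<^sup>+z. h z \<partial>step_law x0 (perturbed B) n) + (\<integral>\<^sup>+z. h z \<partial>step_law x0 (perturbed ?C) n)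
        = (\<integral>\<^sup>+z. G B (fst z) \<partial>step_law x0 (perturbed B) n) + (\<integral>\<^sup>+z. G ?C (fst z) \<partial>step_law x0 (perturbed ?C) n)"
      unfolding step_law_perturbed_at[OF B h] step_law_perturbed_at[OF C h] G_def ..
    also have "\<dots> = (\<integral>\<^sup>+z. G B (fst z) \<partial>step_law x0 stationary n) + (\<integral>\<^sup>+z. G ?C (fst z) \<partial>step_law x0 stationary n)"
      by (simp add: step_law_perturbed_fst[OF B Gm[OF B]] step_law_perturbed_fst[OF C Gm[OF C]])
    also have "\<dots> = (\<integral>\<^sup>+z. G B (fst z) + G ?C (fst z) \<partial>step_law x0 stationary n)"
      by (rule nn_integral_add[OF Gf[OF B] Gf[OF C], symmetric])
    also have "\<dots> = (\<integral>\<^sup>+z. 2 * (\<integral>\<^sup>+a. h (fst z, a) \<partial>\<pi> (fst z)) \<partial>step_law x0 stationary n)"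
      using sets_eq_imp_space_eq[OF sets_step_law]
      by (intro nn_integral_cong GG) (auto simp: space_pair_measure)
    also have "\<dots> = 2 * (\<integral>\<^sup>+z. \<integral>\<^sup>+a. h (fst z, a) \<partial>\<pi> (fst z) \<partial>step_law x0 stationary n)"
    proof (rule nn_integral_cmult)
      show "(\<lambda>z. \<integral>\<^sup>+a. h (fst z, a) \<partial>\<pi> (fst z)) \<in> borel_measurable (step_law x0 stationary n)"
        by (subst measurable_cong_sets[OF sets_step_law refl])
          (rule measurable_compose[OF measurable_fst measurable_kernel_integral[OF h]])
    qed
    finally show ?thesis unfolding True step_law_stationary[OF h, symmetric] .
  qed
  have "(\<integral>\<^sup>+z. g (fst z) \<partial>step_law x0 (perturbed B) k) + (\<integral>\<^sup>+z. g (fst z) \<partial>step_law x0 (perturbed ?C) k)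
      = 2 * (\<integral>\<^sup>+z. g (fst z) \<partial>step_law x0 stationary k)" if "g \<in> borel_measurable state_borel" for g k
    using that
  proof (induction k arbitrary: g)
    case 0
    then show ?case
      by (simp add: step_law_0[OF strategy_perturbed[OF B] x0] step_law_0[OF strategy_perturbed[OF C] x0]
          step_law_0[OF strategy_stationary x0] mult_2)
  next
    case (Suc k)
    show ?case
      unfolding step_law_Suc[OF strategy_perturbed[OF B] x0 Suc.prems]
        step_law_Suc[OF strategy_perturbed[OF C] x0 Suc.prems] step_law_Suc[OF strategy_stationary x0 Suc.prems]
      by (rule step[OF nn_integral_p_measurable[OF Suc.prems] Suc.IH])
  qed
  then show ?thesis using step[OF h] by blast
qed

text \<open>An identity in \<open>[0, \<infinity>]\<close>: finiteness of the perturbed occupation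
  measures is later a consequence of it, not a prerequisite.\<close>

lemma live_occupation_perturbed_average:
  assumes B: "B \<in> sets action_borel" and E: "E \<in> sets pair_borel"
  shows "emeasure (live_occupation x0 (perturbed B)) E + emeasure (live_occupation x0 (perturbed (topspace A - B))) E
    = 2 * emeasure (live_occupation x0 stationary) E"
proof -
  have C: "topspace A - B \<in> sets action_borel" using sets.compl_sets[OF B] by simp
  have h: "(\<lambda>z. alive (fst z) * indicator E z) \<in> borel_measurable pair_borel" using E by measurable
  have em: "emeasure (live_occupation x0 \<tau>) E = (\<Sum>k. \<integral>\<^sup>+z. alive (fst z) * indicator E z \<partial>step_law x0 \<tau> k)"
    if "strategy \<tau>" for \<tau>
    using E nn_integral_live_occupation[OF that x0, of "indicator E"]
    by (simp add: sets_live_occupation[OF that x0])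
  show ?thesis
    unfolding em[OF strategy_perturbed[OF B]] em[OF strategy_perturbed[OF C]] em[OF strategy_stationary]
    by (subst suminf_add) (simp_all add: step_law_perturbed_average[OF B h] ennreal_suminf_cmult)
qed

text \<open>Under the perturbed strategy, compare visits to \<open>B\<close> with their
  \<open>\<pi>\<close>-prediction from the visited states. The totals over all times agree, because
  the occupation measure is that of \<open>stationary\<close> and disintegrates along
  \<open>\<pi>\<close>; so do the terms at every time other than \<open>n\<close>. Hence the excess
  created by the tilt at time \<open>n\<close> is zero.\<close>

lemma perturbation_invariant_imp:
  assumes B: "B \<in> sets action_borel"
    and eq: "live_occupation x0 (perturbed B) = live_occupation x0 stationary"
    and fin: "finite_measure (live_occupation x0 stationary)"
    and dis: "live_occupation x0 stationary
      = kernel_prod state_borel action_borel (distr (live_occupation x0 stationary) state_borel fst) \<pi>"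
  shows "(\<integral>\<^sup>+z. alive (fst z) * (emeasure (\<pi> (fst z)) B * emeasure (\<pi> (fst z)) (topspace A - B)) \<partial>step_law x0 stationary n) = 0"
proof -
  let ?M = "live_occupation x0 stationary" and ?\<tau> = "perturbed B" and ?C = "topspace A - B"
  have C: "?C \<in> sets action_borel" using sets.compl_sets[OF B] by simp
  note \<tau> = strategy_perturbed[OF B]
  have sM: "sets ?M = sets pair_borel" by (rule sets_live_occupation[OF strategy_stationary x0])
  have mfst: "fst \<in> measurable ?M state_borel" by (simp add: measurable_cong_sets[OF sM refl])
  define h where "h z = (alive (fst z) * indicator B (snd z) :: ennreal)" for z
  define g where "g x = alive x * emeasure (\<pi> x) B" for x
  \<comment> \<open>What the tilt adds to the mass of \<open>B\<close> at a live state
    \<open>x\<close>.\<close>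
  define d where "d x = alive x * (emeasure (\<pi> x) B * emeasure (\<pi> x) ?C)" for x
  have h: "h \<in> borel_measurable pair_borel"
    unfolding h_def using measurable_compose[OF measurable_snd borel_measurable_indicator[OF B]] by measurable
  have gm: "g \<in> borel_measurable state_borel" unfolding g_def using measurable_kernel_emeasure[OF B] by measurable
  have dm: "d \<in> borel_measurable state_borel"
    unfolding d_def using measurable_kernel_emeasure[OF B] measurable_kernel_emeasure[OF C] by measurable
  have g0: "g None = 0" by (simp add: g_def)
  have hg: "(\<integral>\<^sup>+a. h (x, a) \<partial>\<pi> x) = g x" if x: "x \<in> space state_borel" for x
    using B by (simp add: h_def g_def nn_integral_cmult_indicator sets_kernel_action[OF x])
  have hd: "(\<integral>\<^sup>+a. (indicator B a + emeasure (\<pi> x) ?C) * h (x, a) \<partial>\<pi> x) = g x + d x" if x: "x \<in> space state_borel" for x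
  proof -
    have "(indicator B a + emeasure (\<pi> x) ?C) * h (x, a) = alive x * (1 + emeasure (\<pi> x) ?C) * indicator B a" for a
      by (simp add: h_def mult.commute split: split_indicator)
    then have "(\<integral>\<^sup>+a. (indicator B a + emeasure (\<pi> x) ?C) * h (x, a) \<partial>\<pi> x)
        = alive x * (1 + emeasure (\<pi> x) ?C) * emeasure (\<pi> x) B"
      using B by (simp add: nn_integral_cmult_indicator sets_kernel_action[OF x])
    also have "\<dots> = g x + d x"
      unfolding g_def d_def by (simp only: distrib_left distrib_right mult_1_right) (simp only: mult.assoc mult.commute mult.left_commute)
    finally show ?thesis .
  qed
  have fst_space: "fst z \<in> space state_borel" if "z \<in> space (step_law x0 \<rho> k)" for z \<rho> k
    using that sets_eq_imp_space_eq[OF sets_step_law] by (auto simp: space_pair_measure)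
  have ah: "alive (fst z) * h z = h z" for z by (simp add: h_def mult.assoc[symmetric])
  have "(\<Sum>k. \<integral>\<^sup>+z. h z \<partial>step_law x0 ?\<tau> k) = (\<integral>\<^sup>+z. h z \<partial>?M)"
    using nn_integral_live_occupation[OF \<tau> x0 h] by (simp add: eq ah)
  also have "\<dots> = (\<integral>\<^sup>+x. \<integral>\<^sup>+a. h (x, a) \<partial>\<pi> x \<partial>distr ?M state_borel fst)"
    by (subst dis) (rule nn_integral_kernel_prod[OF \<pi> _ h], simp)
  also have "\<dots> = (\<integral>\<^sup>+x. g x \<partial>distr ?M state_borel fst)" by (intro nn_integral_cong hg) simp
  also have "\<dots> = (\<integral>\<^sup>+z. g (fst z) \<partial>?M)" by (rule nn_integral_distr[OF mfst]) (simp add: gm)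
  also have "\<dots> = (\<Sum>k. \<integral>\<^sup>+z. g (fst z) \<partial>step_law x0 ?\<tau> k)"
    unfolding eq[symmetric] by (rule nn_integral_live_occupation_fst[OF \<tau> x0 gm g0])
  finally have sums: "(\<Sum>k. \<integral>\<^sup>+z. h z \<partial>step_law x0 ?\<tau> k) = (\<Sum>k. \<integral>\<^sup>+z. g (fst z) \<partial>step_law x0 ?\<tau> k)" .
  define \<delta> where "\<delta> k = (if k = n then \<integral>\<^sup>+z. d (fst z) \<partial>step_law x0 ?\<tau> n else 0)" for k
  have "(\<integral>\<^sup>+z. h z \<partial>step_law x0 ?\<tau> k) = (\<integral>\<^sup>+z. g (fst z) \<partial>step_law x0 ?\<tau> k) + \<delta> k" for k
  proof (cases "k = n")
    case False
    then show ?thesis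
      unfolding step_law_perturbed[OF B h False] \<delta>_def using hg[OF fst_space] by (simp cong: nn_integral_cong)
  next
    case True
    have fm: "(\<lambda>z. q (fst z)) \<in> borel_measurable (step_law x0 ?\<tau> n)"
      if "q \<in> borel_measurable state_borel" for q :: "'x option \<Rightarrow> ennreal"
      by (subst measurable_cong_sets[OF sets_step_law refl]) (rule measurable_compose[OF measurable_fst that])
    have "(\<integral>\<^sup>+z. h z \<partial>step_law x0 ?\<tau> n) = (\<integral>\<^sup>+z. g (fst z) + d (fst z) \<partial>step_law x0 ?\<tau> n)"
      unfolding step_law_perturbed_at[OF B h] by (intro nn_integral_cong hd fst_space)
    also have "\<dots> = (\<integral>\<^sup>+z. g (fst z) \<partial>step_law x0 ?\<tau> n) + (\<integral>\<^sup>+z. d (fst z) \<partial>step_law x0 ?\<tau> n)"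
      by (rule nn_integral_add[OF fm[OF gm] fm[OF dm]])
    finally show ?thesis by (simp add: True \<delta>_def)
  qed
  then have "(\<Sum>k. \<integral>\<^sup>+z. h z \<partial>step_law x0 ?\<tau> k) = (\<Sum>k. \<integral>\<^sup>+z. g (fst z) \<partial>step_law x0 ?\<tau> k) + (\<Sum>k. \<delta> k)"
    by (simp add: suminf_add[symmetric])
  moreover have "(\<Sum>k. \<integral>\<^sup>+z. h z \<partial>step_law x0 ?\<tau> k) < \<top>"
  proof -
    interpret M: finite_measure ?M by (rule fin)
    have "(\<Sum>k. \<integral>\<^sup>+z. h z \<partial>step_law x0 ?\<tau> k) = (\<integral>\<^sup>+z. h z \<partial>?M)"
      using nn_integral_live_occupation[OF \<tau> x0 h] by (simp add: eq ah)
    also have "\<dots> \<le> (\<integral>\<^sup>+z. 1 \<partial>?M)"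
      by (intro nn_integral_mono) (auto simp: h_def split: split_indicator)
    also have "\<dots> < \<top>" using M.emeasure_finite[of "space ?M"] unfolding less_top infinity_ennreal_def by simp
    finally show ?thesis .
  qed
  \<comment> \<open>The common series may be cancelled because it is finite.\<close>
  ultimately have "(\<Sum>k. \<integral>\<^sup>+z. g (fst z) \<partial>step_law x0 ?\<tau> k) + 0
        = (\<Sum>k. \<integral>\<^sup>+z. g (fst z) \<partial>step_law x0 ?\<tau> k) + (\<Sum>k. \<delta> k)"
    and "(\<Sum>k. \<integral>\<^sup>+z. g (fst z) \<partial>step_law x0 ?\<tau> k) \<noteq> \<infinity>"
    unfolding sums by simp_all
  then have "(\<Sum>k. \<delta> k) = 0" unfolding ennreal_add_left_cancel by simp
  then have "\<delta> n = 0" by (subst (asm) suminf_eq_zero_iff) auto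
  then show ?thesis
    using step_law_perturbed_fst[OF B dm order_refl] by (simp add: \<delta>_def d_def)
qed

end

end

section \<open>Extreme points\<close>

text \<open>The code of \<open>X\<close> is injective, so a point is the preimage of a real
  singleton.\<close>

lemma singleton_Some_sets:
  assumes "topological_borel_space TYPE('p::polish_space) X" and x0: "x0 \<in> topspace X"
  shows "{Some x0} \<in> sets state_borel"
proof -
  obtain c :: "'x \<Rightarrow> real" and d where c: "c \<in> borel_measurable (borel_of X)"
    and d: "\<And>x. x \<in> topspace X \<Longrightarrow> d (c x) = x"
    using topological_borel_space_real_code[OF assms] by metis
  have "c -` {c x0} \<inter> space (borel_of X) = {x0}" using d x0 by (auto, metis)
  then have "{x0} \<in> sets (borel_of X)" using measurable_sets[OF c, of "{c x0}"] by simp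
  from sets_Some_image[OF this] show ?thesis by simp
qed

section \<open>The two implications, with a real code of the action space at hand\<close>

context
  fixes x0 and c :: "'a \<Rightarrow> real" and d :: "real \<Rightarrow> 'a"
  assumes x0: "x0 \<in> topspace X" "{Some x0} \<in> sets state_borel"
    and c: "c \<in> borel_measurable action_borel" "\<And>a. c a \<in> {0..1}"
    and d: "d \<in> measurable borel action_borel" "\<And>a. a \<in> topspace A \<Longrightarrow> d (c a) = a"
begin

lemma singleton_action_sets:
  assumes "a \<in> topspace A"
  shows "{a} \<in> sets action_borel"
proof -
  have "c -` {c a} \<inter> space action_borel = {a}" using d(2) assms by (auto, metis)
  then show ?thesis using measurable_sets[OF c(1), of "{c a}"] by simp
qed

text \<open>Equality of actions is equality of their real codes, which makes the graph of
  \<open>\<phi>\<close> measurable.\<close>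

lemma off_graph_sets:
  assumes \<phi>: "\<phi> \<in> measurable state_borel action_borel"
  shows "{z \<in> space pair_borel. snd z \<noteq> \<phi> (fst z)} \<in> sets pair_borel"
proof -
  have m: "(\<lambda>z. c (snd z)) \<in> borel_measurable pair_borel" "(\<lambda>z. c (\<phi> (fst z))) \<in> borel_measurable pair_borel"
    using c(1) \<phi> by measurable
  have "{z \<in> space pair_borel. c (snd z) \<noteq> c (\<phi> (fst z))} \<in> sets pair_borel"
    using m by measurable
  moreover have "c (snd z) = c (\<phi> (fst z)) \<longleftrightarrow> snd z = \<phi> (fst z)" if z: "z \<in> space pair_borel" for z
  proof -
    have "snd z \<in> topspace A" "fst z \<in> space state_borel" using z by (auto simp: space_pair_measure)
    then show ?thesis using d(2)[of "snd z"] d(2)[of "\<phi> (fst z)"] measurable_space[OF \<phi>, of "fst z"] by auto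
  qed
  then have "{z \<in> space pair_borel. c (snd z) \<noteq> c (\<phi> (fst z))} = {z \<in> space pair_borel. snd z \<noteq> \<phi> (fst z)}"
    by blast
  ultimately show ?thesis by simp
qed

text \<open>Carried by the graph, the measure disintegrates along the Dirac kernel of
  \<open>\<phi>\<close>, so the stationary strategy \<open>\<phi>\<close> reproduces it. Both
  implications of the theorem end with this lemma.\<close>

lemma graph_occupation_eq:
  assumes \<sigma>: "strategy \<sigma>" and \<tau>: "strategy \<tau>" and \<phi>: "\<phi> \<in> measurable state_borel action_borel"
    and \<tau>\<phi>: "\<And>n h. h \<in> space (history_space n) \<Longrightarrow> \<tau> n h = return action_borel (\<phi> (snd h))"
    and fin: "finite_measure (live_occupation x0 \<sigma>)"
    and null: "emeasure (live_occupation x0 \<sigma>) {z \<in> space pair_borel. snd z \<noteq> \<phi> (fst z)} = 0"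
  shows "live_occupation x0 \<tau> = live_occupation x0 \<sigma>"
proof (rule stationary_reproduces_occupation[OF \<sigma> \<tau> x0 _ _ fin])
  note s = sets_live_occupation[OF \<sigma> x0]
  show "(\<lambda>x. return action_borel (\<phi> x)) \<in> measurable state_borel (prob_algebra action_borel)"
    by (rule measurable_compose[OF \<phi> measurable_return_prob_space])
  have "AE z in live_occupation x0 \<sigma>. snd z = \<phi> (fst z)"
    by (rule AE_I[OF _ null]) (use off_graph_sets[OF \<phi>] sets_eq_imp_space_eq[OF s] s in auto)
  then show "live_occupation x0 \<sigma> = kernel_prod state_borel action_borel
      (distr (live_occupation x0 \<sigma>) state_borel fst) (\<lambda>x. return action_borel (\<phi> x))"
    by (rule kernel_prod_return_graph[OF s \<phi>])
qed (simp add: \<tau>\<phi>)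

lemma live_occupation_off_graph:
  assumes \<tau>: "strategy \<tau>" and \<phi>: "\<phi> \<in> measurable state_borel action_borel"
    and \<tau>\<phi>: "\<And>n h. h \<in> space (history_space n) \<Longrightarrow> \<tau> n h = return action_borel (\<phi> (snd h))"
  shows "emeasure (live_occupation x0 \<tau>) {z \<in> space pair_borel. snd z \<noteq> \<phi> (fst z)} = 0" (is "emeasure _ ?N = 0")
proof -
  note N = off_graph_sets[OF \<phi>]
  have k: "(\<lambda>x. return action_borel (\<phi> x)) \<in> measurable state_borel (prob_algebra action_borel)"
    by (rule measurable_compose[OF \<phi> measurable_return_prob_space])
  have "(\<integral>\<^sup>+z. alive (fst z) * indicator ?N z \<partial>step_law x0 \<tau> n) = 0" for n
  proof -
    have h: "(\<lambda>z. alive (fst z) * indicator ?N z) \<in> borel_measurable pair_borel" using N by measurable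
    have "(\<integral>\<^sup>+z. alive (fst z) * indicator ?N z \<partial>step_law x0 \<tau> n)
        = (\<integral>\<^sup>+z. \<integral>\<^sup>+a. alive (fst z) * indicator ?N (fst z, a) \<partial>return action_borel (\<phi> (fst z)) \<partial>step_law x0 \<tau> n)"
      using step_law_markov[OF \<tau> x0 k \<tau>\<phi> h] by simp
    also have "\<dots> = (\<integral>\<^sup>+z. 0 \<partial>step_law x0 \<tau> n)"
    proof (rule nn_integral_cong)
      fix z assume "z \<in> space (step_law x0 \<tau> n)"
      then have z: "fst z \<in> space state_borel"
        using sets_eq_imp_space_eq[OF sets_step_law] by (auto simp: space_pair_measure)
      have "(\<lambda>a. alive (fst z) * indicator ?N (fst z, a)) \<in> borel_measurable action_borel"
        using measurable_compose[OF measurable_Pair1'[OF z] h] by simp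
      then show "(\<integral>\<^sup>+a. alive (fst z) * indicator ?N (fst z, a) \<partial>return action_borel (\<phi> (fst z))) = 0"
        by (subst nn_integral_return[OF measurable_space[OF \<phi> z]]) auto
    qed
    finally show ?thesis by simp
  qed
  then show ?thesis
    using N nn_integral_live_occupation[OF \<tau> x0, of "indicator ?N"]
    by (simp add: sets_live_occupation[OF \<tau> x0])
qed

text \<open>Extreme points are taken among real-valued set functions, hence the passage from
  \<open>emeasure\<close> to \<open>measure\<close>.\<close>

lemma measure_occupation_measure_eq:
  assumes "strategy \<sigma>" "E \<in> sets pair_borel"
  shows "measure (live_occupation x0 \<sigma>) E
    = measure (occupation_measure x0 \<sigma>) (embed -` E \<inter> topspace X \<times> topspace A)"
proof -
  have "embed \<in> measurable (occupation_measure x0 \<sigma>) pair_borel"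
    by (subst measurable_cong_sets[OF sets_occupation_measure refl]) (rule measurable_embed)
  then show ?thesis
    unfolding live_occupation_eq_distr[OF x0 assms(1)] using assms(2)
    by (simp add: measure_distr space_occupation_measure)
qed

lemma deterministic_stationary_extreme:
  assumes \<tau>: "deterministic_stationary_strategy \<tau>"
    and fin: "occupation_measure x0 \<tau> \<in> finite_occupation_measures x0"
  shows "measure (occupation_measure x0 \<tau>) extreme_point_of measure ` finite_occupation_measures x0"
proof -
  obtain \<phi> where st: "strategy \<tau>" and \<phi>: "\<phi> \<in> measurable state_borel action_borel"
    and \<tau>\<phi>: "\<And>n h. h \<in> space (history_space n) \<Longrightarrow> \<tau> n h = return action_borel (\<phi> (snd h))"
    using \<tau> unfolding deterministic_stationary_strategy_def by blast
  let ?N = "{z \<in> space pair_borel. snd z \<noteq> \<phi> (fst z)}"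
  \<comment> \<open>A component of weight \<open>w\<close> is dominated by the mixture, so it
    inherits the null set \<open>?N\<close>, and that determines it.\<close>
  have component: "M1 = occupation_measure x0 \<tau>"
    if M1: "M1 \<in> finite_occupation_measures x0" and w: "0 < w"
      and le: "\<And>E. w * measure M1 E \<le> measure (occupation_measure x0 \<tau>) E" for M1 w
  proof -
    obtain \<sigma> where \<sigma>: "strategy \<sigma>" and M1_eq: "M1 = occupation_measure x0 \<sigma>"
      and "emeasure (occupation_measure x0 \<sigma>) (topspace X \<times> topspace A) < \<infinity>"
      using M1 by (auto simp: finite_occupation_measures_def)
    then have finM1: "finite_measure (live_occupation x0 \<sigma>)"
      by (simp add: finite_live_occupation_iff[OF x0 \<sigma>])
    have "measure (live_occupation x0 \<tau>) ?N = 0"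
      using live_occupation_off_graph[OF st \<phi> \<tau>\<phi>] by (simp add: measure_def)
    then have "w * measure (live_occupation x0 \<sigma>) ?N \<le> 0"
      using le[of "embed -` ?N \<inter> topspace X \<times> topspace A"] unfolding M1_eq
      by (simp only: measure_occupation_measure_eq[OF \<sigma> off_graph_sets[OF \<phi>]]
          measure_occupation_measure_eq[OF st off_graph_sets[OF \<phi>]])
    then have "measure (live_occupation x0 \<sigma>) ?N = 0"
      using w by (simp add: mult_le_0_iff measure_le_0_iff)
    then have "emeasure (live_occupation x0 \<sigma>) ?N = 0"
      using finM1 by (simp add: finite_measure.emeasure_eq_measure)
    from graph_occupation_eq[OF \<sigma> st \<phi> \<tau>\<phi> finM1 this]
    show ?thesis unfolding M1_eq by (intro occupation_measure_eqI[OF x0 \<sigma> st]) simp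
  qed
  show ?thesis
    unfolding extreme_point_of_def
  proof (intro conjI ballI notI)
    show "measure (occupation_measure x0 \<tau>) \<in> measure ` finite_occupation_measures x0" using fin by blast
    fix m1 m2 assume "m1 \<in> measure ` finite_occupation_measures x0" "m2 \<in> measure ` finite_occupation_measures x0"
    then obtain M1 M2 where M: "M1 \<in> finite_occupation_measures x0" "M2 \<in> finite_occupation_measures x0"
      and m: "m1 = measure M1" "m2 = measure M2" by blast
    assume "measure (occupation_measure x0 \<tau>) \<in> open_segment m1 m2"
    then obtain u where u: "0 < u" "u < 1" and ne: "m1 \<noteq> m2"
      and eq: "measure (occupation_measure x0 \<tau>) = (1 - u) *\<^sub>R m1 + u *\<^sub>R m2"
      by (auto simp: in_segment)
    have E: "measure (occupation_measure x0 \<tau>) E = (1 - u) * measure M1 E + u * measure M2 E" for E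
      using fun_cong[OF eq, of E] by (simp add: m scaleR_fun_def)
    have "M1 = occupation_measure x0 \<tau>"
      by (rule component[OF M(1), of "1 - u"]) (use u E in \<open>auto simp: measure_nonneg\<close>)
    moreover have "M2 = occupation_measure x0 \<tau>"
      by (rule component[OF M(2), of u]) (use u E in \<open>auto simp: measure_nonneg\<close>)
    ultimately show False using ne m by simp
  qed
qed

lemma extreme_imp_deterministic_stationary:
  assumes M: "M \<in> finite_occupation_measures x0"
    and ext: "measure M extreme_point_of measure ` finite_occupation_measures x0"
  shows "\<exists>\<tau>. deterministic_stationary_strategy \<tau> \<and> M = occupation_measure x0 \<tau>"
proof -
  obtain \<sigma> where \<sigma>: "strategy \<sigma>" and M_eq: "M = occupation_measure x0 \<sigma>"
    and "emeasure (occupation_measure x0 \<sigma>) (topspace X \<times> topspace A) < \<infinity>"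
    using M by (auto simp: finite_occupation_measures_def)
  then have fin: "finite_measure (live_occupation x0 \<sigma>)" by (simp add: finite_live_occupation_iff[OF x0 \<sigma>])
  let ?L = "live_occupation x0 \<sigma>"
  note sL = sets_live_occupation[OF \<sigma> x0]
  note ahat = singleton_action_sets[OF ahat_in]
  have mfst: "fst \<in> measurable ?L state_borel" by (simp add: measurable_cong_sets[OF sL refl])
  obtain \<pi>' where \<pi>': "\<pi>' \<in> measurable state_borel (prob_algebra action_borel)"
    and dis': "?L = kernel_prod state_borel action_borel (distr ?L state_borel fst) \<pi>'"
    using disintegration[OF fin sL _ c(1) _ d(1)] c(2) d(2) by (metis space_borel_of space_state_borel_nonempty)
  \<comment> \<open>The disintegration says nothing at the cemetery, to which \<open>?L\<close>
    gives no mass; the value prescribed for strategies is put in there.\<close>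
  define \<pi> where "\<pi> x = (if x = None then return action_borel ahat else \<pi>' x)" for x
  have \<pi>: "\<pi> \<in> measurable state_borel (prob_algebra action_borel)"
  proof -
    have "(\<lambda>x. if x \<in> {None} then return action_borel ahat else \<pi>' x) \<in> measurable state_borel (prob_algebra action_borel)"
      using \<pi>' None_sets ahat_in
      by (intro measurable_If_set measurable_const) (auto simp: space_prob_algebra prob_space_return)
    then show ?thesis by (simp add: \<pi>_def[abs_def])
  qed
  have alive_AE: "AE z in ?L. fst z \<noteq> None"
  proof -
    have "(\<integral>\<^sup>+z. indicator {None} (fst z) \<partial>?L) = (\<Sum>n. \<integral>\<^sup>+z. alive (fst z) * indicator {None} (fst z) \<partial>step_law x0 \<sigma> n)"
      by (rule nn_integral_live_occupation[OF \<sigma> x0]) measurable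
    also have "\<dots> = 0"
    proof -
      have "alive x * indicator {None} x = 0" for x by (cases x) simp_all
      then show ?thesis by (simp only: nn_integral_const) simp
    qed
    finally have "(\<integral>\<^sup>+z. indicator {None} (fst z) \<partial>?L) = 0" .
    then show ?thesis
      using measurable_compose[OF mfst borel_measurable_indicator[OF None_sets]]
      by (subst (asm) nn_integral_0_iff_AE) (auto split: split_indicator_asm)
  qed
  have dis: "?L = kernel_prod state_borel action_borel (distr ?L state_borel fst) \<pi>"
  proof (rule measure_eqI_rectangles[OF fin sL])
    show "sets (kernel_prod state_borel action_borel (distr ?L state_borel fst) \<pi>) = sets pair_borel"
      by (rule sets_kernel_prod[OF \<pi>]) simp_all
    fix B C assume B: "B \<in> sets state_borel" and C: "C \<in> sets action_borel"
    have "emeasure ?L (B \<times> C) = (\<integral>\<^sup>+x. emeasure (\<pi>' x) C * indicator B x \<partial>distr ?L state_borel fst)"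
      by (subst dis') (rule emeasure_kernel_prod[OF \<pi>' _ _ B C], simp_all)
    also have "\<dots> = (\<integral>\<^sup>+x. emeasure (\<pi> x) C * indicator B x \<partial>distr ?L state_borel fst)"
    proof (rule nn_integral_cong_AE)
      have "AE x in distr ?L state_borel fst. x \<noteq> None"
      proof (subst AE_distr_iff[OF mfst])
        have "{x \<in> space state_borel. x \<noteq> None} = space state_borel - {None}" by auto
        then show "{x \<in> space state_borel. x \<noteq> None} \<in> sets state_borel"
          using sets.compl_sets[OF None_sets] by simp
      qed (rule alive_AE)
      then show "AE x in distr ?L state_borel fst. emeasure (\<pi>' x) C * indicator B x = emeasure (\<pi> x) C * indicator B x"
        by eventually_elim (auto simp: \<pi>_def)
    qed
    also have "\<dots> = emeasure (kernel_prod state_borel action_borel (distr ?L state_borel fst) \<pi>) (B \<times> C)"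
      by (rule emeasure_kernel_prod[OF \<pi> _ _ B C, symmetric]) simp_all
    finally show "emeasure ?L (B \<times> C) = emeasure (kernel_prod state_borel action_borel (distr ?L state_borel fst) \<pi>) (B \<times> C)" .
  qed
  have \<pi>N: "\<pi> None = return action_borel ahat" by (simp add: \<pi>_def)
  let ?st = "\<lambda>(k::nat) (h :: (nat \<Rightarrow> 'x option \<times> 'a) \<times> 'x option). \<pi> (snd h)"
  note st = strategy_stationary[OF \<pi> x0 ahat \<pi>N]
  \<comment> \<open>From here on \<open>M\<close> is the occupation measure of a stationary
    strategy, whose kernel can be tilted at any single time.\<close>
  have Lst: "live_occupation x0 ?st = ?L"
    by (rule stationary_reproduces_occupation[OF \<sigma> st x0 \<pi> refl fin dis])

  have split: "(\<integral>\<^sup>+z. alive (fst z) * (emeasure (\<pi> (fst z)) B * emeasure (\<pi> (fst z)) (topspace A - B)) \<partial>step_law x0 ?st n) = 0"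
    if B: "B \<in> sets action_borel" for B and n :: nat
  proof (rule perturbation_invariant_imp[OF \<pi> x0 ahat \<pi>N B])
    let ?C = "topspace A - B"
    have C: "?C \<in> sets action_borel" using sets.compl_sets[OF B] by simp
    let ?p = "\<lambda>B k h. (if k = n then tilt \<pi> B else \<pi>) (snd h)"
    note sB = strategy_perturbed[OF \<pi> x0 ahat \<pi>N B, of n] and sC = strategy_perturbed[OF \<pi> x0 ahat \<pi>N C, of n]
    note LsB = sets_live_occupation[OF sB x0] and LsC = sets_live_occupation[OF sC x0]
    have avg: "emeasure (live_occupation x0 (?p B)) E + emeasure (live_occupation x0 (?p ?C)) E = 2 * emeasure ?L E"
      if "E \<in> sets pair_borel" for E
      using live_occupation_perturbed_average[OF \<pi> x0 ahat \<pi>N B that, of n] by (simp add: Lst)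
    have Lfin: "emeasure ?L E < \<top>" for E
      using finite_measure.emeasure_finite[OF fin, of E] unfolding less_top infinity_ennreal_def .
    \<comment> \<open>The two sum to twice the finite \<open>?L\<close>, so both belong to the
      convex set in which \<open>M\<close> is extreme.\<close>
    have finB: "finite_measure (live_occupation x0 (?p B))" and finC: "finite_measure (live_occupation x0 (?p ?C))"
    proof -
      have "emeasure (live_occupation x0 (?p B)) (space pair_borel) + emeasure (live_occupation x0 (?p ?C)) (space pair_borel) < \<top>"
        unfolding avg[OF sets.top] using Lfin[of "space pair_borel"] by (simp add: ennreal_mult_less_top)
      then show "finite_measure (live_occupation x0 (?p B))" "finite_measure (live_occupation x0 (?p ?C))"
        using sets_eq_imp_space_eq[OF LsB] sets_eq_imp_space_eq[OF LsC] by (auto intro!: finite_measureI)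
    qed
    let ?MB = "occupation_measure x0 (?p B)" and ?MC = "occupation_measure x0 (?p ?C)"
    have MB: "?MB \<in> finite_occupation_measures x0" and MC: "?MC \<in> finite_occupation_measures x0"
      using sB sC finB finC unfolding finite_occupation_measures_def
      by (auto simp: finite_live_occupation_iff[OF x0 sB] finite_live_occupation_iff[OF x0 sC])
    \<comment> \<open>The identity is required for functions on all sets; off the sigma-algebra
      every \<open>measure\<close> is 0 by convention.\<close>
    have meas: "measure M E = (1/2) * measure ?MB E + (1/2) * measure ?MC E" for E
    proof (cases "E \<in> sets (borel_of X \<Otimes>\<^sub>M action_borel)")
      case True
      have iE: "embed ` E \<in> sets pair_borel" by (rule sets_embed_image[OF x0(1) True])
      have me: "emeasure (occupation_measure x0 \<rho>) E = ennreal (measure (occupation_measure x0 \<rho>) E)"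
        if "strategy \<rho>" "finite_measure (live_occupation x0 \<rho>)" for \<rho>
        using finite_measure.emeasure_finite[OF that(2), of "embed ` E"]
        unfolding emeasure_occupation_measure[OF x0 that(1) True, symmetric]
        by (intro emeasure_eq_ennreal_measure) auto
      have "ennreal (measure ?MB E + measure ?MC E) = emeasure ?MB E + emeasure ?MC E"
        by (simp add: me[OF sB finB] me[OF sC finC])
      also have "\<dots> = 2 * emeasure M E"
        unfolding M_eq by (simp only: emeasure_occupation_measure[OF x0 sB True] emeasure_occupation_measure[OF x0 sC True]
            emeasure_occupation_measure[OF x0 \<sigma> True] avg[OF iE])
      also have "\<dots> = ennreal (2 * measure M E)"
        unfolding M_eq by (simp add: me[OF \<sigma> fin] ennreal_mult)
      finally have "measure ?MB E + measure ?MC E = 2 * measure M E"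
        by (subst (asm) ennreal_inj) auto
      then show ?thesis by simp
    next
      case False
      then show ?thesis unfolding M_eq by (simp add: measure_notin_sets sets_occupation_measure)
    qed
    have "measure ?MB = measure ?MC"
    proof (rule ccontr)
      assume "measure ?MB \<noteq> measure ?MC"
      moreover have "measure M = (1 - 1/2) *\<^sub>R measure ?MB + (1/2) *\<^sub>R measure ?MC"
        using meas by (simp add: fun_eq_iff scaleR_fun_def)
      ultimately have "measure M \<in> open_segment (measure ?MB) (measure ?MC)"
        unfolding in_segment by (intro conjI exI[of _ "1/2"]) auto
      then show False using ext MB MC unfolding extreme_point_of_def by blast
    qed
    then have "measure ?MB E = measure M E" for E using meas[of E] by simp
    then have "measure (live_occupation x0 (?p B)) E = measure ?L E" if "E \<in> sets pair_borel" for E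
      using that by (simp add: measure_occupation_measure_eq[OF sB] measure_occupation_measure_eq[OF \<sigma>] M_eq)
    then have "live_occupation x0 (?p B) = ?L"
      using LsB sL finite_measure.emeasure_eq_measure[OF finB] finite_measure.emeasure_eq_measure[OF fin]
      by (intro measure_eqI) auto
    then show "live_occupation x0 (?p B) = live_occupation x0 ?st" by (simp add: Lst)
    show "finite_measure (live_occupation x0 ?st)" using fin by (simp add: Lst)
    show "live_occupation x0 ?st = kernel_prod state_borel action_borel (distr (live_occupation x0 ?st) state_borel fst) \<pi>"
      unfolding Lst by (rule dis)
  qed
  \<comment> \<open>Summing \<open>split\<close> over all times gives a vanishing integral over
    \<open>?L\<close>.\<close>
  have zero_one: "AE z in ?L. emeasure (\<pi> (fst z)) B = 0 \<or> emeasure (\<pi> (fst z)) (topspace A - B) = 0"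
    if B: "B \<in> sets action_borel" for B
  proof -
    have C: "topspace A - B \<in> sets action_borel" using sets.compl_sets[OF B] by simp
    let ?h = "\<lambda>z. emeasure (\<pi> (fst z)) B * emeasure (\<pi> (fst z)) (topspace A - B)"
    have h: "?h \<in> borel_measurable pair_borel"
      using measurable_compose[OF measurable_fst measurable_kernel_emeasure[OF \<pi> B]]
        measurable_compose[OF measurable_fst measurable_kernel_emeasure[OF \<pi> C]]
      by (intro borel_measurable_times_ennreal)
    have "(\<integral>\<^sup>+z. ?h z \<partial>?L) = (\<Sum>n. \<integral>\<^sup>+z. alive (fst z) * ?h z \<partial>step_law x0 ?st n)"
      unfolding Lst[symmetric] by (rule nn_integral_live_occupation[OF st x0 h])
    then have "(\<integral>\<^sup>+z. ?h z \<partial>?L) = 0" by (simp add: split[OF B])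
    then show ?thesis
      using h by (subst (asm) nn_integral_0_iff_AE) (auto simp: measurable_cong_sets[OF sL refl])
  qed
  \<comment> \<open>Sublevel sets of the code at rational levels: countably many sets
    \<open>B\<close>, so one null set of states serves them all.\<close>
  define Bq where "Bq q = c -` {..q} \<inter> topspace A" for q :: real
  have Bq: "Bq q \<in> sets action_borel" for q
    unfolding Bq_def using measurable_sets[OF c(1), of "{..q}"] by simp
  have AEq: "AE z in ?L. \<forall>q\<in>\<rat>. emeasure (\<pi> (fst z)) (Bq q) = 0 \<or> emeasure (\<pi> (fst z)) (topspace A - Bq q) = 0"
    using zero_one[OF Bq] by (subst AE_ball_countable[OF countable_rat]) blast

  \<comment> \<open>If each rational half-line has mass 0 or 1, the code is almost surely constant
    and equals its mean. Defining \<open>\<phi>\<close> through the mean makes its measurability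
    immediate.\<close>
  define ce where "ce x = enn2real (\<integral>\<^sup>+a. ennreal (c a) \<partial>\<pi> x)" for x
  define \<phi> where "\<phi> x = (if x = None then ahat else d (ce x))" for x
  have ce_m: "ce \<in> borel_measurable state_borel"
  proof -
    have "(\<lambda>z. ennreal (c (snd z))) \<in> borel_measurable pair_borel" using c(1) by measurable
    from measurable_kernel_integral[OF \<pi> this] show ?thesis unfolding ce_def by simp
  qed
  have \<phi>: "\<phi> \<in> measurable state_borel action_borel"
  proof -
    have "(\<lambda>x. if x \<in> {None} then ahat else d (ce x)) \<in> measurable state_borel action_borel"
      using None_sets ahat_in measurable_compose[OF ce_m d(1)] by (intro measurable_If_set measurable_const) auto
    then show ?thesis by (simp add: \<phi>_def[abs_def])
  qed
  let ?N = "{z \<in> space pair_borel. snd z \<noteq> \<phi> (fst z)}"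
  note N = off_graph_sets[OF \<phi>]
  have concentrated: "AE a in \<pi> x. a = \<phi> x"
    if x: "x \<in> space state_borel" "x \<noteq> None"
      and q: "\<forall>q\<in>\<rat>. emeasure (\<pi> x) (Bq q) = 0 \<or> emeasure (\<pi> x) (topspace A - Bq q) = 0" for x
  proof -
    interpret prob_space "\<pi> x" by (rule prob_space_kernel_action[OF \<pi> x(1)])
    note s\<pi> = sets_kernel_action[OF \<pi> x(1)] and sp\<pi> = space_kernel_action[OF \<pi> x(1)]
    have finite: "(\<integral>\<^sup>+a. ennreal (c a) \<partial>\<pi> x) < \<top>"
    proof -
      have "(\<integral>\<^sup>+a. ennreal (c a) \<partial>\<pi> x) \<le> (\<integral>\<^sup>+a. 1 \<partial>\<pi> x)"
        using c(2) by (intro nn_integral_mono) (auto simp: ennreal_le_1)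
      then show ?thesis by (simp add: emeasure_space_1 le_less_trans)
    qed
    have ce: "ennreal (ce x) = (\<integral>\<^sup>+a. ennreal (c a) \<partial>\<pi> x)"
      unfolding ce_def using finite by (rule ennreal_enn2real)
    have ce0: "0 \<le> ce x" by (simp add: ce_def)
    have up: "ce x \<le> r" if "AE a in \<pi> x. c a \<le> r" for r
    proof -
      \<comment> \<open>Negative reals collapse to 0 in \<open>ennreal\<close>, so the sign of
        \<open>r\<close> is settled first.\<close>
      have "0 \<le> r"
      proof (rule ccontr)
        assume r: "\<not> 0 \<le> r"
        from that have "AE a in \<pi> x. False"
        proof eventually_elim
          case (elim a)
          then show ?case using c(2)[of a] r by simp
        qed
        then show False by simp
      qed
      have "(\<integral>\<^sup>+a. ennreal (c a) \<partial>\<pi> x) \<le> (\<integral>\<^sup>+a. ennreal r \<partial>\<pi> x)"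
        using that by (intro nn_integral_mono_AE) (auto intro: ennreal_leI)
      then show ?thesis unfolding ce[symmetric] using \<open>0 \<le> r\<close> by (simp add: emeasure_space_1)
    qed
    have lo: "r \<le> ce x" if "AE a in \<pi> x. r \<le> c a" for r
    proof -
      have "(\<integral>\<^sup>+a. ennreal r \<partial>\<pi> x) \<le> (\<integral>\<^sup>+a. ennreal (c a) \<partial>\<pi> x)"
        using that by (intro nn_integral_mono_AE) (auto intro: ennreal_leI)
      then show ?thesis unfolding ce[symmetric] using ce0 by (simp add: emeasure_space_1)
    qed
    \<comment> \<open>For each rational \<open>q\<close> the code is almost surely on one side of
      it, and then so is the mean; a rational strictly between code and mean is impossible.\<close>
    have "AE a in \<pi> x. \<forall>q\<in>\<rat>. (c a \<le> q \<longrightarrow> ce x \<le> q) \<and> (q < c a \<longrightarrow> q \<le> ce x)"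
    proof (subst AE_ball_countable[OF countable_rat], intro ballI)
      fix q :: real assume "q \<in> \<rat>"
      then consider "emeasure (\<pi> x) (Bq q) = 0" | "emeasure (\<pi> x) (topspace A - Bq q) = 0" using q by blast
      then show "AE a in \<pi> x. (c a \<le> q \<longrightarrow> ce x \<le> q) \<and> (q < c a \<longrightarrow> q \<le> ce x)"
      proof cases
        case 1
        have ae: "AE a in \<pi> x. q < c a"
          by (rule AE_I[OF _ 1]) (auto simp: Bq_def sp\<pi> s\<pi> Bq[unfolded Bq_def])
        then have "AE a in \<pi> x. q \<le> c a" by eventually_elim simp
        then have "q \<le> ce x" by (rule lo)
        then show ?thesis by (intro eventually_mono[OF ae]) auto
      next
        case 2
        have ae: "AE a in \<pi> x. c a \<le> q"
          by (rule AE_I[OF _ 2]) (use sets.compl_sets[OF Bq[of q]] in \<open>auto simp: Bq_def sp\<pi> s\<pi>\<close>)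
        then have "ce x \<le> q" by (rule up)
        then show ?thesis by (intro eventually_mono[OF ae]) auto
      qed
    qed
    then have "AE a in \<pi> x. c a = ce x"
    proof eventually_elim
      case (elim a)
      show ?case
      proof (rule ccontr)
        assume "c a \<noteq> ce x"
        then consider "c a < ce x" | "ce x < c a" by linarith
        then show False
        proof cases
          case 1
          then obtain q where "q \<in> \<rat>" "c a < q" "q < ce x" using Rats_dense_in_real by blast
          then show False using elim by force
        next
          case 2
          then obtain q where "q \<in> \<rat>" "ce x < q" "q < c a" using Rats_dense_in_real by blast
          then show False using elim by force
        qed
      qed
    qed
    then show ?thesis using AE_space
    proof eventually_elim
      case (elim a)
      then show ?case using d(2)[of a] x(2) by (auto simp: sp\<pi> \<phi>_def)
    qed
  qed
  \<comment> \<open>At almost every visited state \<open>\<pi>\<close> is Dirac at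
    \<open>\<phi>\<close> of that state, so \<open>?L\<close> does not charge pairs off the
    graph.\<close>
  have "emeasure ?L ?N = (\<integral>\<^sup>+z. indicator ?N z \<partial>kernel_prod state_borel action_borel (distr ?L state_borel fst) \<pi>)"
    using N sL dis by simp
  also have "\<dots> = (\<integral>\<^sup>+x. \<integral>\<^sup>+a. indicator ?N (x, a) \<partial>\<pi> x \<partial>distr ?L state_borel fst)"
    using N by (intro nn_integral_kernel_prod[OF \<pi>]) auto
  also have "\<dots> = (\<integral>\<^sup>+z. \<integral>\<^sup>+a. indicator ?N (fst z, a) \<partial>\<pi> (fst z) \<partial>?L)"
    using measurable_kernel_integral[OF \<pi> borel_measurable_indicator[OF N]]
    by (intro nn_integral_distr[OF mfst]) simp
  also have "\<dots> = (\<integral>\<^sup>+z. 0 \<partial>?L)"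
  proof (rule nn_integral_cong_AE)
    show "AE z in ?L. (\<integral>\<^sup>+a. indicator ?N (fst z, a) \<partial>\<pi> (fst z)) = (0 :: ennreal)"
      using AEq alive_AE AE_space
    proof eventually_elim
      case (elim z)
      have "AE a in \<pi> (fst z). a = \<phi> (fst z)"
        using elim measurable_space[OF mfst] by (intro concentrated) auto
      then have "AE a in \<pi> (fst z). indicator ?N (fst z, a) = (0 :: ennreal)"
        by eventually_elim simp
      then show ?case by (subst nn_integral_cong_AE[where v="\<lambda>_. 0"]) auto
    qed
  qed
  finally have null: "emeasure ?L ?N = 0" by simp
  define \<tau> where "\<tau> = (\<lambda>(n::nat) (h :: (nat \<Rightarrow> 'x option \<times> 'a) \<times> 'x option). return action_borel (\<phi> (snd h)))"
  have s\<tau>: "strategy \<tau>"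
    unfolding \<tau>_def
    by (rule strategy_markov) (use measurable_compose[OF \<phi> measurable_return_prob_space] ahat in \<open>auto simp: \<phi>_def\<close>)
  have "live_occupation x0 \<tau> = ?L"
    by (rule graph_occupation_eq[OF \<sigma> s\<tau> \<phi> _ fin null]) (simp add: \<tau>_def)
  then have "M = occupation_measure x0 \<tau>"
    unfolding M_eq by (intro occupation_measure_eqI[OF x0 \<sigma> s\<tau>]) simp
  moreover have "deterministic_stationary_strategy \<tau>"
    unfolding deterministic_stationary_strategy_def using s\<tau> \<phi> by (auto simp: \<tau>_def)
  ultimately show ?thesis by blast
qed

end

end

theorem theorem1:
  fixes X :: "'x topology" and A :: "'a topology"
    and p :: "'x option \<times> 'a \<Rightarrow> 'x option measure"
    and ahat :: 'a and x0 :: 'x and M :: "('x \<times> 'a) measure"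
  assumes "topological_borel_space TYPE('p::polish_space) X"
    and "topological_borel_space TYPE('q::polish_space) A"
    and "cemetery_mdp X A p ahat"
    and "x0 \<in> topspace X"
    and "M \<in> cemetery_mdp.finite_occupation_measures X A p ahat x0"
  shows "measure M extreme_point_of
           (measure ` cemetery_mdp.finite_occupation_measures X A p ahat x0)
     \<longleftrightarrow> (\<exists>\<sigma>. cemetery_mdp.deterministic_stationary_strategy X A ahat \<sigma>
              \<and> M = cemetery_mdp.occupation_measure X A p x0 \<sigma>)"
proof -
  interpret cemetery_mdp X A p ahat by fact
  have x0: "{Some x0} \<in> sets state_borel" by (rule singleton_Some_sets[OF assms(1,4)])
  obtain c :: "'a \<Rightarrow> real" and d where cd: "c \<in> borel_measurable action_borel" "\<And>a. c a \<in> {0..1}"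
    "d \<in> measurable borel action_borel" "\<And>a. a \<in> topspace A \<Longrightarrow> d (c a) = a"
    using topological_borel_space_real_code[OF assms(2) ahat_in] by metis
  show ?thesis
    using extreme_imp_deterministic_stationary[OF assms(4) x0 cd assms(5)]
      deterministic_stationary_extreme[OF assms(4) x0 cd] assms(5) by blast
qed

end
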